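(* Let $G=(V,E)$ be a decomposable graph with cliques $C_1,\dots,C_k$ in a perfect order, and consider the multinomial model with $N\ge 1$ trials and strictly positive cell-probability vector $p$, Markov with respect to $G$, parametrized by $$p^{cond}=\big(p^{C_1};\ p^{R_l|i_{S_l}},\ i_{S_l}\in\mathcal I_{S_l},\ l=2,\dots,k\big),$$ where $p^{C_1}=(p^{C_1}(i_{C_1}))_{i_{C_1}\in\mathcal I_{C_1}}$ and $p^{R_l|i_{S_l}}=(p^{R_l|i_{S_l}}(i_{R_l}))_{i_{R_l}\in\mathcal I_{R_l}}$. Then the reference prior for $p^{cond}$ relative to the grouping whose $1+\sum_{l=2}^k|\mathcal I_{S_l}|$ groups are the vectors $p^{C_1}$ and $p^{R_l|i_{S_l}}$ ($i_{S_l}\in\mathcal I_{S_l}$, $l=2,\dots,k$), taken in any order, is $$\pi^R_{p^{cond}}(p^{cond})\ \propto\ \Big(\prod_{i_{C_1}\in\mathcal I_{C_1}}p^{C_1}(i_{C_1})\Big)^{-1/2}\ \prod_{l=2}^k\ \prod_{i_{S_l}\in\mathcal I_{S_l}}\Big(\prod_{i_{R_l}\in\mathcal I_{R_l}}p^{R_l|i_{S_l}}(i_{R_l})\Big)^{-1/2}.$$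
   Context: $V$ is a finite nonempty set. For each $\gamma\in V$, $\mathcal I_\gamma$ is a finite set of levels; $\mathcal I=\prod_{\gamma\in V}\mathcal I_\gamma$, $\mathcal I_D=\prod_{\gamma\in D}\mathcal I_\gamma$, $i_D$ denotes restriction to $D$. The data are counts $n=(n(i))_{i\in\mathcal I}$ with $\sum_i n(i)=N$, with likelihood $\prod_i p(i)^{n(i)}$ (up to the multinomial coefficient). $p^D(i_D)=\sum_{j\in\mathcal I:j_D=i_D}p(j)$ and $p^{A|i_B}(i_A)=p^{A\cup B}(i_A,i_B)/p^B(i_B)$. For an ordering $C_1,\dots,C_k$ of the cliques (maximal complete subsets), $H_l=\bigcup_{j\le l}C_j$, and for $l\ge2$, $S_l=H_{l-1}\cap C_l$, $R_l=C_l\setminus S_l$. The order is perfect if for each $l>1$ there is $i<l$ with $S_l\subseteq C_i$. $p$ is Markov with respect to $G$ if $X_\gamma, X_\delta$ are conditionally independent given the remaining variables whenever $\gamma\neq\delta$ and $\{\gamma,\delta\}\notin E$; then $p(i)=p^{C_1}(i_{C_1})\prod_{l=2}^kp^{R_l|i_{S_l}}(i_{R_l})$, and the groups of $p^{cond}$ vary freely and independently, each in an open probability simplex (each simplex is coordinatized by all but one of its entries; densities are with respect to Lebesgue measure in these coordinates). Reference prior (Berger–Bernardo) relative to ordered groups: for a parameter $\lambda=(\lambda_1,\dots,\lambda_m)$ divided into ordered groups, let $I(\lambda)$ be the Fisher information matrix (of one observation of the data $n$), $\Sigma=I^{-1}$, $\Sigma_j$ the upper-left block of $\Sigma$ for $(\lambda_1,\dots,\lambda_j)$,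 and $h_j(\lambda)$ the lower-right block of $\Sigma_j^{-1}$ corresponding to $\lambda_j$. Define conditional densities recursively for $j=m,m-1,\dots,1$: $$\pi(\lambda_j\mid\lambda_1,\dots,\lambda_{j-1})\propto\exp\Big\{\tfrac12\,E\big[\log\det h_j(\lambda)\mid\lambda_1,\dots,\lambda_j\big]\Big\},$$ normalized in $\lambda_j$, where the expectation is over $(\lambda_{j+1},\dots,\lambda_m)$ under the already constructed $\prod_{r>j}\pi(\lambda_r|\lambda_1,\dots,\lambda_{r-1})$. The reference prior is $\pi^R(\lambda)=\prod_j\pi(\lambda_j|\lambda_1,\dots,\lambda_{j-1})$. (All the normalizing constants and expectations needed are finite here, so no limiting sequence of compact sets is required.) *)

theory Defs
  imports
    "HOL-Analysis.Analysis"
    "Jordan_Normal_Form.Gauss_Jordan_Elimination"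
    "Jordan_Normal_Form.Determinant"
begin

section \<open>Decomposable graphs and perfect orders of the cliques\<close>

text \<open>A simple undirected graph is a vertex set together with a symmetric, irreflexive edge
  relation \<open>E\<close>; the subgraph induced by \<open>U\<close> is the pair \<open>(U, E)\<close>, edges outside \<open>U\<close> being
  ignored.\<close>

definition complete_set :: "'v rel \<Rightarrow> 'v set \<Rightarrow> bool" where
  "complete_set E U \<longleftrightarrow> (\<forall>x\<in>U. \<forall>y\<in>U. x \<noteq> y \<longrightarrow> (x, y) \<in> E)"

definition cliques :: "'v set \<Rightarrow> 'v rel \<Rightarrow> 'v set set" where
  "cliques V E =
    {C. C \<subseteq> V \<and> complete_set E C \<and> (\<forall>D. C \<subseteq> D \<and> D \<subseteq> V \<and> complete_set E D \<longrightarrow> D = C)}"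

text \<open>\<open>C\<close> separates \<open>A\<close> from \<open>B\<close> in the subgraph induced by \<open>U\<close>: every path in it from \<open>A\<close> to
  \<open>B\<close> meets \<open>C\<close>.\<close>

definition separates :: "'v rel \<Rightarrow> 'v set \<Rightarrow> 'v set \<Rightarrow> 'v set \<Rightarrow> 'v set \<Rightarrow> bool" where
  "separates E U C A B \<longleftrightarrow> (\<forall>a\<in>A. \<forall>b\<in>B. (a, b) \<notin> (Restr E (U - C))\<^sup>*)"

inductive decomposable :: "'v rel \<Rightarrow> 'v set \<Rightarrow> bool" for E where
  complete: "complete_set E U \<Longrightarrow> decomposable E U"
| decompose: "\<lbrakk>U = A \<union> B \<union> C; A \<inter> B = {}; A \<inter> C = {}; B \<inter> C = {}; A \<noteq> {}; B \<noteq> {};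
    complete_set E C; separates E U C A B;
    decomposable E (A \<union> C); decomposable E (B \<union> C)\<rbrakk> \<Longrightarrow> decomposable E U"

text \<open>The cliques \<open>C\<^sub>1, \<dots>, C\<^sub>k\<close> are the entries \<open>Cs ! 0, \<dots>, Cs ! (k - 1)\<close> of a list.  The
  separator at position \<open>0\<close> is empty, hence the residual there is \<open>C\<^sub>1\<close>.\<close>

definition separator :: "'v set list \<Rightarrow> nat \<Rightarrow> 'v set" where
  "separator Cs l = (\<Union>j<l. Cs ! j) \<inter> Cs ! l"

definition residual :: "'v set list \<Rightarrow> nat \<Rightarrow> 'v set" where
  "residual Cs l = Cs ! l - separator Cs l"

definition perfect_clique_order :: "'v set \<Rightarrow> 'v rel \<Rightarrow> 'v set list \<Rightarrow> bool" where
  "perfect_clique_order V E Cs \<longleftrightarrow>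
    distinct Cs \<and> set Cs = cliques V E \<and>
    (\<forall>l. 0 < l \<and> l < length Cs \<longrightarrow> (\<exists>i<l. separator Cs l \<subseteq> Cs ! i))"


section \<open>The Markov model and its parametrization by conditional probabilities\<close>

text \<open>The cells over \<open>D\<close> are the elements of \<open>Pi\<^sub>E D L\<close>, where \<open>L \<gamma>\<close> is the set of levels of
  \<open>\<gamma>\<close>, and \<open>i\<^sub>D\<close> is \<open>restrict i D\<close>.\<close>

definition marginal ::
    "'v set \<Rightarrow> ('v \<Rightarrow> 'l set) \<Rightarrow> 'v set \<Rightarrow> (('v \<Rightarrow> 'l) \<Rightarrow> real) \<Rightarrow> ('v \<Rightarrow> 'l) \<Rightarrow> real" where
  "marginal V L D p d = (\<Sum>j \<in> {j \<in> Pi\<^sub>E V L. restrict j D = d}. p j)"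

definition conditional ::
    "'v set \<Rightarrow> ('v \<Rightarrow> 'l set) \<Rightarrow> 'v set \<Rightarrow> 'v set \<Rightarrow> (('v \<Rightarrow> 'l) \<Rightarrow> real) \<Rightarrow>
     ('v \<Rightarrow> 'l) \<Rightarrow> ('v \<Rightarrow> 'l) \<Rightarrow> real" where
  "conditional V L A B p a b =
    marginal V L (A \<union> B) p (merge A B (a, b)) / marginal V L B p b"

definition markov :: "'v set \<Rightarrow> 'v rel \<Rightarrow> ('v \<Rightarrow> 'l set) \<Rightarrow> (('v \<Rightarrow> 'l) \<Rightarrow> real) \<Rightarrow> bool" where
  "markov V E L p \<longleftrightarrow>
    (\<forall>\<gamma>\<in>V. \<forall>\<delta>\<in>V. \<gamma> \<noteq> \<delta> \<and> (\<gamma>, \<delta>) \<notin> E \<longrightarrow>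
      (\<forall>i\<in>Pi\<^sub>E V L. let W = V - {\<gamma>, \<delta>} in
        conditional V L {\<gamma>, \<delta>} W p (restrict i {\<gamma>, \<delta>}) (restrict i W) =
        conditional V L {\<gamma>} W p (restrict i {\<gamma>}) (restrict i W) *
        conditional V L {\<delta>} W p (restrict i {\<delta>}) (restrict i W)))"

definition markov_model :: "'v set \<Rightarrow> 'v rel \<Rightarrow> ('v \<Rightarrow> 'l set) \<Rightarrow> (('v \<Rightarrow> 'l) \<Rightarrow> real) set" where
  "markov_model V E L =
    {p \<in> Pi\<^sub>E (Pi\<^sub>E V L) (\<lambda>_. {0<..}). (\<Sum>i\<in>Pi\<^sub>E V L. p i) = 1 \<and> markov V E L p}"

text \<open>The group \<open>(l, s)\<close> stands for the vector of conditional probabilities of the residual at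
  position \<open>l\<close> given the value \<open>s\<close> on the separator.  At position \<open>0\<close> the separator is empty and
  the only group is the vector of marginal probabilities for the first clique.\<close>

definition cond_groups ::
    "('v \<Rightarrow> 'l set) \<Rightarrow> 'v set list \<Rightarrow> (nat \<times> ('v \<Rightarrow> 'l)) set" where
  "cond_groups L Cs = (SIGMA l:{..<length Cs}. Pi\<^sub>E (separator Cs l) L)"

text \<open>The entries of a group sum to one; its coordinates are all its entries except the one at
  the cell \<open>omit g\<close>.\<close>

definition group_coords ::
    "('v \<Rightarrow> 'l set) \<Rightarrow> 'v set list \<Rightarrow> (nat \<times> ('v \<Rightarrow> 'l) \<Rightarrow> 'v \<Rightarrow> 'l) \<Rightarrow>
     nat \<times> ('v \<Rightarrow> 'l) \<Rightarrow> ((nat \<times> ('v \<Rightarrow> 'l)) \<times> ('v \<Rightarrow> 'l)) set" where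
  "group_coords L Cs omit g = {g} \<times> (Pi\<^sub>E (residual Cs (fst g)) L - {omit g})"

definition cond_coords ::
    "('v \<Rightarrow> 'l set) \<Rightarrow> 'v set list \<Rightarrow> (nat \<times> ('v \<Rightarrow> 'l) \<Rightarrow> 'v \<Rightarrow> 'l) \<Rightarrow>
     ((nat \<times> ('v \<Rightarrow> 'l)) \<times> ('v \<Rightarrow> 'l)) set" where
  "cond_coords L Cs omit = (\<Union>g\<in>cond_groups L Cs. group_coords L Cs omit g)"

definition p_cond ::
    "'v set \<Rightarrow> ('v \<Rightarrow> 'l set) \<Rightarrow> 'v set list \<Rightarrow> (nat \<times> ('v \<Rightarrow> 'l) \<Rightarrow> 'v \<Rightarrow> 'l) \<Rightarrow>
     (('v \<Rightarrow> 'l) \<Rightarrow> real) \<Rightarrow> (nat \<times> ('v \<Rightarrow> 'l)) \<times> ('v \<Rightarrow> 'l) \<Rightarrow> real" where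
  "p_cond V L Cs omit p =
    (\<lambda>((l, s), r) \<in> cond_coords L Cs omit.
      conditional V L (residual Cs l) (separator Cs l) p r s)"

definition cond_space ::
    "'v set \<Rightarrow> 'v rel \<Rightarrow> ('v \<Rightarrow> 'l set) \<Rightarrow> 'v set list \<Rightarrow> (nat \<times> ('v \<Rightarrow> 'l) \<Rightarrow> 'v \<Rightarrow> 'l) \<Rightarrow>
     ((nat \<times> ('v \<Rightarrow> 'l)) \<times> ('v \<Rightarrow> 'l) \<Rightarrow> real) set" where
  "cond_space V E L Cs omit = p_cond V L Cs omit ` markov_model V E L"

definition cell_prob ::
    "'v set \<Rightarrow> 'v rel \<Rightarrow> ('v \<Rightarrow> 'l set) \<Rightarrow> 'v set list \<Rightarrow> (nat \<times> ('v \<Rightarrow> 'l) \<Rightarrow> 'v \<Rightarrow> 'l) \<Rightarrow>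
     ((nat \<times> ('v \<Rightarrow> 'l)) \<times> ('v \<Rightarrow> 'l) \<Rightarrow> real) \<Rightarrow> ('v \<Rightarrow> 'l) \<Rightarrow> real" where
  "cell_prob V E L Cs omit = the_inv_into (markov_model V E L) (p_cond V L Cs omit)"

definition count_vectors :: "'c set \<Rightarrow> nat \<Rightarrow> ('c \<Rightarrow> nat) set" where
  "count_vectors I N = {n \<in> Pi\<^sub>E I (\<lambda>_. {..N}). (\<Sum>i\<in>I. n i) = N}"

definition multinomial_prob :: "'c set \<Rightarrow> nat \<Rightarrow> ('c \<Rightarrow> real) \<Rightarrow> ('c \<Rightarrow> nat) \<Rightarrow> real" where
  "multinomial_prob I N p n = fact N / (\<Prod>i\<in>I. fact (n i)) * (\<Prod>i\<in>I. p i ^ n i)"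


section \<open>Reference priors relative to ordered groups\<close>

text \<open>Parameters are functions on a finite set of coordinates, extended by \<open>undefined\<close>.  A
  statistical model on a finite sample space \<open>D\<close> is given by its probability function
  \<open>f x n\<close>, the parameter being \<open>x\<close>.\<close>

definition partial_deriv :: "'j \<Rightarrow> (('j \<Rightarrow> real) \<Rightarrow> real) \<Rightarrow> ('j \<Rightarrow> real) \<Rightarrow> real" where
  "partial_deriv a F x = deriv (\<lambda>t. F (x(a := t))) (x a)"

definition fisher_info ::
    "'d set \<Rightarrow> (('j \<Rightarrow> real) \<Rightarrow> 'd \<Rightarrow> real) \<Rightarrow> ('j \<Rightarrow> real) \<Rightarrow> 'j \<Rightarrow> 'j \<Rightarrow> real" where
  "fisher_info D f x a b =
    (\<Sum>n\<in>D. f x n * (partial_deriv a (\<lambda>y. ln (f y n)) x * partial_deriv b (\<lambda>y. ln (f y n)) x))"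

definition fisher_matrix ::
    "'d set \<Rightarrow> (('j \<Rightarrow> real) \<Rightarrow> 'd \<Rightarrow> real) \<Rightarrow> 'j list \<Rightarrow> ('j \<Rightarrow> real) \<Rightarrow> real Matrix.mat" where
  "fisher_matrix D f js x =
    Matrix.mat (length js) (length js) (\<lambda>(a, b). fisher_info D f x (js ! a) (js ! b))"

text \<open>The groups are the entries \<open>Gs ! 0, \<dots>, Gs ! (m - 1)\<close> of a list, each group being a list of
  coordinates.  The rows and columns of the Fisher information matrix follow \<open>concat Gs\<close>, so
  that every group is a block of consecutive indices.\<close>

definition h_block ::
    "'d set \<Rightarrow> (('j \<Rightarrow> real) \<Rightarrow> 'd \<Rightarrow> real) \<Rightarrow> 'j list list \<Rightarrow> nat \<Rightarrow> ('j \<Rightarrow> real) \<Rightarrow>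
     real Matrix.mat" where
  "h_block D f Gs j x =
    (let before = length (concat (take j Gs));
         upto_j = length (concat (take (Suc j) Gs));
         \<Sigma> = the (mat_inverse (fisher_matrix D f (concat Gs) x));
         (\<Sigma>\<^sub>j, _, _, _) = split_block \<Sigma> upto_j upto_j;
         (_, _, _, h) = split_block (the (mat_inverse \<Sigma>\<^sub>j)) before before
     in h)"

definition coords_before :: "'j list list \<Rightarrow> nat \<Rightarrow> 'j set" where
  "coords_before Gs j = set (concat (take j Gs))"

definition coords_from :: "'j list list \<Rightarrow> nat \<Rightarrow> 'j set" where
  "coords_from Gs j = set (concat (drop j Gs))"

definition coord_lebesgue :: "'j set \<Rightarrow> ('j \<Rightarrow> real) measure" where
  "coord_lebesgue A = Pi\<^sub>M A (\<lambda>_. lborel)"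

text \<open>\<open>q r\<close> is the conditional density of the group at position \<open>r\<close> given the preceding groups,
  as a function of the whole parameter.  The integral of \<open>later_integrand \<dots> x\<close> is the
  conditional expectation of \<open>log det h\<^sub>j\<close> given the groups up to and including position \<open>j\<close>.  It
  and \<open>ref_weight \<dots> x\<close> only depend on the coordinates of \<open>x\<close> in those groups.\<close>

definition later_integrand ::
    "'d set \<Rightarrow> (('j \<Rightarrow> real) \<Rightarrow> 'd \<Rightarrow> real) \<Rightarrow> ('j \<Rightarrow> real) set \<Rightarrow> 'j list list \<Rightarrow>
     (nat \<Rightarrow> ('j \<Rightarrow> real) \<Rightarrow> real) \<Rightarrow> nat \<Rightarrow> ('j \<Rightarrow> real) \<Rightarrow> ('j \<Rightarrow> real) \<Rightarrow> real" where
  "later_integrand D f \<Theta> Gs q j x \<nu> =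
    (let y = merge (coords_before Gs (Suc j)) (coords_from Gs (Suc j)) (x, \<nu>)
     in indicator \<Theta> y * (\<Prod>r\<in>{j<..<length Gs}. q r y) *
        ln (Determinant.det (h_block D f Gs j y)))"

definition ref_weight ::
    "'d set \<Rightarrow> (('j \<Rightarrow> real) \<Rightarrow> 'd \<Rightarrow> real) \<Rightarrow> ('j \<Rightarrow> real) set \<Rightarrow> 'j list list \<Rightarrow>
     (nat \<Rightarrow> ('j \<Rightarrow> real) \<Rightarrow> real) \<Rightarrow> nat \<Rightarrow> ('j \<Rightarrow> real) \<Rightarrow> real" where
  "ref_weight D f \<Theta> Gs q j x =
    exp (1 / 2 * (\<integral>\<nu>. later_integrand D f \<Theta> Gs q j x \<nu> \<partial>coord_lebesgue (coords_from Gs (Suc j))))"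

text \<open>Given the preceding groups of \<open>x\<close>, the group at position \<open>j\<close> ranges over the section of the
  projection of \<open>\<Theta>\<close> to the groups up to and including position \<open>j\<close>.\<close>

definition group_integrand ::
    "'d set \<Rightarrow> (('j \<Rightarrow> real) \<Rightarrow> 'd \<Rightarrow> real) \<Rightarrow> ('j \<Rightarrow> real) set \<Rightarrow> 'j list list \<Rightarrow>
     (nat \<Rightarrow> ('j \<Rightarrow> real) \<Rightarrow> real) \<Rightarrow> nat \<Rightarrow> ('j \<Rightarrow> real) \<Rightarrow> ('j \<Rightarrow> real) \<Rightarrow> real" where
  "group_integrand D f \<Theta> Gs q j x \<mu> =
    (let z = merge (coords_before Gs j) (set (Gs ! j)) (x, \<mu>)
     in indicator ((\<lambda>y. restrict y (coords_before Gs (Suc j))) ` \<Theta>) z *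
        ref_weight D f \<Theta> Gs q j z)"

text \<open>The integrability, positivity and invertibility conditions say that all the expectations and
  normalizing constants are finite and that the information matrix is invertible.  The equations
  determine \<open>q j\<close> on \<open>\<Theta>\<close> recursively for \<open>j = m - 1, m - 2, \<dots>, 0\<close>, since \<open>ref_weight\<close> at
  position \<open>j\<close> only uses \<open>q r\<close> on \<open>\<Theta>\<close> for \<open>r > j\<close>.\<close>

definition is_reference_prior ::
    "'d set \<Rightarrow> (('j \<Rightarrow> real) \<Rightarrow> 'd \<Rightarrow> real) \<Rightarrow> ('j \<Rightarrow> real) set \<Rightarrow> 'j list list \<Rightarrow>
     (('j \<Rightarrow> real) \<Rightarrow> real) \<Rightarrow> bool" where
  "is_reference_prior D f \<Theta> Gs \<pi> \<longleftrightarrow>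
    (\<forall>x\<in>\<Theta>. invertible_mat (fisher_matrix D f (concat Gs) x)) \<and>
    (\<exists>q.
      (\<forall>j<length Gs. \<forall>x\<in>\<Theta>.
        integrable (coord_lebesgue (coords_from Gs (Suc j))) (later_integrand D f \<Theta> Gs q j x) \<and>
        integrable (coord_lebesgue (set (Gs ! j))) (group_integrand D f \<Theta> Gs q j x) \<and>
        (\<integral>\<mu>. group_integrand D f \<Theta> Gs q j x \<mu> \<partial>coord_lebesgue (set (Gs ! j))) > 0 \<and>
        q j x = ref_weight D f \<Theta> Gs q j x /
          (\<integral>\<mu>. group_integrand D f \<Theta> Gs q j x \<mu> \<partial>coord_lebesgue (set (Gs ! j)))) \<and>
      (\<forall>x\<in>\<Theta>. \<pi> x = (\<Prod>j<length Gs. q j x)))"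

end

theory Submission
  imports Defs
begin

text \<open>A positive distribution is Markov with respect to \<open>G\<close> iff the mixed differences of its
  logarithm vanish for non-adjacent pairs.  Along a perfect order this property passes from the
  marginal on \<open>H\<^sub>l\<close> to the one on \<open>H\<^bsub>l-1\<^esub>\<close> and makes \<open>R\<^sub>l\<close> independent of
  \<open>H\<^bsub>l-1\<^esub>\<close> given \<open>S\<^sub>l\<close>, so the Markov model is the product of the open simplices of
  conditional probabilities.  In these coordinates scores of different groups are uncorrelated,
  hence the Fisher matrix is block diagonal; the block of the group \<open>(l, s)\<close> is
  \<open>N p(s) (diag (1/x) + 1/x\<^sub>0)\<close>, where \<open>x\<^sub>0\<close> is the omitted entry, and its determinant is a power
  of \<open>N p(s)\<close> divided by the product of all entries of the group.  The separator probability
  \<open>p(s)\<close> does not involve the group itself, so it cancels when the weight of the group is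
  normalized, for every order of the groups.\<close>

section \<open>Fisher information of the multinomial model\<close>

text \<open>The order of the groups is unrelated to the order of the cliques, so the separator
  probability \<open>p(s)\<close> may involve groups listed later as well as earlier. The later ones
  make the recursion ask for a conditional mean of \<open>ln p(s)\<close>, which is unbounded near
  the boundary of the simplices, and the definition of a reference prior includes its integrability.
  A crude bound gives it: \<open>p(s)\<close> is at least the product of all entries of all groups.
  The earlier ones enter only through a factor that normalization removes. Run from the last group,
  the recursion therefore returns at each stage a Dirichlet density with all parameters 1/2 that
  ignores the other groups, and this invariant keeps the next expectation tractable.

  The cell probabilities are defined as an inverse function on the model. Nothing can be computed
  from it until an explicit inverse is exhibited, the product of the conditional probabilities along
  the cliques, and derivatives also need a whole neighbourhood to stay in the parameter
  space.\<close>

lemma finite_count_vectors: "finite I \<Longrightarrow> finite (count_vectors I N)"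
  by (rule finite_subset[of _ "Pi\<^sub>E I (\<lambda>_. {..N})"]) (auto simp: count_vectors_def intro: finite_PiE)

lemma count_vectors_increment:
  assumes "finite I" "i \<in> I" "m \<in> count_vectors I N"
  shows "m(i := Suc (m i)) \<in> count_vectors I (Suc N)"
proof -
  have s: "(\<Sum>k\<in>I. m k) = N" and m: "m \<in> Pi\<^sub>E I (\<lambda>_. {..N})"
    using assms by (auto simp: count_vectors_def)
  have "(\<Sum>k\<in>I. (m(i := Suc (m i))) k) = Suc (m i) + (\<Sum>k\<in>I - {i}. m k)"
    using assms(1,2) by (subst sum.remove[of _ i]) auto
  also have "\<dots> = Suc N"
    using assms(1,2) s by (simp add: sum.remove[of I i])
  finally have *: "(\<Sum>k\<in>I. (m(i := Suc (m i))) k) = Suc N" .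
  moreover have "m(i := Suc (m i)) \<in> Pi\<^sub>E I (\<lambda>_. {..Suc N})"
    using m assms(2) by (fastforce simp: PiE_iff extensional_def)
  ultimately show ?thesis by (simp add: count_vectors_def)
qed

lemma count_vectors_decrement:
  assumes "finite I" "i \<in> I" "n \<in> count_vectors I (Suc N)" "n i > 0"
  shows "n(i := n i - 1) \<in> count_vectors I N"
proof -
  have s: "(\<Sum>k\<in>I. n k) = Suc N" and n: "n \<in> Pi\<^sub>E I (\<lambda>_. {..Suc N})"
    using assms by (auto simp: count_vectors_def)
  have "(\<Sum>k\<in>I. (n(i := n i - 1)) k) = (n i - 1) + (\<Sum>k\<in>I - {i}. n k)"
    using assms(1,2) by (subst sum.remove[of _ i]) auto
  also have "\<dots> = N"
    using assms(1,2,4) s by (simp add: sum.remove[of I i])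
  finally have *: "(\<Sum>k\<in>I. (n(i := n i - 1)) k) = N" .
  have "(n(i := n i - 1)) k \<le> N" if "k \<in> I" for k
    using member_le_sum[of k I "n(i := n i - 1)"] that assms(1) * by simp
  then have "n(i := n i - 1) \<in> Pi\<^sub>E I (\<lambda>_. {..N})"
    using n assms(2) by (auto simp: PiE_iff extensional_def)
  then show ?thesis using * by (simp add: count_vectors_def)
qed

text \<open>Both sides are the probability that \<open>Suc N\<close> trials give the counts
  \<open>m(i := Suc (m i))\<close> and that one fixed trial falls in cell \<open>i\<close>.\<close>

lemma multinomial_prob_increment:
  assumes "finite I" "i \<in> I"
  shows "real (Suc (m i)) / real (Suc N) * multinomial_prob I (Suc N) p (m(i := Suc (m i))) =
    p i * multinomial_prob I N p m"
proof -
  let ?A = "\<Prod>k\<in>I - {i}. fact (m k) :: real" and ?B = "\<Prod>k\<in>I - {i}. p k ^ m k"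
  have A0: "?A \<noteq> 0" using assms by simp
  have 1: "(\<Prod>k\<in>I. fact ((m(i := Suc (m i))) k)) = fact (Suc (m i)) * ?A"
    using assms by (subst prod.remove[of _ i]) auto
  have 2: "(\<Prod>k\<in>I. p k ^ (m(i := Suc (m i))) k) = p i ^ Suc (m i) * ?B"
    using assms by (subst prod.remove[of _ i]) auto
  have 3: "(\<Prod>k\<in>I. fact (m k)) = fact (m i) * ?A" "(\<Prod>k\<in>I. p k ^ m k) = p i ^ m i * ?B"
    using assms by (auto simp: prod.remove[of I i])
  have f: "fact (m i) \<noteq> (0::real)" by simp
  show ?thesis
    unfolding multinomial_prob_def 1 2 3 using A0
    by (simp add: divide_simps del: of_nat_Suc)
qed

text \<open>Conditions on the cell of a single trial. This turns moments of the counts into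
  inductions on \<open>N\<close>.\<close>

lemma sum_multinomial_Suc:
  assumes "finite I"
  shows "(\<Sum>n\<in>count_vectors I (Suc N). multinomial_prob I (Suc N) p n * F n) =
    (\<Sum>i\<in>I. p i * (\<Sum>n\<in>count_vectors I N. multinomial_prob I N p n * F (n(i := Suc (n i)))))"
proof -
  let ?P = "\<lambda>n. multinomial_prob I (Suc N) p n * F n"
  \<comment> \<open>The weights \<open>n i / Suc N\<close> sum to one over \<open>i\<close>; they
    are the conditional probabilities of the cell of one trial given the counts.\<close>
  have "(\<Sum>n\<in>count_vectors I (Suc N). ?P n) =
      (\<Sum>n\<in>count_vectors I (Suc N). \<Sum>i\<in>I. real (n i) / real (Suc N) * ?P n)"
  proof (rule sum.cong[OF refl])
    fix n assume "n \<in> count_vectors I (Suc N)"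
    then have "(\<Sum>i\<in>I. real (n i)) = real (Suc N)"
      by (simp add: count_vectors_def flip: of_nat_sum)
    then show "?P n = (\<Sum>i\<in>I. real (n i) / real (Suc N) * ?P n)"
      by (simp del: of_nat_Suc flip: sum_distrib_right sum_divide_distrib)
  qed
  also have "\<dots> = (\<Sum>i\<in>I. \<Sum>n\<in>count_vectors I (Suc N). real (n i) / real (Suc N) * ?P n)"
    by (rule sum.swap)
  also have "\<dots> = (\<Sum>i\<in>I. p i * (\<Sum>n\<in>count_vectors I N. multinomial_prob I N p n * F (n(i := Suc (n i)))))"
  proof (rule sum.cong[OF refl])
    fix i assume i: "i \<in> I"
    \<comment> \<open>Counts with \<open>n i = 0\<close> have weight zero; without them the
      truncated \<open>n i - 1\<close> can be undone.\<close>
    have "(\<Sum>n\<in>count_vectors I (Suc N). real (n i) / real (Suc N) * ?P n) =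
        (\<Sum>n\<in>{n \<in> count_vectors I (Suc N). n i > 0}. real (n i) / real (Suc N) * ?P n)"
      using finite_count_vectors[OF assms] by (intro sum.mono_neutral_right) auto
    also have "\<dots> = (\<Sum>n\<in>count_vectors I N. p i * (multinomial_prob I N p n * F (n(i := Suc (n i)))))"
    proof (rule sum.reindex_bij_witness[where i = "\<lambda>m. m(i := Suc (m i))" and j = "\<lambda>n. n(i := n i - 1)"])
      fix n assume n: "n \<in> {n \<in> count_vectors I (Suc N). n i > 0}"
      then show e: "(n(i := n i - 1))(i := Suc ((n(i := n i - 1)) i)) = n" by auto
      show "n(i := n i - 1) \<in> count_vectors I N"
        using n count_vectors_decrement[OF assms i] by auto
      show "p i * (multinomial_prob I N p (n(i := n i - 1)) * F ((n(i := n i - 1))(i := Suc ((n(i := n i - 1)) i)))) =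
          real (n i) / real (Suc N) * ?P n"
      proof -
        have "Suc ((n(i := n i - 1)) i) = n i" using n by simp
        then have "p i * multinomial_prob I N p (n(i := n i - 1)) =
            real (n i) / real (Suc N) * multinomial_prob I (Suc N) p n"
          using multinomial_prob_increment[OF assms i, of "n(i := n i - 1)" N p] unfolding e by simp
        then show ?thesis unfolding e by (metis mult.assoc)
      qed
    next
      fix m assume "m \<in> count_vectors I N"
      then show "m(i := Suc (m i)) \<in> {n \<in> count_vectors I (Suc N). n i > 0}"
        using count_vectors_increment[OF assms i] by auto
    qed auto
    finally show "(\<Sum>n\<in>count_vectors I (Suc N). real (n i) / real (Suc N) * ?P n) =
        p i * (\<Sum>n\<in>count_vectors I N. multinomial_prob I N p n * F (n(i := Suc (n i))))"
      by (simp add: sum_distrib_left)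
  qed
  finally show ?thesis .
qed

section \<open>Moments of multinomial counts\<close>

lemma count_vectors_0: "count_vectors I 0 = {\<lambda>i\<in>I. 0}" if "finite I"
  using that by (auto simp: count_vectors_def PiE_iff extensional_def restrict_def fun_eq_iff)

lemma sum_increment:
  fixes c :: "'c \<Rightarrow> real"
  assumes "finite I" "i \<in> I"
  shows "(\<Sum>k\<in>I. real ((n(i := Suc (n i))) k) * c k) = (\<Sum>k\<in>I. real (n k) * c k) + c i"
  using assms by (simp add: sum.remove[of I i] algebra_simps)

lemma multinomial_prob_sum:
  assumes "finite I" "(\<Sum>i\<in>I. p i) = 1"
  shows "(\<Sum>n\<in>count_vectors I N. multinomial_prob I N p n) = 1"
proof (induction N)
  case 0
  show ?case using assms by (simp add: count_vectors_0 multinomial_prob_def)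
next
  case (Suc N)
  then show ?case
    using sum_multinomial_Suc[OF assms(1), of N p "\<lambda>_. 1"] assms(2) by simp
qed

lemma multinomial_mean:
  assumes "finite I" "(\<Sum>i\<in>I. p i) = 1" "(\<Sum>i\<in>I. p i * c i) = 0"
  shows "(\<Sum>n\<in>count_vectors I N. multinomial_prob I N p n * (\<Sum>k\<in>I. real (n k) * c k)) = 0"
proof (induction N)
  case 0
  show ?case using assms by (simp add: count_vectors_0)
next
  case (Suc N)
  have "(\<Sum>n\<in>count_vectors I (Suc N). multinomial_prob I (Suc N) p n * (\<Sum>k\<in>I. real (n k) * c k)) =
     (\<Sum>i\<in>I. p i * (\<Sum>n\<in>count_vectors I N. multinomial_prob I N p n * ((\<Sum>k\<in>I. real (n k) * c k) + c i)))"
    by (subst sum_multinomial_Suc[OF assms(1)]) (simp add: sum_increment[OF assms(1)] del: fun_upd_apply cong: sum.cong)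
  also have "\<dots> = (\<Sum>i\<in>I. p i * c i)"
    using Suc multinomial_prob_sum[OF assms(1,2)]
    by (simp add: distrib_left sum.distrib flip: sum_distrib_right)
  finally show ?case using assms(3) by simp
qed

text \<open>Each further trial adds one single-trial covariance: since \<open>c\<close> and
  \<open>d\<close> are centred, the cross terms between the new trial and the earlier ones vanish by
  \<open>multinomial_mean\<close>.\<close>

lemma multinomial_covariance:
  fixes c d :: "'c \<Rightarrow> real"
  assumes "finite I" "(\<Sum>i\<in>I. p i) = 1" "(\<Sum>i\<in>I. p i * c i) = 0" "(\<Sum>i\<in>I. p i * d i) = 0"
  shows "(\<Sum>n\<in>count_vectors I N. multinomial_prob I N p n *
      ((\<Sum>k\<in>I. real (n k) * c k) * (\<Sum>k\<in>I. real (n k) * d k))) =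
    real N * (\<Sum>i\<in>I. p i * (c i * d i))"
proof (induction N)
  case 0
  show ?case using assms by (simp add: count_vectors_0)
next
  case (Suc N)
  let ?T = "\<lambda>c n. \<Sum>k\<in>I. real (n k) * c k" and ?m = "multinomial_prob I N p"
  have "(\<Sum>n\<in>count_vectors I (Suc N). multinomial_prob I (Suc N) p n * (?T c n * ?T d n)) =
     (\<Sum>i\<in>I. p i * (\<Sum>n\<in>count_vectors I N. ?m n * ((?T c n + c i) * (?T d n + d i))))"
    by (subst sum_multinomial_Suc[OF assms(1)]) (simp add: sum_increment[OF assms(1)] del: fun_upd_apply cong: sum.cong)
  also have "\<dots> = (\<Sum>i\<in>I. p i * (real N * (\<Sum>i\<in>I. p i * (c i * d i)) + c i * d i))"
  proof (intro sum.cong refl arg_cong2[where f = "(*)"])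
    fix i
    have "(\<Sum>n\<in>S. m n * ((f n + u) * (g n + v))) = (\<Sum>n\<in>S. m n * (f n * g n)) +
        (\<Sum>n\<in>S. m n * f n) * v + (\<Sum>n\<in>S. m n * g n) * u + (\<Sum>n\<in>S. m n) * (u * v)"
      for S :: "('c \<Rightarrow> nat) set" and m f g :: "('c \<Rightarrow> nat) \<Rightarrow> real" and u v :: real
      unfolding sum_distrib_right sum.distrib[symmetric]
      by (intro sum.cong refl) (simp add: algebra_simps)
    note this[of ?m "?T c" "c i" "?T d" "d i" "count_vectors I N"]
    then show "(\<Sum>n\<in>count_vectors I N. ?m n * ((?T c n + c i) * (?T d n + d i))) =
        real N * (\<Sum>i\<in>I. p i * (c i * d i)) + c i * d i"
      using Suc multinomial_mean[OF assms(1,2,3)] multinomial_mean[OF assms(1,2,4)]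
        multinomial_prob_sum[OF assms(1,2)] by simp
  qed
  also have "\<dots> = (\<Sum>i\<in>I. p i) * (real N * (\<Sum>i\<in>I. p i * (c i * d i))) + (\<Sum>i\<in>I. p i * (c i * d i))"
    unfolding distrib_left sum.distrib sum_distrib_right ..
  also have "\<dots> = real (Suc N) * (\<Sum>i\<in>I. p i * (c i * d i))"
    unfolding assms(2) by (simp add: distrib_right)
  finally show ?case .
qed

lemma ln_multinomial_prob:
  assumes "finite I" "\<And>i. i \<in> I \<Longrightarrow> 0 < p i"
  shows "ln (multinomial_prob I N p n) =
    ln (fact N / (\<Prod>i\<in>I. fact (n i))) + (\<Sum>i\<in>I. real (n i) * ln (p i))"
proof -
  have "0 < (\<Prod>i\<in>I. p i ^ n i)" using assms by (intro prod_pos) auto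
  moreover have "0 < fact N / (\<Prod>i\<in>I. fact (n i) :: real)" by (intro divide_pos_pos prod_pos) auto
  moreover have "ln (\<Prod>i\<in>I. p i ^ n i) = (\<Sum>i\<in>I. real (n i) * ln (p i))"
    using assms by (subst ln_prod) (force simp: ln_realpow intro!: sum.cong)+
  ultimately show ?thesis unfolding multinomial_prob_def by (subst ln_mult_pos) auto
qed

text \<open>Where all cells are positive the log-likelihood is a constant plus a sum linear in the
  counts, so the scores are centred linear statistics and their covariance is known. Positivity is
  assumed near the point, because a derivative depends on a neighbourhood.\<close>

lemma fisher_info_multinomial:
  assumes "finite I"
    and "(\<Sum>i\<in>I. P x i) = 1" and "\<And>i. i \<in> I \<Longrightarrow> 0 < P x i"
    and a: "\<And>i. i \<in> I \<Longrightarrow> ((\<lambda>t. ln (P (x(a := t)) i)) has_real_derivative c i) (at (x a))"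
    and ca: "(\<Sum>i\<in>I. P x i * c i) = 0"
    and pa: "\<forall>\<^sub>F t in nhds (x a). \<forall>i\<in>I. 0 < P (x(a := t)) i"
    and b: "\<And>i. i \<in> I \<Longrightarrow> ((\<lambda>t. ln (P (x(b := t)) i)) has_real_derivative d i) (at (x b))"
    and cb: "(\<Sum>i\<in>I. P x i * d i) = 0"
    and pb: "\<forall>\<^sub>F t in nhds (x b). \<forall>i\<in>I. 0 < P (x(b := t)) i"
  shows "fisher_info (count_vectors I N) (\<lambda>x. multinomial_prob I N (P x)) x a b =
    real N * (\<Sum>i\<in>I. P x i * (c i * d i))"
proof -
  have D: "partial_deriv a (\<lambda>y. ln (multinomial_prob I N (P y) n)) x = (\<Sum>i\<in>I. real (n i) * c i)"
    if a: "\<And>i. i \<in> I \<Longrightarrow> ((\<lambda>t. ln (P (x(a := t)) i)) has_real_derivative c i) (at (x a))"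
    and pa: "\<forall>\<^sub>F t in nhds (x a). \<forall>i\<in>I. 0 < P (x(a := t)) i" for a c n
  proof -
    have "((\<lambda>t. ln (fact N / (\<Prod>i\<in>I. fact (n i))) + (\<Sum>i\<in>I. real (n i) * ln (P (x(a := t)) i)))
        has_real_derivative (\<Sum>i\<in>I. real (n i) * c i)) (at (x a))"
      by (rule DERIV_cong, rule DERIV_add, rule DERIV_const, rule DERIV_sum, rule DERIV_cmult, erule a) simp
    moreover have "\<forall>\<^sub>F t in nhds (x a). ln (multinomial_prob I N (P (x(a := t))) n) =
        ln (fact N / (\<Prod>i\<in>I. fact (n i))) + (\<Sum>i\<in>I. real (n i) * ln (P (x(a := t)) i))"
      using pa by eventually_elim (simp add: ln_multinomial_prob[OF assms(1)])
    ultimately have "((\<lambda>t. ln (multinomial_prob I N (P (x(a := t))) n))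
        has_real_derivative (\<Sum>i\<in>I. real (n i) * c i)) (at (x a))"
      by (rule DERIV_cong_ev[THEN iffD2, OF refl _ refl, rotated])
    then show ?thesis unfolding partial_deriv_def by (rule DERIV_imp_deriv)
  qed
  have "partial_deriv a (\<lambda>y. ln (multinomial_prob I N (P y) n)) x = (\<Sum>i\<in>I. real (n i) * c i)"
    "partial_deriv b (\<lambda>y. ln (multinomial_prob I N (P y) n)) x = (\<Sum>i\<in>I. real (n i) * d i)" for n
    by (rule D; use a b pa pb in simp)+
  then show ?thesis
    unfolding fisher_info_def using multinomial_covariance[OF assms(1,2) ca cb] by simp
qed

section \<open>Block diagonal information matrices\<close>

text \<open>\<open>mat_inverse\<close> returns an option, and \<open>the\<close> applied to
  \<open>None\<close> would carry no information; a one-sided inverse rules this case out and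
  determines the value.\<close>

lemma the_mat_inverse:
  fixes A :: "'a :: field Matrix.mat"
  assumes A: "A \<in> carrier_mat n n" and B: "B \<in> carrier_mat n n" and AB: "A * B = 1\<^sub>m n"
  shows "the (mat_inverse A) = B"
proof -
  have BA: "B * A = 1\<^sub>m n" using mat_mult_left_right_inverse[OF A B AB] .
  have "A \<in> Units (ring_mat TYPE('a) n ())"
    using A B AB BA by (auto simp: Units_def ring_mat_def)
  then obtain C where C: "mat_inverse A = Some C"
    using mat_inverse(1)[OF A, of "()"] by (cases "mat_inverse A") auto
  from mat_inverse(2)[OF A C] have "C * A = 1\<^sub>m n" and Cc: "C \<in> carrier_mat n n" by auto
  then have "C = C * (A * B)" using AB by simp
  also have "\<dots> = B" using \<open>C * A = 1\<^sub>m n\<close> A B Cc by (simp flip: assoc_mult_mat[of C n n A n B n])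
  finally show ?thesis using C by simp
qed

text \<open>The matrix determinant lemma, from the two ways to eliminate a bordering row and column.\<close>

lemma det_diag_plus_const:
  fixes d :: "nat \<Rightarrow> real"
  assumes d: "\<And>i. i < n \<Longrightarrow> d i \<noteq> 0"
  shows "Determinant.det (Matrix.mat n n (\<lambda>(i, j). (if i = j then d i else 0) + e)) =
    (\<Prod>i<n. d i) * (1 + e * (\<Sum>i<n. 1 / d i))"
proof -
  let ?D = "Matrix.mat n n (\<lambda>(i, j). if i = j then d i else 0)"
  let ?M = "Matrix.mat n n (\<lambda>(i, j). (if i = j then d i else 0) + e)"
  let ?u = "Matrix.mat n 1 (\<lambda>_. - e)" and ?v = "Matrix.mat 1 n (\<lambda>_. 1 :: real)"
  let ?w = "Matrix.mat 1 n (\<lambda>(_, j). - 1 / d j)"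
  let ?s = "Matrix.mat 1 1 (\<lambda>_. 1 + e * (\<Sum>i<n. 1 / d i))"
  let ?o = "1\<^sub>m 1 :: real Matrix.mat" and ?I = "1\<^sub>m n :: real Matrix.mat"
  let ?Z = "0\<^sub>m n 1 :: real Matrix.mat" and ?Z' = "0\<^sub>m 1 n :: real Matrix.mat"
  let ?X = "four_block_mat ?D ?u ?v ?o"
  have 1: "?X * four_block_mat ?I ?Z (- ?v) ?o = four_block_mat ?M ?u ?Z' ?o"
    by (subst mult_four_block_mat[of _ n n _ 1 _ 1 _ _ n _ 1])
      (auto intro!: cong_four_block_mat eq_matI simp: scalar_prod_def)
  have 2: "four_block_mat ?I ?Z ?w ?o * ?X = four_block_mat ?D ?u ?Z' ?s"
  proof -
    have "?w * ?D + ?o * ?v = ?Z'"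
    proof (rule eq_matI)
      fix i j assume "i < dim_row ?Z'" "j < dim_col ?Z'"
      then have ij: "i = 0" "j < n" by auto
      have "(\<Sum>k = 0..<n. - (1 / d k) * (if k = j then d k else 0)) =
          (\<Sum>k = 0..<n. if k = j then - 1 else 0)"
        using d by (intro sum.cong) auto
      then show "(?w * ?D + ?o * ?v) $$ (i, j) = ?Z' $$ (i, j)"
        using ij by (simp add: scalar_prod_def)
    qed auto
    moreover have "?w * ?u + ?o * ?o = ?s"
      by (intro eq_matI) (auto simp: scalar_prod_def sum_distrib_left lessThan_atLeast0)
    ultimately show ?thesis
      by (subst mult_four_block_mat[of _ n n _ 1 _ 1 _ _ n _ 1]) auto
  qed
  have dX: "?X \<in> carrier_mat (n + 1) (n + 1)" by auto
  have dD: "Determinant.det ?D = (\<Prod>i<n. d i)"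
    by (subst det_upper_triangular[where n = n])
      (auto simp: prod_list_diag_prod lessThan_atLeast0 intro!: upper_triangularI prod.cong)
  have "Determinant.det (four_block_mat ?M ?u ?Z' ?o) = Determinant.det ?X"
    unfolding 1[symmetric] by (subst det_mult[OF dX])
      (auto simp: det_four_block_mat_upper_right_zero[where n = n and m = 1])
  moreover have "Determinant.det (four_block_mat ?D ?u ?Z' ?s) = Determinant.det ?X"
    unfolding 2[symmetric] by (subst det_mult[OF _ dX])
      (auto simp: det_four_block_mat_upper_right_zero[where n = n and m = 1])
  moreover have "Determinant.det (four_block_mat ?M ?u ?Z' ?o) = Determinant.det ?M"
    by (subst det_four_block_mat_lower_left_zero[where n = n and m = 1]) auto
  moreover have "Determinant.det (four_block_mat ?D ?u ?Z' ?s) = Determinant.det ?D * (1 + e * (\<Sum>i<n. 1 / d i))"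
    by (subst det_four_block_mat_lower_left_zero[where n = n and m = 1]) (auto simp: det_single)
  ultimately show ?thesis using dD by simp
qed

text \<open>The second condition is positivity of the omitted entry. Values outside \<open>A\<close>
  are unconstrained, so one parameter can be tested against every group.\<close>

definition open_simplex :: "'j set \<Rightarrow> ('j \<Rightarrow> real) set" where
  "open_simplex A = {x. (\<forall>a\<in>A. 0 < x a) \<and> sum x A < 1}"

text \<open>The product of all entries of a probability vector, the omitted one
  \<open>1 - sum x A\<close> included.\<close>

definition simplex_prod :: "'j set \<Rightarrow> ('j \<Rightarrow> real) \<Rightarrow> real" where
  "simplex_prod A x = prod x A * (1 - sum x A)"

lemma simplex_prod_pos: "x \<in> open_simplex A \<Longrightarrow> 0 < simplex_prod A x"
  by (auto simp: open_simplex_def simplex_prod_def intro!: mult_pos_pos prod_pos)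

definition block_index :: "'j list list \<Rightarrow> 'j \<Rightarrow> nat" where
  "block_index Gs a = (THE i. i < length Gs \<and> a \<in> set (Gs ! i))"

lemma nth_block_disjoint:
  assumes "distinct (concat Gs)" "i < length Gs" "j < length Gs" "i \<noteq> j"
  shows "set (Gs ! i) \<inter> set (Gs ! j) = {}"
  using assms
proof (induction Gs arbitrary: i j)
  case (Cons g Gs)
  then show ?case by (cases i; cases j) (force dest: nth_mem)+
qed simp

lemma block_index_eq:
  assumes "distinct (concat Gs)" "i < length Gs" "a \<in> set (Gs ! i)"
  shows "block_index Gs a = i"
  unfolding block_index_def
  using assms nth_block_disjoint[OF assms(1)] by (intro the_equality) auto

text \<open>The Fisher matrix is block diagonal, with blocks \<open>c\<^sub>i (diag (1/x) + 1/x\<^sub>0)\<close> where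
  \<open>x\<^sub>0\<close> is the omitted entry; \<open>(diag x - x x\<^sup>T) / c\<^sub>i\<close> inverts such a block.\<close>

definition block_info :: "'j list list \<Rightarrow> (nat \<Rightarrow> real) \<Rightarrow> ('j \<Rightarrow> real) \<Rightarrow> 'j \<Rightarrow> 'j \<Rightarrow> real" where
  "block_info Gs c x a b =
    (if block_index Gs a = block_index Gs b
     then c (block_index Gs a) * ((if a = b then 1 / x a else 0) + 1 / (1 - sum x (set (Gs ! block_index Gs a))))
     else 0)"

definition block_cov :: "'j list list \<Rightarrow> (nat \<Rightarrow> real) \<Rightarrow> ('j \<Rightarrow> real) \<Rightarrow> 'j \<Rightarrow> 'j \<Rightarrow> real" where
  "block_cov Gs c x a b =
    (if block_index Gs a = block_index Gs b
     then ((if a = b then x a else 0) - x a * x b) / c (block_index Gs a)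
     else 0)"

definition mat_of :: "'j list \<Rightarrow> ('j \<Rightarrow> 'j \<Rightarrow> real) \<Rightarrow> real Matrix.mat" where
  "mat_of js F = Matrix.mat (length js) (length js) (\<lambda>(a, b). F (js ! a) (js ! b))"

lemma mat_of_carrier [simp]: "mat_of js F \<in> carrier_mat (length js) (length js)"
  by (simp add: mat_of_def)

lemma mat_of_mult:
  assumes "distinct js"
  shows "mat_of js F * mat_of js G = mat_of js (\<lambda>a b. \<Sum>k\<in>set js. F a k * G k b)"
proof (rule eq_matI)
  fix i j assume "i < dim_row (mat_of js (\<lambda>a b. \<Sum>k\<in>set js. F a k * G k b))"
    "j < dim_col (mat_of js (\<lambda>a b. \<Sum>k\<in>set js. F a k * G k b))"
  then have ij: "i < length js" "j < length js" by (auto simp: mat_of_def)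
  have "(\<Sum>k\<in>set js. F (js ! i) k * G k (js ! j)) = (\<Sum>k<length js. F (js ! i) (js ! k) * G (js ! k) (js ! j))"
    using assms by (intro sum.reindex_bij_betw[symmetric] bij_betw_nth) auto
  then show "(mat_of js F * mat_of js G) $$ (i, j) = mat_of js (\<lambda>a b. \<Sum>k\<in>set js. F a k * G k b) $$ (i, j)"
    using ij by (simp add: mat_of_def scalar_prod_def lessThan_atLeast0)
qed (auto simp: mat_of_def)

text \<open>Stated for every prefix of the groups because \<open>h_block\<close> inverts twice:
  first the whole information matrix, then a leading block of its inverse.\<close>

lemma block_info_cov:
  assumes dist: "distinct (concat Gs)"
    and "n \<le> length Gs"
    and x: "\<And>i. i < n \<Longrightarrow> x \<in> open_simplex (set (Gs ! i))"
    and c: "\<And>i. i < n \<Longrightarrow> c i \<noteq> 0"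
  shows "mat_of (concat (take n Gs)) (block_info Gs c x) * mat_of (concat (take n Gs)) (block_cov Gs c x) =
    1\<^sub>m (length (concat (take n Gs)))"
proof -
  let ?js = "concat (take n Gs)"
  have djs: "distinct ?js"
    using dist by (metis append_take_drop_id concat_append distinct_append)
  have in_take: "k \<in> set ?js \<longleftrightarrow> (\<exists>i<n. k \<in> set (Gs ! i))" for k
    using assms(2) by (force simp: set_conv_nth[of "take n Gs"])
  have ent: "(\<Sum>k\<in>set ?js. block_info Gs c x a k * block_cov Gs c x k b) = (if a = b then 1 else 0)"
    if ab: "a \<in> set ?js" "b \<in> set ?js" for a b
  proof -
    obtain i where i: "i < n" "a \<in> set (Gs ! i)"
      using ab(1) in_take[of a] by blast
    obtain j where j: "j < n" "b \<in> set (Gs ! j)"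
      using ab(2) in_take[of b] by blast
    let ?A = "set (Gs ! i)"
    have ia: "block_index Gs k = i" if "k \<in> ?A" for k
      using block_index_eq[OF dist _ that] i assms(2) by simp
    have ib: "block_index Gs b = j" using block_index_eq[OF dist _ j(2)] j assms(2) by simp
    have sub: "?A \<subseteq> set ?js" using i in_take by blast
    have iff: "k \<in> ?A" if k: "k \<in> set ?js" "block_index Gs k = i" for k
    proof -
      obtain l where l: "l < n" "k \<in> set (Gs ! l)"
        using k(1) in_take[of k] by blast
      then show ?thesis using block_index_eq[OF dist _ l(2)] k(2) assms(2) by auto
    qed
    \<comment> \<open>Only indices in the block of \<open>a\<close> contribute, so the product
      reduces to the Sherman-Morrison formula for one block.\<close>
    have "(\<Sum>k\<in>set ?js. block_info Gs c x a k * block_cov Gs c x k b) =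
        (\<Sum>k\<in>?A. block_info Gs c x a k * block_cov Gs c x k b)"
    proof (intro sum.mono_neutral_right ballI)
      fix k assume "k \<in> set ?js - ?A"
      then have "block_index Gs k \<noteq> i" using iff by blast
      then show "block_info Gs c x a k * block_cov Gs c x k b = 0"
        using ia[OF i(2)] by (simp add: block_info_def)
    qed (use sub in auto)
    also have "\<dots> = (if a = b then 1 else 0)"
    proof (cases "i = j")
      case False
      then have "a \<noteq> b" using ia[OF i(2)] ib by auto
      then show ?thesis using False ia ib by (simp add: block_cov_def)
    next
      case True
      let ?e = "1 - sum x ?A"
      have e: "?e > 0" and xa: "x a > 0" using x[OF i(1)] i(2) by (auto simp: open_simplex_def)
      have "(\<Sum>k\<in>?A. block_info Gs c x a k * block_cov Gs c x k b) =
          (\<Sum>k\<in>?A. ((if a = k then 1 / x a else 0) + 1 / ?e) * ((if k = b then x k else 0) - x k * x b))"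
        using True ia[OF i(2)] ia ib c[OF i(1)] by (intro sum.cong refl) (simp add: block_info_def block_cov_def)
      also have "\<dots> = (\<Sum>k\<in>?A. (if a = k then 1 / x a * ((if k = b then x k else 0) - x k * x b) else 0)
           + ((if k = b then x k / ?e else 0) - x k * (x b / ?e)))"
        unfolding distrib_right by (intro sum.cong refl) (auto simp: right_diff_distrib)
      also have "\<dots> = 1 / x a * ((if a = b then x a else 0) - x a * x b) + (x b / ?e - sum x ?A * (x b / ?e))"
        using i j True by (simp add: sum.distrib sum_subtractf sum_distrib_right flip: sum_divide_distrib)
      also have "\<dots> = (if a = b then 1 else 0) - x b + (1 - sum x ?A) * (x b / ?e)"
      proof -
        have "1 / x a * ((if a = b then x a else 0) - x a * x b) = (if a = b then 1 else 0) - x b"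
          using xa by (cases "a = b") (auto simp: right_diff_distrib)
        then show ?thesis unfolding left_diff_distrib[of 1] by simp
      qed
      also have "\<dots> = (if a = b then 1 else 0)" using e by simp
      finally show ?thesis .
    qed
    finally show ?thesis .
  qed
  show ?thesis
    unfolding mat_of_mult[OF djs]
  proof (rule eq_matI)
    fix i j assume "i < dim_row (1\<^sub>m (length ?js) :: real Matrix.mat)" "j < dim_col (1\<^sub>m (length ?js) :: real Matrix.mat)"
    then have ij: "i < length ?js" "j < length ?js" by auto
    show "mat_of ?js (\<lambda>a b. \<Sum>k\<in>set ?js. block_info Gs c x a k * block_cov Gs c x k b) $$ (i, j) =
        1\<^sub>m (length ?js) $$ (i, j)"
      using ij ent[of "?js ! i" "?js ! j"] djs
      by (simp add: mat_of_def nth_eq_iff_index_eq del: length_concat set_concat)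
  qed (auto simp: mat_of_def)
qed

lemma split_block_upper_left:
  assumes "length js = n"
  shows "fst (split_block (mat_of (js @ ks) F) n n) = mat_of js F"
  using assms by (auto simp: split_block_def Let_def mat_of_def nth_append intro!: eq_matI)

lemma split_block_lower_right:
  assumes "length js = n"
  shows "snd (snd (snd (split_block (mat_of (js @ ks) F) n n))) = mat_of ks F"
  using assms by (auto simp: split_block_def Let_def mat_of_def nth_append intro!: eq_matI)

text \<open>For a block diagonal matrix, taking a leading block commutes with inversion. The two
  inversions cancel and \<open>h_block\<close> is just the diagonal block of group \<open>j\<close>,
  whatever precedes or follows it. Its determinant is the determinant lemma with
  \<open>d i = 1 / x i\<close> and \<open>e = 1 / (1 - sum x)\<close>, where the correction factor
  collapses to \<open>1 / (1 - sum x)\<close>.\<close>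

lemma h_block_block_diagonal:
  assumes dist: "distinct (concat Gs)" and j: "j < length Gs"
    and x: "\<And>i. i < length Gs \<Longrightarrow> x \<in> open_simplex (set (Gs ! i))"
    and c: "\<And>i. i < length Gs \<Longrightarrow> c i \<noteq> 0"
    and F: "\<And>a b. a \<in> set (concat Gs) \<Longrightarrow> b \<in> set (concat Gs) \<Longrightarrow> fisher_info D f x a b = block_info Gs c x a b"
  shows "invertible_mat (fisher_matrix D f (concat Gs) x)"
    and "Determinant.det (h_block D f Gs j x) = c j ^ length (Gs ! j) / simplex_prod (set (Gs ! j)) x"
proof -
  let ?js = "concat Gs" and ?ks = "concat (take (Suc j) Gs)"
  let ?I = "block_info Gs c x" and ?C = "block_cov Gs c x"
  have fm: "fisher_matrix D f ?js x = mat_of ?js ?I"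
    unfolding fisher_matrix_def mat_of_def
    by (intro eq_matI) (auto simp: F simp del: set_concat length_concat intro!: F)
  have IC: "mat_of ?js ?I * mat_of ?js ?C = 1\<^sub>m (length ?js)"
    using block_info_cov[OF dist order_refl, of x c] x c by simp
  have CI: "mat_of ?js ?C * mat_of ?js ?I = 1\<^sub>m (length ?js)"
    by (rule mat_mult_left_right_inverse[OF _ _ IC]) auto
  show "invertible_mat (fisher_matrix D f (concat Gs) x)"
    unfolding fm invertible_mat_def inverts_mat_def using IC CI
    by (intro conjI exI[of _ "mat_of ?js ?C"]) (auto simp: mat_of_def)
  have IC': "mat_of ?ks ?I * mat_of ?ks ?C = 1\<^sub>m (length ?ks)"
    using block_info_cov[OF dist, of "Suc j" x c] j x c by simp
  have CI': "mat_of ?ks ?C * mat_of ?ks ?I = 1\<^sub>m (length ?ks)"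
    by (rule mat_mult_left_right_inverse[OF _ _ IC']) auto
  have i1: "the (mat_inverse (fisher_matrix D f ?js x)) = mat_of ?js ?C"
    unfolding fm by (rule the_mat_inverse[OF _ _ IC]) auto
  have i2: "the (mat_inverse (mat_of ?ks ?C)) = mat_of ?ks ?I"
    by (rule the_mat_inverse[OF _ _ CI']) auto
  have js: "?js = ?ks @ concat (drop (Suc j) Gs)"
    by (metis append_take_drop_id concat_append)
  have ks: "?ks = concat (take j Gs) @ Gs ! j"
    using j by (simp add: take_Suc_conv_app_nth)
  have 1: "fst (split_block (mat_of ?js ?C) (length ?ks) (length ?ks)) = mat_of ?ks ?C"
    by (subst js, rule split_block_upper_left) simp
  have 2: "snd (snd (snd (split_block (mat_of ?ks ?I) (length (concat (take j Gs))) (length (concat (take j Gs))))))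
      = mat_of (Gs ! j) ?I"
    by (subst ks, rule split_block_lower_right) simp
  have h: "h_block D f Gs j x = mat_of (Gs ! j) ?I"
    using 1 2 i2 unfolding h_block_def Let_def i1 by (simp add: case_prod_unfold del: length_concat)
  let ?g = "Gs ! j" and ?A = "set (Gs ! j)"
  let ?n = "length ?g" and ?e = "1 - sum x ?A"
  have dg: "distinct ?g" using dist j by (auto simp: distinct_concat_iff)
  have bi: "block_index Gs a = j" if "a \<in> ?A" for a using block_index_eq[OF dist j that] .
  have xs: "x \<in> open_simplex ?A" using x j by simp
  have xp: "x a > 0" if "a \<in> ?A" for a using xs that by (auto simp: open_simplex_def)
  have e: "?e > 0" using xs by (auto simp: open_simplex_def)
  have s: "(\<Sum>i<?n. x (?g ! i)) = sum x ?A" and p: "(\<Prod>i<?n. x (?g ! i)) = prod x ?A"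
    using dg by (auto intro!: sum.reindex_bij_betw prod.reindex_bij_betw bij_betw_nth)
  have "mat_of ?g ?I = c j \<cdot>\<^sub>m Matrix.mat ?n ?n (\<lambda>(i, k). (if i = k then 1 / x (?g ! i) else 0) + 1 / ?e)"
    using dg by (intro eq_matI) (auto simp: mat_of_def block_info_def bi nth_eq_iff_index_eq)
  then have "Determinant.det (h_block D f Gs j x) =
     c j ^ ?n * ((\<Prod>i<?n. 1 / x (?g ! i)) * (1 + 1 / ?e * (\<Sum>i<?n. 1 / (1 / x (?g ! i)))))"
    unfolding h using less_imp_neq[OF xp[OF nth_mem]]
    by (simp only: det_smult dim_col_mat, subst det_diag_plus_const) auto
  also have "\<dots> = c j ^ ?n * (1 / prod x ?A * (1 + 1 / ?e * sum x ?A))"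
    by (simp add: s p prod_dividef)
  also have "1 + 1 / ?e * sum x ?A = 1 / ?e" using e by (simp add: field_simps)
  finally show "Determinant.det (h_block D f Gs j x) = c j ^ length ?g / simplex_prod ?A x"
    by (simp add: simplex_prod_def)
qed

section \<open>Dirichlet integrals\<close>

interpretation lborel_product: product_sigma_finite "\<lambda>_. lborel :: real measure" ..

text \<open>The unnormalized symmetric Dirichlet density with all parameters \<open>e + 1\<close>,
  extended by zero. The prior has \<open>e = -1/2\<close>; \<open>e = -3/4\<close> serves as a
  dominating function.\<close>

definition simplex_density :: "real \<Rightarrow> 'j set \<Rightarrow> ('j \<Rightarrow> real) \<Rightarrow> real" where
  "simplex_density e A x = indicator (open_simplex A) x * simplex_prod A x powr e"

lemma simplex_density_nonneg: "0 \<le> simplex_density e A x"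
  by (simp add: simplex_density_def)

lemma open_simplex_sum_nonneg: "x \<in> open_simplex A \<Longrightarrow> 0 \<le> sum x A"
  by (rule sum_nonneg) (auto simp: open_simplex_def less_imp_le)

lemma open_simplex_cong:
  "(\<And>a. a \<in> A \<Longrightarrow> x a = y a) \<Longrightarrow> x \<in> open_simplex A \<longleftrightarrow> y \<in> open_simplex A"
  by (simp add: open_simplex_def cong: sum.cong)

lemma simplex_prod_cong:
  "(\<And>a. a \<in> A \<Longrightarrow> x a = y a) \<Longrightarrow> simplex_prod A x = simplex_prod A y"
  by (simp add: simplex_prod_def cong: sum.cong prod.cong)

lemma simplex_density_cong:
  "(\<And>a. a \<in> A \<Longrightarrow> x a = y a) \<Longrightarrow> simplex_density e A x = simplex_density e A y"
  using open_simplex_cong[of A x y] simplex_prod_cong[of A x y]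
  by (simp add: simplex_density_def indicator_def)

lemma simplex_prod_le_coord:
  assumes "finite A" "x \<in> open_simplex A" "a \<in> A"
  shows "simplex_prod A x \<le> x a"
proof -
  have pos: "0 < x b" if "b \<in> A" for b using assms that by (auto simp: open_simplex_def)
  have "x b \<le> sum x A" if "b \<in> A" for b
    using member_le_sum[of b A x] pos assms(1) that by force
  then have le: "x b \<le> 1" if "b \<in> A" for b
    using assms that by (force simp: open_simplex_def)
  have "prod x (A - {a}) \<le> 1" "0 \<le> prod x (A - {a})"
    using le pos by (auto intro!: prod_le_1 prod_nonneg simp: less_imp_le)
  moreover have "0 \<le> 1 - sum x A" "1 - sum x A \<le> 1"
    using assms pos by (auto simp: open_simplex_def less_imp_le intro!: sum_nonneg)
  ultimately have "prod x (A - {a}) * (1 - sum x A) \<le> 1" using mult_le_one by blast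
  then show ?thesis
    using assms pos[OF assms(3)] mult_left_mono[of "prod x (A - {a}) * (1 - sum x A)" 1 "x a"]
    by (simp add: simplex_prod_def prod.remove[of A a] mult.assoc)
qed

lemma simplex_prod_le_rest:
  assumes "finite A" "x \<in> open_simplex A"
  shows "simplex_prod A x \<le> 1 - sum x A"
proof -
  have pos: "0 < x b" if "b \<in> A" for b using assms that by (auto simp: open_simplex_def)
  have "x b \<le> sum x A" if "b \<in> A" for b
    using member_le_sum[of b A x] pos assms(1) that by force
  then have le: "x b \<le> 1" if "b \<in> A" for b
    using assms that by (force simp: open_simplex_def)
  have "prod x A \<le> 1" "0 \<le> prod x A"
    using le pos by (auto intro!: prod_le_1 prod_nonneg simp: less_imp_le)
  then show ?thesis
    using assms mult_right_mono[of "prod x A" 1 "1 - sum x A"]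
    by (simp add: simplex_prod_def open_simplex_def)
qed

lemma simplex_prod_le_1:
  assumes "finite A" "x \<in> open_simplex A"
  shows "simplex_prod A x \<le> 1"
  using simplex_prod_le_rest[OF assms] open_simplex_sum_nonneg[OF assms(2)] by simp

lemma coord_measurable:
  assumes "a \<in> J"
  shows "(\<lambda>x. x a) \<in> borel_measurable (Pi\<^sub>M J (\<lambda>_. lborel :: real measure))"
  using measurable_component_singleton[of a J "\<lambda>_. lborel"] assms by auto

lemma simplex_prod_measurable:
  assumes "A \<subseteq> J"
  shows "simplex_prod A \<in> borel_measurable (Pi\<^sub>M J (\<lambda>_. lborel))"
  unfolding simplex_prod_def using assms
  by (auto intro!: borel_measurable_times borel_measurable_diff borel_measurable_prod
      borel_measurable_sum coord_measurable)

lemma open_simplex_measurable: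
  assumes "finite A" "A \<subseteq> J"
  shows "(indicator (open_simplex A) :: _ \<Rightarrow> real) \<in> borel_measurable (Pi\<^sub>M J (\<lambda>_. lborel))"
proof -
  let ?M = "Pi\<^sub>M J (\<lambda>_. lborel :: real measure)"
  have ind: "(\<lambda>x. indicator {0<..} (f x) :: real) \<in> borel_measurable ?M"
    if "f \<in> borel_measurable ?M" for f :: "_ \<Rightarrow> real"
    using that by measurable
  have "(\<lambda>x. indicator {0<..} (1 - sum x A) * (\<Prod>a\<in>A. indicator {0<..} (x a) :: real)) \<in> borel_measurable ?M"
    using assms(2) by (intro borel_measurable_times borel_measurable_prod ind borel_measurable_diff
        borel_measurable_sum coord_measurable) auto
  moreover have "indicator {0<..} (1 - sum x A) * (\<Prod>a\<in>A. indicator {0<..} (x a)) =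
      (indicator (open_simplex A) x :: real)" for x
  proof -
    have "(\<Prod>a\<in>A. indicator {0<..} (x a)) = (if \<forall>a\<in>A. 0 < x a then 1 else (0::real))"
      using assms(1) by (auto simp: indicator_def intro!: prod.neutral)
    then show ?thesis by (auto simp: indicator_def open_simplex_def)
  qed
  ultimately show ?thesis by simp
qed

lemma simplex_density_measurable:
  assumes "finite A" "A \<subseteq> J"
  shows "simplex_density e A \<in> borel_measurable (Pi\<^sub>M J (\<lambda>_. lborel))"
  unfolding simplex_density_def
  using simplex_prod_measurable[OF assms(2)] open_simplex_measurable[OF assms]
  by (auto intro!: borel_measurable_times)

section \<open>Finiteness and positivity of the Dirichlet integrals\<close>

lemma nn_integral_powr_interval:
  assumes "0 < c"
  shows "(\<integral>\<^sup>+x. ennreal (indicator {0<..<c} x * x powr (-3/4)) \<partial>lborel) = ennreal (4 * c powr (1/4))"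
proof -
  have "((\<lambda>x. x powr (-3/4)) has_integral (c powr (-3/4 + 1) / (-3/4 + 1))) {0..c}"
    using has_integral_powr_from_0[of "-3/4" c] assms by simp
  then have "(\<integral>\<^sup>+x. ennreal (x powr (-3/4)) * indicator {0..c} x \<partial>lborel) = ennreal (c powr (-3/4 + 1) / (-3/4 + 1))"
    by (intro nn_integral_has_integral_lebesgue') auto
  moreover have "AE x in lborel. ennreal (indicator {0<..<c} x * x powr (-3/4)) = ennreal (x powr (-3/4)) * indicator {0..c} x"
    using AE_lborel_singleton[of 0] AE_lborel_singleton[of c]
    by eventually_elim (auto simp: indicator_def)
  ultimately show ?thesis by (simp add: nn_integral_cong_AE mult.commute)
qed

text \<open>The exponent \<open>-3/4\<close> leaves room for the factor \<open>B\<^bsup>-1/4\<^esup>\<close> that bounds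
  \<open>\<bar>ln B\<bar>\<close> in the integrals against the density \<open>B\<^bsup>-1/2\<^esup>\<close>.\<close>

lemma nn_integral_beta_bound:
  assumes "0 < c" "c \<le> 1"
  shows "(\<integral>\<^sup>+x. ennreal (indicator {0<..<c} x * (x * (c - x)) powr (-3/4)) \<partial>lborel)
    \<le> ennreal (16 * c powr (-3/4))"
proof -
  let ?f = "\<lambda>x. indicator {0<..<c} x * x powr (-3/4) :: real"
  have refl: "(\<integral>\<^sup>+x. ennreal (?f (c - x)) \<partial>lborel) = (\<integral>\<^sup>+x. ennreal (?f x) \<partial>lborel)"
    using nn_integral_real_affine[of "\<lambda>x. ennreal (?f x)" "-1" c] by simp
  have "(\<integral>\<^sup>+x. ennreal (indicator {0<..<c} x * (x * (c - x)) powr (-3/4)) \<partial>lborel)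
      \<le> (\<integral>\<^sup>+x. ennreal ((c/2) powr (-3/4)) * (ennreal (?f x) + ennreal (?f (c - x))) \<partial>lborel)"
  proof (intro nn_integral_mono)
    fix x :: real
    \<comment> \<open>On each half of the interval one of the factors \<open>x\<close> and
      \<open>c - x\<close> is at least \<open>c / 2\<close>; bounding that factor leaves a one-sided
      singularity, and the two halves are mirror images.\<close>
    have "indicator {0<..<c} x * (x * (c - x)) powr (-3/4) \<le> (c/2) powr (-3/4) * (?f x + ?f (c - x))"
    proof (cases "0 < x \<and> x < c")
      case True
      have *: "(u * v) powr (-3/4) \<le> (c/2) powr (-3/4) * (u powr (-3/4) + v powr (-3/4))"
        if "0 < u" "c / 2 \<le> v" for u v :: real
      proof -
        have "v powr (-3/4) \<le> (c/2) powr (-3/4)"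
          using that assms by (intro powr_mono2') auto
        then have "(u * v) powr (-3/4) \<le> u powr (-3/4) * (c/2) powr (-3/4)"
          using that assms by (simp add: powr_mult mult_left_mono)
        then show ?thesis by (simp add: algebra_simps add_increasing2)
      qed
      show ?thesis using True *[of x "c - x"] *[of "c - x" x]
        by (cases "x \<le> c / 2") (auto simp: algebra_simps)
    qed auto
    then show "ennreal (indicator {0<..<c} x * (x * (c - x)) powr (-3/4)) \<le>
        ennreal ((c/2) powr (-3/4)) * (ennreal (?f x) + ennreal (?f (c - x)))"
      by (simp add: ennreal_leI flip: ennreal_mult ennreal_plus)
  qed
  also have "\<dots> = ennreal ((c/2) powr (-3/4)) * (ennreal (4 * c powr (1/4)) + ennreal (4 * c powr (1/4)))"
    using assms by (subst nn_integral_cmult, measurable, subst nn_integral_add, measurable)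
      (simp only: refl nn_integral_powr_interval)
  also have "\<dots> = ennreal ((c/2) powr (-3/4) * (8 * c powr (1/4)))"
    by (simp flip: ennreal_mult ennreal_plus)
  also have "\<dots> \<le> ennreal (16 * c powr (-3/4))"
  proof (rule ennreal_leI)
    \<comment> \<open>The constant 16 is \<open>4 + 4\<close> from the two halves times the bound 2
      for \<open>2 powr (3/4)\<close>. Dropping \<open>c powr (1/4)\<close> leaves exactly the power
      of \<open>c\<close> that the density in one coordinate fewer contains.\<close>
    have "c powr (1/4) \<le> 1" using assms by (simp add: powr_le1)
    moreover have "2 powr (3/4) \<le> (2::real)" using powr_mono[of "3/4" 1 "2::real"] by simp
    ultimately have "2 powr (3/4) * c powr (1/4) \<le> 2 * 1" by (intro mult_mono) auto
    then have "c powr (-3/4) * (8 * (2 powr (3/4) * c powr (1/4))) \<le> c powr (-3/4) * (8 * 2)"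
      by (intro mult_left_mono) auto
    moreover have "(c/2) powr (-3/4) = c powr (-3/4) * 2 powr (3/4)"
      using assms by (simp add: powr_divide powr_minus_divide)
    ultimately show "(c/2) powr (-3/4) * (8 * c powr (1/4)) \<le> 16 * c powr (-3/4)"
      by (simp add: mult_ac)
  qed
  finally show ?thesis .
qed

text \<open>Integrating out one coordinate \<open>b\<close> over the interval up to the remaining
  mass \<open>1 - sum x A\<close> costs a factor 16 and returns the same density on the other
  coordinates.\<close>

lemma nn_integral_simplex_density_bound:
  assumes "finite A"
  shows "(\<integral>\<^sup>+x. ennreal (simplex_density (-3/4) A x) \<partial>coord_lebesgue A) \<le> 16 ^ card A"
  using assms
proof (induction A rule: finite_induct)
  case empty
  show ?case
    by (simp add: coord_lebesgue_def PiM_empty nn_integral_count_space_finite simplex_density_def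
        simplex_prod_def open_simplex_def)
next
  case (insert b A)
  let ?P = "\<lambda>A. Pi\<^sub>M A (\<lambda>_. lborel :: real measure)"
  have "(\<integral>\<^sup>+x. ennreal (simplex_density (-3/4) (insert b A) x) \<partial>?P (insert b A)) =
      (\<integral>\<^sup>+x. (\<integral>\<^sup>+y. ennreal (simplex_density (-3/4) (insert b A) (x(b := y))) \<partial>lborel) \<partial>?P A)"
    using insert simplex_density_measurable[of "insert b A" "insert b A"]
    by (intro lborel_product.product_nn_integral_insert) auto
  also have "\<dots> \<le> (\<integral>\<^sup>+x. 16 * ennreal (simplex_density (-3/4) A x) \<partial>?P A)"
  proof (intro nn_integral_mono)
    fix x :: "'a \<Rightarrow> real"
    have s: "sum (x(b := y)) A = sum x A" "prod (x(b := y)) A = prod x A" for y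
      using insert by (auto intro!: sum.cong prod.cong)
    let ?c = "1 - sum x A"
    show "(\<integral>\<^sup>+y. ennreal (simplex_density (-3/4) (insert b A) (x(b := y))) \<partial>lborel) \<le>
        16 * ennreal (simplex_density (-3/4) A x)"
    proof (cases "x \<in> open_simplex A")
      case False
      have "x(b := y) \<notin> open_simplex (insert b A)" for y
        using False insert s[of y] by (auto simp: open_simplex_def)
      then show ?thesis by (simp add: simplex_density_def)
    next
      case True
      then have c: "0 < ?c" "?c \<le> 1" and p: "0 < prod x A"
        using open_simplex_sum_nonneg[OF True] by (auto simp: open_simplex_def intro!: prod_pos)
      have "simplex_density (-3/4) (insert b A) (x(b := y)) =
          prod x A powr (-3/4) * (indicator {0<..<?c} y * (y * (?c - y)) powr (-3/4))" for y
      proof -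
        have "x(b := y) \<in> open_simplex (insert b A) \<longleftrightarrow> y \<in> {0<..<?c}"
          using True insert s[of y] by (auto simp: open_simplex_def)
        moreover have "simplex_prod (insert b A) (x(b := y)) = prod x A * (y * (?c - y))"
          using insert s[of y] by (simp add: simplex_prod_def algebra_simps)
        ultimately show ?thesis
          using p by (auto simp: simplex_density_def indicator_def powr_mult)
      qed
      then have "(\<integral>\<^sup>+y. ennreal (simplex_density (-3/4) (insert b A) (x(b := y))) \<partial>lborel) =
          ennreal (prod x A powr (-3/4)) * (\<integral>\<^sup>+y. ennreal (indicator {0<..<?c} y * (y * (?c - y)) powr (-3/4)) \<partial>lborel)"
        by (simp add: ennreal_mult' nn_integral_cmult)
      also have "\<dots> \<le> ennreal (prod x A powr (-3/4)) * ennreal (16 * ?c powr (-3/4))"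
        by (intro mult_left_mono nn_integral_beta_bound c) auto
      also have "\<dots> = 16 * ennreal (simplex_density (-3/4) A x)"
        using True p c by (simp add: simplex_density_def simplex_prod_def powr_mult ennreal_mult mult_ac)
      finally show ?thesis .
    qed
  qed
  also have "\<dots> = 16 * (\<integral>\<^sup>+x. ennreal (simplex_density (-3/4) A x) \<partial>?P A)"
    using insert simplex_density_measurable[of A A] by (intro nn_integral_cmult) auto
  also have "\<dots> \<le> 16 * 16 ^ card A"
    using insert by (intro mult_left_mono) (auto simp: coord_lebesgue_def)
  finally show ?case using insert by (simp add: coord_lebesgue_def)
qed

lemma nn_integral_simplex_density_finite:
  assumes "finite A"
  shows "(\<integral>\<^sup>+x. ennreal (simplex_density (-3/4) A x) \<partial>coord_lebesgue A) < \<infinity>"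
  using nn_integral_simplex_density_bound[OF assms]
  by (rule le_less_trans) (simp add: power_less_top_ennreal)

lemma simplex_density_half_le:
  assumes "finite A"
  shows "simplex_density (-1/2) A x \<le> simplex_density (-3/4) A x"
  using simplex_prod_le_1[OF assms] simplex_prod_pos[of x A]
  by (auto simp: simplex_density_def indicator_def intro!: powr_mono')

definition simplex_const :: "'j set \<Rightarrow> real" where
  "simplex_const A = enn2real (\<integral>\<^sup>+x. ennreal (simplex_density (-1/2) A x) \<partial>coord_lebesgue A)"

lemma simplex_const:
  assumes "finite A"
  shows "(\<integral>\<^sup>+x. ennreal (simplex_density (-1/2) A x) \<partial>coord_lebesgue A) = ennreal (simplex_const A)"
    and "0 < simplex_const A"
proof -
  let ?I = "\<integral>\<^sup>+x. ennreal (simplex_density (-1/2) A x) \<partial>coord_lebesgue A"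
  have "?I \<le> (\<integral>\<^sup>+x. ennreal (simplex_density (-3/4) A x) \<partial>coord_lebesgue A)"
    using simplex_density_half_le[OF assms] by (intro nn_integral_mono ennreal_leI)
  then have fin: "?I < \<infinity>"
    using nn_integral_simplex_density_finite[OF assms] by (rule le_less_trans)
  then show eq: "?I = ennreal (simplex_const A)" by (simp add: simplex_const_def)
  \<comment> \<open>A cube of this side lies inside the simplex, since the coordinates sum to less
    than one. There the density is at least one, because a number in (0, 1] is raised to a negative
    power; so the volume of the cube bounds the integral from below.\<close>
  let ?e = "1 / real (Suc (card A))"
  let ?B = "Pi\<^sub>E A (\<lambda>_. {0<..<?e})"
  have "ennreal ?e ^ card A = emeasure (coord_lebesgue A) ?B"
    using assms unfolding coord_lebesgue_def by (subst lborel_product.emeasure_PiM) auto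
  also have "\<dots> = (\<integral>\<^sup>+x. indicator ?B x \<partial>coord_lebesgue A)"
    using assms unfolding coord_lebesgue_def
    by (intro nn_integral_indicator[symmetric] sets_PiM_I_finite) auto
  also have "\<dots> \<le> ?I"
  proof (intro nn_integral_mono)
    fix x :: "'a \<Rightarrow> real"
    show "indicator ?B x \<le> ennreal (simplex_density (-1/2) A x)"
    proof (cases "x \<in> ?B")
      case True
      then have x: "0 < x a" "x a < ?e" if "a \<in> A" for a using that by (auto simp: PiE_iff)
      have "sum x A \<le> real (card A) * ?e"
        using x by (intro sum_bounded_above less_imp_le)
      also have "\<dots> < 1" by (simp add: field_simps)
      finally have S: "x \<in> open_simplex A" using x by (auto simp: open_simplex_def)
      have "1 \<le> simplex_prod A x powr (-1/2)"
        using powr_mono2'[of "-1/2" "simplex_prod A x" 1] simplex_prod_pos[OF S] simplex_prod_le_1[OF assms S] by simp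
      then show ?thesis using S True by (simp add: simplex_density_def ennreal_leI)
    qed simp
  qed
  finally have "ennreal (?e ^ card A) \<le> ennreal (simplex_const A)" unfolding eq by (simp add: ennreal_power)
  moreover have "0 < ?e ^ card A" by simp
  ultimately show "0 < simplex_const A"
    by (metis ennreal_le_iff2 less_le_trans not_le)
qed

text \<open>Tonelli over disjoint blocks of coordinates. Measurability is required over every
  \<open>J\<close> containing \<open>A r\<close>, as each factor appears under the integral over its
  own block and under the one over the union.\<close>

lemma nn_integral_prod_blocks:
  fixes g :: "'r \<Rightarrow> ('j \<Rightarrow> real) \<Rightarrow> ennreal"
  assumes "finite R" "\<And>r. r \<in> R \<Longrightarrow> finite (A r)" "disjoint_family_on A R"
    and "\<And>r J. r \<in> R \<Longrightarrow> A r \<subseteq> J \<Longrightarrow> g r \<in> borel_measurable (Pi\<^sub>M J (\<lambda>_. lborel))"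
    and "\<And>r x y. r \<in> R \<Longrightarrow> (\<And>a. a \<in> A r \<Longrightarrow> x a = y a) \<Longrightarrow> g r x = g r y"
  shows "(\<integral>\<^sup>+x. (\<Prod>r\<in>R. g r x) \<partial>coord_lebesgue (\<Union>r\<in>R. A r)) =
    (\<Prod>r\<in>R. \<integral>\<^sup>+x. g r x \<partial>coord_lebesgue (A r))"
  using assms
proof (induction R rule: finite_induct)
  case empty
  show ?case by (simp add: coord_lebesgue_def PiM_empty)
next
  case (insert r R)
  let ?U = "\<Union>r\<in>R. A r"
  have dis: "A r \<inter> ?U = {}"
    using insert.prems(2) insert.hyps unfolding disjoint_family_on_def by auto
  have fin: "finite (A r)" "finite ?U" using insert.prems(1) insert.hyps by auto
  have meas: "(\<lambda>x. \<Prod>r\<in>R. g r x) \<in> borel_measurable (Pi\<^sub>M ?U (\<lambda>_. lborel))"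
    by (intro borel_measurable_prod_ennreal insert.prems(3)) auto
  have "(\<integral>\<^sup>+x. (\<Prod>r\<in>insert r R. g r x) \<partial>coord_lebesgue (A r \<union> ?U)) =
      (\<integral>\<^sup>+x. (\<integral>\<^sup>+y. (\<Prod>s\<in>insert r R. g s (merge (A r) ?U (x, y))) \<partial>coord_lebesgue ?U) \<partial>coord_lebesgue (A r))"
    unfolding coord_lebesgue_def
    by (rule lborel_product.product_nn_integral_fold[OF dis fin, where f = "\<lambda>x. \<Prod>r\<in>insert r R. g r x"])
      (auto intro!: borel_measurable_prod_ennreal insert.prems(3))
  also have "\<dots> = (\<integral>\<^sup>+x. (\<integral>\<^sup>+y. g r x * (\<Prod>r\<in>R. g r y) \<partial>coord_lebesgue ?U) \<partial>coord_lebesgue (A r))"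
  proof (intro nn_integral_cong)
    fix x y :: "'j \<Rightarrow> real"
    have "g r (merge (A r) ?U (x, y)) = g r x"
      by (intro insert.prems(4)) (auto simp: merge_def)
    moreover have "g s (merge (A r) ?U (x, y)) = g s y" if "s \<in> R" for s
      using that dis by (intro insert.prems(4)) (auto simp: merge_def)
    ultimately show "(\<Prod>s\<in>insert r R. g s (merge (A r) ?U (x, y))) = g r x * (\<Prod>r\<in>R. g r y)"
      using insert.hyps by simp
  qed
  also have "\<dots> = (\<integral>\<^sup>+x. g r x \<partial>coord_lebesgue (A r)) * (\<integral>\<^sup>+y. (\<Prod>r\<in>R. g r y) \<partial>coord_lebesgue ?U)"
    using meas insert.prems(3)[of r "A r"]
    by (simp add: coord_lebesgue_def nn_integral_cmult nn_integral_multc)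
  also have "(\<integral>\<^sup>+y. (\<Prod>r\<in>R. g r y) \<partial>coord_lebesgue ?U) = (\<Prod>r\<in>R. \<integral>\<^sup>+x. g r x \<partial>coord_lebesgue (A r))"
  proof (rule insert.IH)
    show "disjoint_family_on A R" using insert.prems(2) by (auto simp: disjoint_family_on_def)
    show "g s x = g s y" if "s \<in> R" "\<And>a. a \<in> A s \<Longrightarrow> x a = y a" for s x y
      using that by (intro insert.prems(4)) auto
  qed (use insert.prems(1,3) in auto)
  finally show ?case using insert.hyps by simp
qed

section \<open>Reference priors for block diagonal information\<close>

text \<open>The inequality \<open>ln u \<le> u - 1\<close> at \<open>u = s powr (-1/4)\<close>. The
  exponent is the gap between the densities with exponents -1/2 and -3/4.\<close>

lemma neg_ln_le_powr:
  fixes s :: real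
  assumes "0 < s"
  shows "- ln s \<le> 4 * s powr (-1/4)"
proof -
  have "ln (s powr (-1/4)) \<le> s powr (-1/4) - 1" using assms by (intro ln_le_minus_one) auto
  then show ?thesis using assms by (simp add: ln_powr)
qed

text \<open>What the recursion needs to know about the statistical model. \<open>M j\<close> stands
  for the separator probability attached to the group at list position \<open>j\<close>, and
  \<open>K\<close> for the number of trials. \<open>M_cong\<close> says that \<open>M j\<close>
  ignores its own group, which makes it cancel; \<open>M_lower\<close> and \<open>M_upper\<close>
  control its logarithm. The lower bound runs over all groups, so that no relation between their
  order and the model is presupposed.\<close>

locale block_diagonal_model =
  fixes D :: "'d set" and f :: "('j \<Rightarrow> real) \<Rightarrow> 'd \<Rightarrow> real" and Gs :: "'j list list"
    and K :: real and M :: "nat \<Rightarrow> ('j \<Rightarrow> real) \<Rightarrow> real" and \<Theta> :: "('j \<Rightarrow> real) set"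
  assumes dist: "distinct (concat Gs)"
    and \<Theta>_eq: "\<Theta> = {x \<in> extensional (set (concat Gs)). \<forall>j<length Gs. x \<in> open_simplex (set (Gs ! j))}"
    and K: "1 \<le> K"
    and fisher: "\<And>x a b. x \<in> \<Theta> \<Longrightarrow> a \<in> set (concat Gs) \<Longrightarrow> b \<in> set (concat Gs) \<Longrightarrow>
      fisher_info D f x a b = block_info Gs (\<lambda>j. K * M j x) x a b"
    and M_lower: "\<And>j x. j < length Gs \<Longrightarrow> x \<in> \<Theta> \<Longrightarrow> (\<Prod>r<length Gs. simplex_prod (set (Gs ! r)) x) \<le> M j x"
    and M_upper: "\<And>j x. j < length Gs \<Longrightarrow> x \<in> \<Theta> \<Longrightarrow> M j x \<le> 1"
    and M_measurable: "\<And>j. j < length Gs \<Longrightarrow> M j \<in> borel_measurable (coord_lebesgue (set (concat Gs)))"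
    and M_cong: "\<And>j x y. j < length Gs \<Longrightarrow>
      (\<And>a. a \<in> set (concat Gs) \<Longrightarrow> a \<notin> set (Gs ! j) \<Longrightarrow> x a = y a) \<Longrightarrow> M j x = M j y"
begin

abbreviation "m \<equiv> length Gs"
abbreviation "A r \<equiv> set (Gs ! r)"
abbreviation "later j \<equiv> coords_from Gs (Suc j)"
abbreviation "init j \<equiv> coords_before Gs (Suc j)"

text \<open>The claimed conditional density of group \<open>r\<close>: a normalized Dirichlet
  density that ignores all preceding groups.\<close>

definition prior_factor :: "nat \<Rightarrow> ('j \<Rightarrow> real) \<Rightarrow> real" where
  "prior_factor r x = simplex_prod (A r) x powr (-1/2) / simplex_const (A r)"

definition later_density :: "nat \<Rightarrow> ('j \<Rightarrow> real) \<Rightarrow> real" where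
  "later_density j \<nu> = (\<Prod>r\<in>{j<..<m}. simplex_density (-1/2) (A r) \<nu> / simplex_const (A r))"

lemma coords_before_eq: "j \<le> m \<Longrightarrow> coords_before Gs j = (\<Union>r<j. A r)"
  by (force simp: coords_before_def set_conv_nth[of "take j Gs"])

lemma later_eq: "later j = (\<Union>r\<in>{j<..<m}. A r)"
proof -
  have "(\<exists>g\<in>set (drop (Suc j) Gs). a \<in> set g) \<longleftrightarrow> (\<exists>r\<in>{j<..<m}. a \<in> A r)" for a
  proof
    assume "\<exists>r\<in>{j<..<m}. a \<in> A r"
    then obtain r where r: "j < r" "r < m" "a \<in> A r" by auto
    then have "Gs ! r = drop (Suc j) Gs ! (r - Suc j)" "r - Suc j < length (drop (Suc j) Gs)" by auto
    then have "Gs ! r \<in> set (drop (Suc j) Gs)" by (metis nth_mem)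
    then show "\<exists>g\<in>set (drop (Suc j) Gs). a \<in> set g" using r by blast
  next
    assume "\<exists>g\<in>set (drop (Suc j) Gs). a \<in> set g"
    then obtain i where "i < length (drop (Suc j) Gs)" "a \<in> set (drop (Suc j) Gs ! i)"
      by (metis in_set_conv_nth)
    then show "\<exists>r\<in>{j<..<m}. a \<in> A r" by (intro bexI[of _ "Suc j + i"]) auto
  qed
  then show ?thesis by (auto simp: coords_from_def)
qed

lemma all_coords: "set (concat Gs) = (\<Union>r<m. A r)"
  using coords_before_eq[of m] by (simp add: coords_before_def)

lemma A_disjoint: "r < m \<Longrightarrow> s < m \<Longrightarrow> r \<noteq> s \<Longrightarrow> A r \<inter> A s = {}"
  using nth_block_disjoint[OF dist] by blast

lemma init_eq: "j < m \<Longrightarrow> init j = (\<Union>r\<le>j. A r)"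
  using coords_before_eq[of "Suc j"] by (simp add: lessThan_Suc_atMost)

lemma later_init_disjoint:
  assumes "j < m"
  shows "init j \<inter> later j = {}"
proof -
  have "A r \<inter> A s = {}" if "r \<le> j" "s \<in> {j<..<m}" for r s
    using that by (intro A_disjoint) auto
  then show ?thesis unfolding init_eq[OF assms] later_eq by blast
qed

lemma later_init_Un:
  assumes "j < m"
  shows "init j \<union> later j = set (concat Gs)"
proof -
  have "{..<m} = {..j} \<union> {j<..<m}" using assms by auto
  then show ?thesis unfolding all_coords init_eq[OF assms] later_eq by (simp only: UN_Un)
qed

lemma A_subset_init: "r \<le> j \<Longrightarrow> j < m \<Longrightarrow> A r \<subseteq> init j"
  unfolding init_eq by blast

lemma A_subset_later: "j < r \<Longrightarrow> r < m \<Longrightarrow> A r \<subseteq> later j"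
  by (auto simp: later_eq)

lemma merge_init: "j < m \<Longrightarrow> a \<in> init j \<Longrightarrow> merge (init j) (later j) (z, \<nu>) a = z a"
  by (simp add: merge_def)

lemma merge_later: "j < m \<Longrightarrow> a \<in> later j \<Longrightarrow> merge (init j) (later j) (z, \<nu>) a = \<nu> a"
  using later_init_disjoint[of j] by (auto simp: merge_def)

lemma merge_simplex_init:
  assumes "r \<le> j" "j < m"
  shows "merge (init j) (later j) (z, \<nu>) \<in> open_simplex (A r) \<longleftrightarrow> z \<in> open_simplex (A r)"
    and "simplex_prod (A r) (merge (init j) (later j) (z, \<nu>)) = simplex_prod (A r) z"
  using A_subset_init[OF assms] merge_init[OF assms(2)]
  by (intro open_simplex_cong simplex_prod_cong; auto)+

lemma merge_simplex_later:
  assumes "j < r" "r < m"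
  shows "merge (init j) (later j) (z, \<nu>) \<in> open_simplex (A r) \<longleftrightarrow> \<nu> \<in> open_simplex (A r)"
    and "simplex_prod (A r) (merge (init j) (later j) (z, \<nu>)) = simplex_prod (A r) \<nu>"
  using A_subset_later[OF assms] merge_later[of j] assms
  by (intro open_simplex_cong simplex_prod_cong; auto)+

lemma merge_mem_\<Theta>:
  assumes "j < m" "\<And>r. r \<le> j \<Longrightarrow> z \<in> open_simplex (A r)"
  shows "merge (init j) (later j) (z, \<nu>) \<in> \<Theta> \<longleftrightarrow> (\<forall>r\<in>{j<..<m}. \<nu> \<in> open_simplex (A r))"
proof -
  have "merge (init j) (later j) (z, \<nu>) \<in> extensional (set (concat Gs))"
    unfolding later_init_Un[OF assms(1), symmetric] by (auto simp: merge_def extensional_def)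
  moreover have "merge (init j) (later j) (z, \<nu>) \<in> open_simplex (A r) \<longleftrightarrow> (j < r \<longrightarrow> \<nu> \<in> open_simplex (A r))"
    if "r < m" for r
    using merge_simplex_init(1)[of r j] merge_simplex_later(1)[of j r] assms that by (cases "j < r") auto
  ultimately show ?thesis unfolding \<Theta>_eq by auto
qed

lemma later_density_eq:
  "later_density j \<nu> = (if \<forall>r\<in>{j<..<m}. \<nu> \<in> open_simplex (A r) then \<Prod>r\<in>{j<..<m}. prior_factor r \<nu> else 0)"
  by (auto simp: later_density_def prior_factor_def simplex_density_def indicator_def intro!: prod.cong)

lemma ln_det_h_block:
  assumes "x \<in> \<Theta>" "j < m"
  shows "ln (Determinant.det (h_block D f Gs j x)) =
      real (length (Gs ! j)) * ln (K * M j x) - ln (simplex_prod (A j) x)"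
    and "invertible_mat (fisher_matrix D f (concat Gs) x)"
proof -
  have pos: "0 < simplex_prod (A r) x" if "r < m" for r
    using assms that by (intro simplex_prod_pos) (auto simp: \<Theta>_eq)
  then have "0 < (\<Prod>r<m. simplex_prod (A r) x)" by (intro prod_pos) auto
  then have M: "0 < K * M r x" if "r < m" for r
    using M_lower[OF that assms(1)] K by auto
  note h = h_block_block_diagonal[of Gs j x "\<lambda>j. K * M j x" D f]
  have *: "\<And>i. i < m \<Longrightarrow> x \<in> open_simplex (A i)" "\<And>i. i < m \<Longrightarrow> K * M i x \<noteq> 0"
    using M assms(1) by (auto simp: \<Theta>_eq less_le)
  show "invertible_mat (fisher_matrix D f (concat Gs) x)"
    by (rule h(1)[OF dist assms(2) * fisher[OF assms(1)]])
  have "Determinant.det (h_block D f Gs j x) = (K * M j x) ^ length (Gs ! j) / simplex_prod (A j) x"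
    by (rule h(2)[OF dist assms(2) * fisher[OF assms(1)]])
  moreover have "ln ((K * M j x) ^ length (Gs ! j)) = real (length (Gs ! j)) * ln (K * M j x)"
    using M[OF assms(2)] by (intro ln_realpow)
  ultimately show "ln (Determinant.det (h_block D f Gs j x)) =
      real (length (Gs ! j)) * ln (K * M j x) - ln (simplex_prod (A j) x)"
    using zero_less_power[OF M[OF assms(2)]] pos[OF assms(2)] by (simp only: ln_divide_pos)
qed

text \<open>Kept general in \<open>e\<close>: the value -1/2 gives total mass one, the value -3/4
  the dominating function. The constants are those of -1/2 in both uses.\<close>

lemma nn_integral_later_densities:
  "(\<integral>\<^sup>+\<nu>. ennreal (\<Prod>r\<in>{j<..<m}. simplex_density e (A r) \<nu> / simplex_const (A r)) \<partial>coord_lebesgue (later j)) =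
    (\<Prod>r\<in>{j<..<m}. (\<integral>\<^sup>+\<nu>. ennreal (simplex_density e (A r) \<nu>) \<partial>coord_lebesgue (A r)) / ennreal (simplex_const (A r)))"
proof -
  have c: "0 < simplex_const (A r)" for r by (intro simplex_const) auto
  have e: "ennreal (simplex_density e (A r) \<nu> / simplex_const (A r)) =
      ennreal (simplex_density e (A r) \<nu>) / ennreal (simplex_const (A r))" for r \<nu>
    using c[of r] by (simp add: divide_ennreal simplex_density_nonneg)
  have "(\<integral>\<^sup>+\<nu>. ennreal (\<Prod>r\<in>{j<..<m}. simplex_density e (A r) \<nu> / simplex_const (A r)) \<partial>coord_lebesgue (later j)) =
     (\<integral>\<^sup>+\<nu>. (\<Prod>r\<in>{j<..<m}. ennreal (simplex_density e (A r) \<nu> / simplex_const (A r))) \<partial>coord_lebesgue (later j))"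
    using c by (intro nn_integral_cong) (auto simp: prod_ennreal simplex_density_nonneg less_imp_le)
  also have "\<dots> = (\<Prod>r\<in>{j<..<m}. \<integral>\<^sup>+\<nu>. ennreal (simplex_density e (A r) \<nu> / simplex_const (A r)) \<partial>coord_lebesgue (A r))"
    unfolding later_eq
  proof (rule nn_integral_prod_blocks)
    show "disjoint_family_on A {j<..<m}" using A_disjoint by (auto simp: disjoint_family_on_def)
    show "(\<lambda>\<nu>. ennreal (simplex_density e (A r) \<nu> / simplex_const (A r))) \<in> borel_measurable (Pi\<^sub>M J (\<lambda>_. lborel))"
      if "A r \<subseteq> J" for r J
      using simplex_density_measurable[of "A r" J e] that by auto
    show "ennreal (simplex_density e (A r) x / simplex_const (A r)) = ennreal (simplex_density e (A r) y / simplex_const (A r))"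
      if "\<And>a. a \<in> A r \<Longrightarrow> x a = y a" for r x y
      using simplex_density_cong[of "A r" x y e] that by simp
  qed auto
  also have "\<dots> = (\<Prod>r\<in>{j<..<m}. (\<integral>\<^sup>+\<nu>. ennreal (simplex_density e (A r) \<nu>) \<partial>coord_lebesgue (A r)) / ennreal (simplex_const (A r)))"
    unfolding e
    by (intro prod.cong refl nn_integral_divide, unfold coord_lebesgue_def,
        rule measurable_compose[OF simplex_density_measurable measurable_ennreal]) auto
  finally show ?thesis .
qed

lemma later_densities_measurable:
  "(\<lambda>\<nu>. \<Prod>r\<in>{j<..<m}. simplex_density e (A r) \<nu> / simplex_const (A r)) \<in> borel_measurable (coord_lebesgue (later j))"
  unfolding coord_lebesgue_def
  by (intro borel_measurable_prod borel_measurable_divide borel_measurable_const simplex_density_measurable)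
    (auto simp: later_eq)

lemma simplex_const_pos: "0 < simplex_const (A r)"
  by (intro simplex_const) auto

lemma later_density_integral:
  "integrable (coord_lebesgue (later j)) (later_density j)"
  "(\<integral>\<nu>. later_density j \<nu> \<partial>coord_lebesgue (later j)) = 1"
proof -
  have "(\<integral>\<^sup>+\<nu>. ennreal (later_density j \<nu>) \<partial>coord_lebesgue (later j)) = 1"
    unfolding later_density_def nn_integral_later_densities
  proof (intro prod.neutral ballI)
    fix r
    show "(\<integral>\<^sup>+\<nu>. ennreal (simplex_density (-1/2) (A r) \<nu>) \<partial>coord_lebesgue (A r)) / ennreal (simplex_const (A r)) = 1"
      using simplex_const[of "A r"] by (simp add: divide_ennreal)
  qed
  moreover have "later_density j \<nu> \<ge> 0" for \<nu>
    using simplex_const_pos by (auto simp: later_density_def simplex_density_nonneg less_imp_le intro!: prod_nonneg)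
  ultimately have "has_bochner_integral (coord_lebesgue (later j)) (later_density j) 1"
    using later_densities_measurable[of "-1/2" j]
    by (intro has_bochner_integral_nn_integral) (auto simp: later_density_def[abs_def])
  then show "integrable (coord_lebesgue (later j)) (later_density j)"
    "(\<integral>\<nu>. later_density j \<nu> \<partial>coord_lebesgue (later j)) = 1"
    by (auto simp: has_bochner_integral_iff)
qed

lemma later_dominating_integrable:
  "integrable (coord_lebesgue (later j))
    (\<lambda>\<nu>. \<Prod>r\<in>{j<..<m}. simplex_density (-3/4) (A r) \<nu> / simplex_const (A r))"
proof (rule integrableI_nonneg)
  have "(\<integral>\<^sup>+\<nu>. ennreal (simplex_density (-3/4) (A r) \<nu>) \<partial>coord_lebesgue (A r)) / ennreal (simplex_const (A r)) < \<infinity>" for r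
    using nn_integral_simplex_density_finite[of "A r"] simplex_const_pos[of r]
    by (auto simp: less_top[symmetric] ennreal_divide_eq_top_iff)
  then show "(\<integral>\<^sup>+\<nu>. ennreal (\<Prod>r\<in>{j<..<m}. simplex_density (-3/4) (A r) \<nu> / simplex_const (A r)) \<partial>coord_lebesgue (later j)) < \<infinity>"
    unfolding nn_integral_later_densities by (auto simp: less_top[symmetric] ennreal_prod_eq_top)
  show "AE \<nu> in coord_lebesgue (later j). 0 \<le> (\<Prod>r\<in>{j<..<m}. simplex_density (-3/4) (A r) \<nu> / simplex_const (A r))"
    using simplex_const_pos by (auto simp: simplex_density_nonneg less_imp_le intro!: prod_nonneg)
qed (rule later_densities_measurable)

section \<open>Integrability of the logarithmic term\<close>

lemma M_merge_measurable:
  assumes "j < m"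
  shows "(\<lambda>\<nu>. M j (merge (init j) (later j) (z, \<nu>))) \<in> borel_measurable (coord_lebesgue (later j))"
proof -
  let ?P = "\<lambda>J. Pi\<^sub>M J (\<lambda>_. lborel :: real measure)"
  \<comment> \<open>\<open>z\<close> itself need not be a point of the product space, but its
    restriction is one and gives the same merged parameter.\<close>
  have "Pair (restrict z (init j)) \<in> measurable (?P (later j)) (?P (init j) \<Otimes>\<^sub>M ?P (later j))"
    by (intro measurable_Pair1') (auto simp: space_PiM)
  then have "(\<lambda>\<nu>. merge (init j) (later j) (restrict z (init j), \<nu>)) \<in> measurable (?P (later j)) (?P (init j \<union> later j))"
    by (rule measurable_compose) (rule measurable_merge)
  moreover have "merge (init j) (later j) (restrict z (init j), \<nu>) = merge (init j) (later j) (z, \<nu>)" for \<nu>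
    by (auto simp: merge_def)
  ultimately have "(\<lambda>\<nu>. merge (init j) (later j) (z, \<nu>)) \<in> measurable (?P (later j)) (?P (set (concat Gs)))"
    unfolding later_init_Un[OF assms] by simp
  then show ?thesis
    using M_measurable[OF assms] unfolding coord_lebesgue_def by (rule measurable_compose)
qed

text \<open>By \<open>M_lower\<close>, \<open>- ln (M j)\<close> is at most the sum of
  \<open>- ln (simplex_prod (A r))\<close> over all groups. Groups up to \<open>j\<close> are held
  fixed and contribute a constant. Each later one contributes at most four times its own factor with
  power -1/4, hence at most four times the whole product, all of whose factors are at least one;
  \<open>real m\<close> bounds the number of these groups.\<close>

lemma ln_M_bound:
  assumes j: "j < m" and z: "\<And>r. r \<le> j \<Longrightarrow> z \<in> open_simplex (A r)"
    and \<nu>: "\<And>r. r \<in> {j<..<m} \<Longrightarrow> \<nu> \<in> open_simplex (A r)"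
  shows "\<bar>ln (K * M j (merge (init j) (later j) (z, \<nu>)))\<bar> \<le>
    (ln K + (\<Sum>r\<le>j. - ln (simplex_prod (A r) z)) + 4 * real m) * (\<Prod>r\<in>{j<..<m}. simplex_prod (A r) \<nu> powr (-1/4))"
proof -
  let ?y = "merge (init j) (later j) (z, \<nu>)"
  let ?u = "\<Prod>r\<in>{j<..<m}. simplex_prod (A r) \<nu> powr (-1/4)"
  have y: "?y \<in> \<Theta>" using merge_mem_\<Theta>[OF j z] \<nu> by auto
  have pos: "0 < simplex_prod (A r) ?y" if "r < m" for r
    using y that by (intro simplex_prod_pos) (auto simp: \<Theta>_eq)
  have P: "0 < (\<Prod>r<m. simplex_prod (A r) ?y)" using pos by (intro prod_pos) auto
  note M = M_lower[OF j y] M_upper[OF j y]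
  have M0: "0 < M j ?y" using P M(1) by simp
  have one: "1 \<le> simplex_prod (A r) \<nu> powr (-1/4)" if "r \<in> {j<..<m}" for r
    using powr_mono2'[of "-1/4" "simplex_prod (A r) \<nu>" 1] simplex_prod_pos[OF \<nu>[OF that]]
      simplex_prod_le_1[OF _ \<nu>[OF that]] by simp
  have u: "1 \<le> ?u" using one by (intro prod_ge_1)
  have le_u: "simplex_prod (A r) \<nu> powr (-1/4) \<le> ?u" if "r \<in> {j<..<m}" for r
  proof -
    have "1 \<le> (\<Prod>s\<in>{j<..<m} - {r}. simplex_prod (A s) \<nu> powr (-1/4))" using one by (intro prod_ge_1) auto
    then show ?thesis using that mult_left_mono[of 1 _ "simplex_prod (A r) \<nu> powr (-1/4)"]
      by (simp add: prod.remove[of "{j<..<m}" r])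
  qed
  have "ln (\<Prod>r<m. simplex_prod (A r) ?y) \<le> ln (M j ?y)" using P M0 M(1) by simp
  moreover have "ln (\<Prod>r<m. simplex_prod (A r) ?y) = (\<Sum>r<m. ln (simplex_prod (A r) ?y))"
    using pos by (intro ln_prod) (auto simp: less_imp_neq[symmetric])
  ultimately have "- ln (M j ?y) \<le> (\<Sum>r<m. - ln (simplex_prod (A r) ?y))" by (simp add: sum_negf)
  also have "\<dots> = (\<Sum>r\<le>j. - ln (simplex_prod (A r) ?y)) + (\<Sum>r\<in>{j<..<m}. - ln (simplex_prod (A r) ?y))"
    using j by (subst sum.union_disjoint[symmetric]) (auto intro!: sum.cong)
  also have "(\<Sum>r\<le>j. - ln (simplex_prod (A r) ?y)) = (\<Sum>r\<le>j. - ln (simplex_prod (A r) z))"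
    using merge_simplex_init(2)[OF _ j] by (intro sum.cong) auto
  also have "(\<Sum>r\<in>{j<..<m}. - ln (simplex_prod (A r) ?y)) \<le> (\<Sum>r\<in>{j<..<m}. 4 * ?u)"
  proof (intro sum_mono)
    fix r assume r: "r \<in> {j<..<m}"
    then have "simplex_prod (A r) ?y = simplex_prod (A r) \<nu>" using merge_simplex_later(2)[of j r] by auto
    then show "- ln (simplex_prod (A r) ?y) \<le> 4 * ?u"
      using neg_ln_le_powr[of "simplex_prod (A r) \<nu>"] simplex_prod_pos[OF \<nu>[OF r]] le_u[OF r] by simp
  qed
  also have "\<dots> \<le> 4 * real m * ?u"
    using u by (simp add: mult_right_mono)
  finally have 1: "- ln (M j ?y) \<le> (\<Sum>r\<le>j. - ln (simplex_prod (A r) z)) + 4 * real m * ?u" by simp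
  have nn: "0 \<le> (\<Sum>r\<le>j. - ln (simplex_prod (A r) z))"
    using z simplex_prod_pos simplex_prod_le_1 by (intro sum_nonneg) (force simp: ln_le_zero_iff)
  have K0: "0 \<le> ln K" using K by simp
  have "\<bar>ln (K * M j ?y)\<bar> \<le> ln K + - ln (M j ?y)"
  proof -
    have "ln (M j ?y) \<le> 0" using M0 M(2) by simp
    moreover have "ln (K * M j ?y) = ln K + ln (M j ?y)" using K M0 by (simp add: ln_mult_pos)
    ultimately show ?thesis using K0 by linarith
  qed
  also have "\<dots> \<le> (ln K + (\<Sum>r\<le>j. - ln (simplex_prod (A r) z))) + 4 * real m * ?u" using 1 by simp
  also have "\<dots> \<le> (ln K + (\<Sum>r\<le>j. - ln (simplex_prod (A r) z))) * ?u + 4 * real m * ?u"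
    using mult_left_mono[OF u, of "ln K + (\<Sum>r\<le>j. - ln (simplex_prod (A r) z))"] nn K0 by simp
  finally show ?thesis by (simp add: distrib_right)
qed

text \<open>The bound on the logarithm multiplies each factor of exponent -1/2 by one of exponent
  -1/4, which gives the integrable product of exponent -3/4.\<close>

lemma later_ln_M_integrable:
  assumes j: "j < m" and z: "\<And>r. r \<le> j \<Longrightarrow> z \<in> open_simplex (A r)"
  shows "integrable (coord_lebesgue (later j))
    (\<lambda>\<nu>. later_density j \<nu> * ln (K * M j (merge (init j) (later j) (z, \<nu>))))"
proof -
  define C where "C = ln K + (\<Sum>r\<le>j. - ln (simplex_prod (A r) z)) + 4 * real m"
  show ?thesis
  proof (rule Bochner_Integration.integrable_bound)
    show "integrable (coord_lebesgue (later j))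
        (\<lambda>\<nu>. C * (\<Prod>r\<in>{j<..<m}. simplex_density (-3/4) (A r) \<nu> / simplex_const (A r)))"
      by (intro integrable_mult_right later_dominating_integrable)
    show "(\<lambda>\<nu>. later_density j \<nu> * ln (K * M j (merge (init j) (later j) (z, \<nu>)))) \<in> borel_measurable (coord_lebesgue (later j))"
      using M_merge_measurable[OF j] later_densities_measurable[of "-1/2" j]
      by (auto simp: later_density_def[abs_def])
    have "\<bar>later_density j \<nu> * ln (K * M j (merge (init j) (later j) (z, \<nu>)))\<bar> \<le>
        C * (\<Prod>r\<in>{j<..<m}. simplex_density (-3/4) (A r) \<nu> / simplex_const (A r))" for \<nu>
    proof (cases "\<forall>r\<in>{j<..<m}. \<nu> \<in> open_simplex (A r)")
      case False
      then obtain r where "r \<in> {j<..<m}" "\<nu> \<notin> open_simplex (A r)" by auto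
      then have 0: "(\<Prod>r\<in>{j<..<m}. simplex_density (-3/4) (A r) \<nu> / simplex_const (A r)) = 0"
        by (intro prod_zero bexI[of _ r]) (auto simp: simplex_density_def)
      have "later_density j \<nu> = 0" using False by (auto simp: later_density_eq)
      then show ?thesis unfolding 0 by simp
    next
      case True
      have nn: "0 \<le> later_density j \<nu>"
        using simplex_const_pos by (auto simp: later_density_def simplex_density_nonneg less_imp_le intro!: prod_nonneg)
      have "\<bar>later_density j \<nu> * ln (K * M j (merge (init j) (later j) (z, \<nu>)))\<bar> \<le>
          later_density j \<nu> * (C * (\<Prod>r\<in>{j<..<m}. simplex_prod (A r) \<nu> powr (-1/4)))"
        unfolding abs_mult abs_of_nonneg[OF nn] C_def
        using True ln_M_bound[OF j z, of \<nu>] nn by (intro mult_left_mono) auto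
      also have "\<dots> = C * (\<Prod>r\<in>{j<..<m}. simplex_density (-1/2) (A r) \<nu> / simplex_const (A r) * simplex_prod (A r) \<nu> powr (-1/4))"
        by (simp only: later_density_def prod.distrib mult_ac)
      also have "\<dots> = C * (\<Prod>r\<in>{j<..<m}. simplex_density (-3/4) (A r) \<nu> / simplex_const (A r))"
        using True by (intro arg_cong2[where f = "(*)"] prod.cong refl)
          (auto simp: simplex_density_def simp flip: powr_add)
      finally show ?thesis .
    qed
    then show "AE \<nu> in coord_lebesgue (later j). norm (later_density j \<nu> * ln (K * M j (merge (init j) (later j) (z, \<nu>)))) \<le>
        norm (C * (\<Prod>r\<in>{j<..<m}. simplex_density (-3/4) (A r) \<nu> / simplex_const (A r)))"
      by (intro AE_I2) (unfold real_norm_def, rule order_trans[OF _ abs_ge_self])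
  qed
qed

section \<open>The conditional densities and their uniqueness\<close>

definition mean_ln_M :: "nat \<Rightarrow> ('j \<Rightarrow> real) \<Rightarrow> real" where
  "mean_ln_M j z = (\<integral>\<nu>. later_density j \<nu> * ln (K * M j (merge (init j) (later j) (z, \<nu>))) \<partial>coord_lebesgue (later j))"

lemma later_integrand_eq:
  assumes j: "j < m" and z: "\<And>r. r \<le> j \<Longrightarrow> z \<in> open_simplex (A r)"
    and q: "\<And>r y. j < r \<Longrightarrow> r < m \<Longrightarrow> y \<in> \<Theta> \<Longrightarrow> q r y = prior_factor r y"
  shows "later_integrand D f \<Theta> Gs q j z \<nu> =
    real (length (Gs ! j)) * (later_density j \<nu> * ln (K * M j (merge (init j) (later j) (z, \<nu>))))
      - ln (simplex_prod (A j) z) * later_density j \<nu>"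
proof (cases "\<forall>r\<in>{j<..<m}. \<nu> \<in> open_simplex (A r)")
  case False
  then have "merge (init j) (later j) (z, \<nu>) \<notin> \<Theta>" using merge_mem_\<Theta>[OF j z] by blast
  moreover have "later_density j \<nu> = 0" using False by (auto simp: later_density_eq)
  ultimately show ?thesis by (simp add: later_integrand_def Let_def)
next
  case True
  let ?y = "merge (init j) (later j) (z, \<nu>)"
  have y: "?y \<in> \<Theta>" using merge_mem_\<Theta>[OF j z] True by blast
  have "(\<Prod>r\<in>{j<..<m}. q r ?y) = later_density j \<nu>"
    unfolding later_density_eq using True q[OF _ _ y] merge_simplex_later(2)[of j]
    by (auto simp: prior_factor_def intro!: prod.cong)
  then show ?thesis
    using y ln_det_h_block(1)[OF y j] merge_simplex_init(2)[of j j z \<nu>] j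
    by (simp add: later_integrand_def Let_def right_diff_distrib mult_ac)
qed

text \<open>The term \<open>ln (simplex_prod (A j) z)\<close> is constant in the later coordinates,
  whose density has mass one, so it passes through the expectation and turns into the power -1/2.
  All other dependence on \<open>z\<close> sits in \<open>mean_ln_M\<close>.\<close>

lemma ref_weight_eq:
  assumes j: "j < m" and z: "\<And>r. r \<le> j \<Longrightarrow> z \<in> open_simplex (A r)"
    and q: "\<And>r y. j < r \<Longrightarrow> r < m \<Longrightarrow> y \<in> \<Theta> \<Longrightarrow> q r y = prior_factor r y"
  shows "integrable (coord_lebesgue (later j)) (later_integrand D f \<Theta> Gs q j z)"
    and "ref_weight D f \<Theta> Gs q j z =
      exp (1 / 2 * (real (length (Gs ! j)) * mean_ln_M j z)) * simplex_prod (A j) z powr (-1/2)"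
proof -
  let ?F = "\<lambda>\<nu>. later_density j \<nu> * ln (K * M j (merge (init j) (later j) (z, \<nu>)))"
  have eq: "later_integrand D f \<Theta> Gs q j z =
      (\<lambda>\<nu>. real (length (Gs ! j)) * ?F \<nu> - ln (simplex_prod (A j) z) * later_density j \<nu>)"
    by (rule ext, rule later_integrand_eq[OF assms])
  note int = later_ln_M_integrable[OF j z] later_density_integral(1)[of j]
  show "integrable (coord_lebesgue (later j)) (later_integrand D f \<Theta> Gs q j z)"
    unfolding eq using int by (intro Bochner_Integration.integrable_diff integrable_mult_right) auto
  have "(\<integral>\<nu>. later_integrand D f \<Theta> Gs q j z \<nu> \<partial>coord_lebesgue (later j)) =
      real (length (Gs ! j)) * mean_ln_M j z - ln (simplex_prod (A j) z)"
    unfolding eq mean_ln_M_def using int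
    by (subst Bochner_Integration.integral_diff) (auto simp: later_density_integral(2))
  moreover have "exp (1 / 2 * (u - ln s)) = exp (1 / 2 * u) * s powr (-1/2)" if "0 < s" for u s :: real
    using that by (simp add: powr_def diff_divide_distrib flip: exp_add)
  ultimately show "ref_weight D f \<Theta> Gs q j z =
      exp (1 / 2 * (real (length (Gs ! j)) * mean_ln_M j z)) * simplex_prod (A j) z powr (-1/2)"
    using simplex_prod_pos[OF z[of j]] by (simp only: ref_weight_def order_refl)
qed

text \<open>The exponential factor is taken at \<open>x\<close> and not at the merged point:
  \<open>M j\<close> ignores group \<open>j\<close>, so its mean logarithm is constant in
  \<open>\<mu>\<close> and disappears in the normalization.\<close>

lemma group_integrand_eq:
  assumes j: "j < m" and x: "x \<in> \<Theta>" and \<mu>: "\<mu> \<in> extensional (A j)"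
    and q: "\<And>r y. j < r \<Longrightarrow> r < m \<Longrightarrow> y \<in> \<Theta> \<Longrightarrow> q r y = prior_factor r y"
  shows "group_integrand D f \<Theta> Gs q j x \<mu> =
    exp (1 / 2 * (real (length (Gs ! j)) * mean_ln_M j x)) * simplex_density (-1/2) (A j) \<mu>"
proof -
  let ?z = "merge (coords_before Gs j) (A j) (x, \<mu>)"
  have xs: "x \<in> open_simplex (A r)" if "r < m" for r using x that by (auto simp: \<Theta>_eq)
  have before: "coords_before Gs j = (\<Union>r<j. A r)" using j by (simp add: coords_before_eq)
  have dis: "coords_before Gs j \<inter> A j = {}" 
  proof -
    have "A r \<inter> A j = {}" if "r < j" for r using that j by (intro A_disjoint) auto
    then show ?thesis unfolding before by blast
  qed
  have init: "init j = coords_before Gs j \<union> A j"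
    unfolding before init_eq[OF j] by (auto simp: le_less)
  have zA: "?z a = \<mu> a" if "a \<in> A j" for a using that dis by (auto simp: merge_def)
  have zj: "?z \<in> open_simplex (A j) \<longleftrightarrow> \<mu> \<in> open_simplex (A j)" "simplex_prod (A j) ?z = simplex_prod (A j) \<mu>"
    using zA by (auto intro: simplex_prod_cong simp: open_simplex_cong[of "A j" ?z \<mu>])
  have zr: "?z \<in> open_simplex (A r)" if "r < j" for r
  proof -
    have "?z \<in> open_simplex (A r) \<longleftrightarrow> x \<in> open_simplex (A r)"
      using that j by (intro open_simplex_cong) (auto simp: merge_def before)
    then show ?thesis using xs[of r] that j by simp
  qed
  show ?thesis
  proof (cases "\<mu> \<in> open_simplex (A j)")
    case False
    have "?z \<noteq> restrict y (init j)" if "y \<in> \<Theta>" for y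
    proof
      assume eq: "?z = restrict y (init j)"
      have "y \<in> open_simplex (A j)" using that j by (auto simp: \<Theta>_eq)
      then have "restrict y (init j) \<in> open_simplex (A j)"
        using A_subset_init[of j j] j by (subst open_simplex_cong[of _ _ y]) auto
      then show False using eq zj False by simp
    qed
    then have "?z \<notin> (\<lambda>y. restrict y (init j)) ` \<Theta>" by blast
    then show ?thesis using False by (simp add: group_integrand_def Let_def simplex_density_def)
  next
    case True
    then have z: "?z \<in> open_simplex (A r)" if "r \<le> j" for r
      using that zr[of r] zj by (cases "r = j") auto
    \<comment> \<open>Completing \<open>?z\<close> by the later coordinates of \<open>x\<close>
      gives a parameter that projects to \<open>?z\<close>, so the indicator of the section is
      one.\<close>
    have "merge (init j) (later j) (?z, x) \<in> \<Theta>"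
      using merge_mem_\<Theta>[OF j z] xs by auto
    moreover have "restrict (merge (init j) (later j) (?z, x)) (init j) = ?z"
      by (auto simp: init merge_def restrict_def)
    ultimately have mem: "?z \<in> (\<lambda>y. restrict y (init j)) ` \<Theta>" by (metis imageI)
    have "mean_ln_M j ?z = mean_ln_M j x"
      unfolding mean_ln_M_def
    proof (intro Bochner_Integration.integral_cong refl arg_cong2[where f = "(*)"] arg_cong[where f = ln] M_cong[OF j])
      fix \<nu> a assume "a \<notin> A j"
      then show "merge (init j) (later j) (?z, \<nu>) a = merge (init j) (later j) (x, \<nu>) a"
        by (auto simp: init merge_def)
    qed
    then show ?thesis
      using mem ref_weight_eq(2)[OF j z q] True zj
      by (simp add: group_integrand_def Let_def simplex_density_def)
  qed
qed

lemma conditional_density: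
  assumes j: "j < m" and x: "x \<in> \<Theta>"
    and q: "\<And>r y. j < r \<Longrightarrow> r < m \<Longrightarrow> y \<in> \<Theta> \<Longrightarrow> q r y = prior_factor r y"
  shows "integrable (coord_lebesgue (later j)) (later_integrand D f \<Theta> Gs q j x)"
    and "integrable (coord_lebesgue (A j)) (group_integrand D f \<Theta> Gs q j x)"
    and "(\<integral>\<mu>. group_integrand D f \<Theta> Gs q j x \<mu> \<partial>coord_lebesgue (A j)) > 0"
    and "ref_weight D f \<Theta> Gs q j x / (\<integral>\<mu>. group_integrand D f \<Theta> Gs q j x \<mu> \<partial>coord_lebesgue (A j)) =
      prior_factor j x"
proof -
  have xs: "x \<in> open_simplex (A r)" if "r \<le> j" for r using x j that by (auto simp: \<Theta>_eq)
  show "integrable (coord_lebesgue (later j)) (later_integrand D f \<Theta> Gs q j x)"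
    by (rule ref_weight_eq(1)[OF j xs q])
  let ?e = "exp (1 / 2 * (real (length (Gs ! j)) * mean_ln_M j x))"
  have sp: "\<mu> \<in> extensional (A j)" if "\<mu> \<in> space (coord_lebesgue (A j))" for \<mu>
    using that by (simp add: coord_lebesgue_def space_PiM PiE_def)
  note eq = group_integrand_eq[OF j x sp q]
  have hb: "has_bochner_integral (coord_lebesgue (A j)) (simplex_density (-1/2) (A j)) (simplex_const (A j))"
    using simplex_const[of "A j"] simplex_density_measurable[of "A j" "A j" "-1/2"]
    by (intro has_bochner_integral_nn_integral) (auto simp: simplex_density_nonneg coord_lebesgue_def)
  have "has_bochner_integral (coord_lebesgue (A j)) (\<lambda>\<mu>. ?e * simplex_density (-1/2) (A j) \<mu>) (?e * simplex_const (A j))"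
    using hb by (intro has_bochner_integral_mult_right) auto
  then have "has_bochner_integral (coord_lebesgue (A j)) (group_integrand D f \<Theta> Gs q j x) (?e * simplex_const (A j))"
    by (subst has_bochner_integral_cong[OF refl eq refl])
  then show "integrable (coord_lebesgue (A j)) (group_integrand D f \<Theta> Gs q j x)"
    and I: "(\<integral>\<mu>. group_integrand D f \<Theta> Gs q j x \<mu> \<partial>coord_lebesgue (A j)) > 0"
    and "ref_weight D f \<Theta> Gs q j x / (\<integral>\<mu>. group_integrand D f \<Theta> Gs q j x \<mu> \<partial>coord_lebesgue (A j)) = prior_factor j x"
    using ref_weight_eq(2)[OF j xs q] simplex_const_pos[of j]
    by (auto simp: has_bochner_integral_iff prior_factor_def)
qed

text \<open>The conditional densities are existentially quantified in the definition, so they must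
  be shown to be forced. The one at \<open>j\<close> uses only those at positions above
  \<open>j\<close>, hence the induction on \<open>m - j\<close>; conversely
  \<open>prior_factor\<close> solves all the equations.\<close>

lemma is_reference_prior_iff:
  "is_reference_prior D f \<Theta> Gs \<pi> \<longleftrightarrow> (\<forall>x\<in>\<Theta>. \<pi> x = (\<Prod>j<m. prior_factor j x))"
proof
  assume "is_reference_prior D f \<Theta> Gs \<pi>"
  then obtain q where
    q: "\<And>j x. j < m \<Longrightarrow> x \<in> \<Theta> \<Longrightarrow> q j x = ref_weight D f \<Theta> Gs q j x /
          (\<integral>\<mu>. group_integrand D f \<Theta> Gs q j x \<mu> \<partial>coord_lebesgue (A j))"
    and \<pi>: "\<And>x. x \<in> \<Theta> \<Longrightarrow> \<pi> x = (\<Prod>j<m. q j x)"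
    unfolding is_reference_prior_def by blast
  have "q j x = prior_factor j x" if "j < m" "x \<in> \<Theta>" for j x
    using that
  proof (induction "m - j" arbitrary: j x rule: less_induct)
    case less
    have "q r y = prior_factor r y" if "j < r" "r < m" "y \<in> \<Theta>" for r y
      using that by (intro less.hyps) auto
    from conditional_density(4)[OF less.prems this] show ?case
      unfolding q[OF less.prems] .
  qed
  then show "\<forall>x\<in>\<Theta>. \<pi> x = (\<Prod>j<m. prior_factor j x)" using \<pi> by simp
next
  assume \<pi>: "\<forall>x\<in>\<Theta>. \<pi> x = (\<Prod>j<m. prior_factor j x)"
  show "is_reference_prior D f \<Theta> Gs \<pi>"
    unfolding is_reference_prior_def
  proof (intro conjI ballI exI[of _ prior_factor] allI impI)
    fix x assume x: "x \<in> \<Theta>"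
    show "invertible_mat (fisher_matrix D f (concat Gs) x)"
    \<comment> \<open>Invertibility is read off at position 0, which exists only if there is a
      group; without groups the matrix is 0 by 0.\<close>
    proof (cases "m = 0")
      case True
      then show ?thesis
        by (auto simp: fisher_matrix_def invertible_mat_def inverts_mat_def intro!: exI[of _ "1\<^sub>m 0"] eq_matI)
    next
      case False
      then show ?thesis using ln_det_h_block(2)[OF x, of 0] by simp
    qed
    show "\<pi> x = (\<Prod>j<m. prior_factor j x)" using \<pi> x by simp
    fix j assume j: "j < m"
    note c = conditional_density[OF j x refl]
    show "integrable (coord_lebesgue (later j)) (later_integrand D f \<Theta> Gs prior_factor j x)" by (rule c(1))
    show "integrable (coord_lebesgue (A j)) (group_integrand D f \<Theta> Gs prior_factor j x)" by (rule c(2))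
    show "(\<integral>\<mu>. group_integrand D f \<Theta> Gs prior_factor j x \<mu> \<partial>coord_lebesgue (A j)) > 0" by (rule c(3))
    show "prior_factor j x = ref_weight D f \<Theta> Gs prior_factor j x /
        (\<integral>\<mu>. group_integrand D f \<Theta> Gs prior_factor j x \<mu> \<partial>coord_lebesgue (A j))" by (rule c(4)[symmetric])
  qed
qed

end

section \<open>Pairwise Markov distributions\<close>

text \<open>Marginalization without change of domain: the result is again a function of full cells,
  constant in the coordinates of \<open>R\<close>, so marginals over different sets can be
  multiplied and divided pointwise.\<close>

definition sum_out :: "('v \<Rightarrow> 'l set) \<Rightarrow> 'v set \<Rightarrow> (('v \<Rightarrow> 'l) \<Rightarrow> real) \<Rightarrow> ('v \<Rightarrow> 'l) \<Rightarrow> real" where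
  "sum_out L R F i = (\<Sum>r\<in>Pi\<^sub>E R L. F (override_on i r R))"

lemma sum_out_empty [simp]: "sum_out L {} F i = F i"
  by (simp add: sum_out_def)

lemma sum_out_Un:
  assumes "A \<inter> B = {}"
  shows "sum_out L (A \<union> B) F i = sum_out L A (sum_out L B F) i"
proof -
  have "(\<Sum>r\<in>Pi\<^sub>E (A \<union> B) L. F (override_on i r (A \<union> B))) =
      (\<Sum>(a, b)\<in>Pi\<^sub>E A L \<times> Pi\<^sub>E B L. F (override_on (override_on i a A) b B))"
  proof (rule sum.reindex_bij_witness[where i = "\<lambda>(a, b). merge A B (a, b)" and j = "\<lambda>r. (restrict r A, restrict r B)"])
    fix r assume r: "r \<in> Pi\<^sub>E (A \<union> B) L"
    then show "(case (restrict r A, restrict r B) of (a, b) \<Rightarrow> merge A B (a, b)) = r"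
      by (auto simp: merge_def PiE_iff extensional_def fun_eq_iff)
    show "(restrict r A, restrict r B) \<in> Pi\<^sub>E A L \<times> Pi\<^sub>E B L" using r by auto
    have "override_on (override_on i (restrict r A) A) (restrict r B) B = override_on i r (A \<union> B)"
      by (auto simp: override_on_def fun_eq_iff)
    then show "(case (restrict r A, restrict r B) of (a, b) \<Rightarrow> F (override_on (override_on i a A) b B)) =
        F (override_on i r (A \<union> B))" by simp
  next
    fix b assume b: "b \<in> Pi\<^sub>E A L \<times> Pi\<^sub>E B L"
    obtain u v where uv: "b = (u, v)" "u \<in> Pi\<^sub>E A L" "v \<in> Pi\<^sub>E B L" using b by auto
    have "restrict (merge A B (u, v)) A = u" "restrict (merge A B (u, v)) B = v"
      using uv assms by (auto simp: merge_def fun_eq_iff PiE_iff extensional_def)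
    then show "(restrict (case b of (a, b) \<Rightarrow> merge A B (a, b)) A, restrict (case b of (a, b) \<Rightarrow> merge A B (a, b)) B) = b"
      using uv by simp
    show "(case b of (a, b) \<Rightarrow> merge A B (a, b)) \<in> Pi\<^sub>E (A \<union> B) L"
      using uv by (auto simp: merge_def PiE_iff extensional_def)
  qed
  then show ?thesis by (simp add: sum_out_def sum.cartesian_product)
qed

lemma sum_out_mult_left:
  assumes "\<And>r. r \<in> Pi\<^sub>E R L \<Longrightarrow> F (override_on i r R) = F i"
  shows "sum_out L R (\<lambda>i. F i * G i) i = F i * sum_out L R G i"
  using assms by (simp add: sum_out_def sum_distrib_left)

lemma sum_out_singleton: "sum_out L {\<gamma>} F i = (\<Sum>x\<in>L \<gamma>. F (i(\<gamma> := x)))"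
proof -
  have "bij_betw (\<lambda>x. \<lambda>a\<in>{\<gamma>}. x) (L \<gamma>) (Pi\<^sub>E {\<gamma>} L)"
    by (rule bij_betwI[where g = "\<lambda>r. r \<gamma>"]) (auto simp: PiE_iff extensional_def restrict_def fun_eq_iff)
  then have "(\<Sum>x\<in>L \<gamma>. F (override_on i (\<lambda>a\<in>{\<gamma>}. x) {\<gamma>})) = sum_out L {\<gamma>} F i"
    unfolding sum_out_def by (rule sum.reindex_bij_betw)
  moreover have "override_on i (\<lambda>a\<in>{\<gamma>}. x) {\<gamma>} = i(\<gamma> := x)" for x
    by (auto simp: override_on_def)
  ultimately show ?thesis by simp
qed

locale cell_space =
  fixes V :: "'v set" and L :: "'v \<Rightarrow> 'l set"
  assumes finV: "finite V" and finL: "\<And>\<gamma>. \<gamma> \<in> V \<Longrightarrow> finite (L \<gamma>)"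
    and neL: "\<And>\<gamma>. \<gamma> \<in> V \<Longrightarrow> L \<gamma> \<noteq> {}"
begin

abbreviation "cells \<equiv> Pi\<^sub>E V L"

lemma finite_cells: "D \<subseteq> V \<Longrightarrow> finite (Pi\<^sub>E D L)"
  using finV finL by (auto intro!: finite_PiE intro: finite_subset)

lemma cells_nonempty: "D \<subseteq> V \<Longrightarrow> Pi\<^sub>E D L \<noteq> {}"
  using neL by (auto simp: PiE_eq_empty_iff)

lemma override_cells: "i \<in> cells \<Longrightarrow> R \<subseteq> V \<Longrightarrow> r \<in> Pi\<^sub>E R L \<Longrightarrow> override_on i r R \<in> cells"
  by (fastforce simp: override_on_def PiE_iff extensional_def)

lemma override_cells': "i \<in> cells \<Longrightarrow> j \<in> cells \<Longrightarrow> override_on i j R \<in> cells"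
  by (auto simp: override_on_def PiE_iff extensional_def)

lemma update_cells: "i \<in> cells \<Longrightarrow> \<gamma> \<in> V \<Longrightarrow> x \<in> L \<gamma> \<Longrightarrow> i(\<gamma> := x) \<in> cells"
  by (auto simp: PiE_iff extensional_def)

lemma restrict_cells: "i \<in> cells \<Longrightarrow> D \<subseteq> V \<Longrightarrow> restrict i D \<in> Pi\<^sub>E D L"
  by (auto simp: PiE_iff)

lemma extend_cell:
  assumes "D \<subseteq> V" "d \<in> Pi\<^sub>E D L"
  obtains i where "i \<in> cells" "restrict i D = d"
proof -
  obtain j where j: "j \<in> cells" using cells_nonempty[of V] by auto
  have "override_on j d D \<in> cells" using override_cells[OF j assms] .
  moreover have "restrict (override_on j d D) D = d"
    using assms by (auto simp: override_on_def fun_eq_iff PiE_iff extensional_def)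
  ultimately show ?thesis using that by blast
qed

lemma sum_out_cong:
  assumes "\<And>j. j \<in> cells \<Longrightarrow> F j = G j" "i \<in> cells" "R \<subseteq> V"
  shows "sum_out L R F i = sum_out L R G i"
  using assms override_cells by (auto simp: sum_out_def intro!: sum.cong)

lemma sum_out_pos:
  assumes "\<And>j. j \<in> cells \<Longrightarrow> 0 < F j" "i \<in> cells" "R \<subseteq> V"
  shows "0 < sum_out L R F i"
  unfolding sum_out_def using assms override_cells finite_cells cells_nonempty by (intro sum_pos) auto

lemma sum_cells:
  assumes "i \<in> cells"
  shows "(\<Sum>j\<in>cells. F j) = sum_out L V F i"
  unfolding sum_out_def
proof (rule sum.cong)
  fix j assume "j \<in> cells"
  then have "override_on i j V = j" using assms by (auto simp: override_on_def fun_eq_iff PiE_iff extensional_def)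
  then show "F j = F (override_on i j V)" by simp
qed simp

lemma marginal_eq_sum_out:
  assumes "i \<in> cells" "D \<subseteq> V"
  shows "marginal V L D p (restrict i D) = sum_out L (V - D) p i"
  unfolding marginal_def sum_out_def
proof (rule sum.reindex_bij_witness[where j = "\<lambda>j. restrict j (V - D)" and i = "\<lambda>r. override_on i r (V - D)"])
  fix j assume j: "j \<in> {j \<in> cells. restrict j D = restrict i D}"
  have "j a = i a" if "a \<in> D" for a
    using j that by (metis (mono_tags, lifting) mem_Collect_eq restrict_apply')
  then show e: "override_on i (restrict j (V - D)) (V - D) = j"
    using j assms by (auto simp: override_on_def fun_eq_iff PiE_iff extensional_def)
  show "restrict j (V - D) \<in> Pi\<^sub>E (V - D) L" using j by auto
  show "p (override_on i (restrict j (V - D)) (V - D)) = p j" unfolding e ..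
next
  fix r assume r: "r \<in> Pi\<^sub>E (V - D) L"
  show "restrict (override_on i r (V - D)) (V - D) = r"
    using r by (auto simp: override_on_def fun_eq_iff PiE_iff extensional_def)
  show "override_on i r (V - D) \<in> {j \<in> cells. restrict j D = restrict i D}"
    using override_cells[OF assms(1) _ r] by (auto simp: override_on_def fun_eq_iff)
qed

lemma conditional_eq_sum_out:
  assumes "i \<in> cells" "A \<union> B \<subseteq> V"
  shows "conditional V L A B p (restrict i A) (restrict i B) =
    sum_out L (V - (A \<union> B)) p i / sum_out L (V - B) p i"
proof -
  have "merge A B (restrict i A, restrict i B) = restrict i (A \<union> B)"
    by (auto simp: merge_def fun_eq_iff)
  then show ?thesis
    using assms by (simp add: conditional_def marginal_eq_sum_out)
qed

lemma sum_out_local: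
  assumes "\<And>a. a \<in> V - R \<Longrightarrow> j a = i a" "i \<in> cells" "j \<in> cells"
  shows "sum_out L R F j = sum_out L R F i"
proof -
  have "j a = i a" if "a \<notin> R" for a
    using assms that by (cases "a \<in> V") (auto simp: PiE_iff extensional_def)
  then have "override_on j r R = override_on i r R" for r
    by (auto simp: override_on_def fun_eq_iff)
  then show ?thesis by (simp add: sum_out_def)
qed

text \<open>The mixed differences of \<open>ln F\<close> in two non-adjacent coordinates vanish.\<close>

definition mixed :: "'v rel \<Rightarrow> 'v set \<Rightarrow> (('v \<Rightarrow> 'l) \<Rightarrow> real) \<Rightarrow> bool" where
  "mixed E U F \<longleftrightarrow> (\<forall>\<gamma>\<in>U. \<forall>\<delta>\<in>U. \<gamma> \<noteq> \<delta> \<and> (\<gamma>, \<delta>) \<notin> E \<longrightarrow>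
    (\<forall>i\<in>cells. \<forall>x\<in>L \<gamma>. \<forall>y\<in>L \<delta>. F i * F (i(\<gamma> := x, \<delta> := y)) = F (i(\<gamma> := x)) * F (i(\<delta> := y))))"

lemma mixed_subset: "mixed E U F \<Longrightarrow> U' \<subseteq> U \<Longrightarrow> mixed E U' F"
  unfolding mixed_def by blast

lemma mixed_cong:
  assumes "mixed E U F" "U \<subseteq> V" "\<And>i. i \<in> cells \<Longrightarrow> F i = G i"
  shows "mixed E U G"
  unfolding mixed_def
proof (intro ballI impI)
  fix \<gamma> \<delta> i x y
  assume "\<gamma> \<in> U" "\<delta> \<in> U" "\<gamma> \<noteq> \<delta> \<and> (\<gamma>, \<delta>) \<notin> E" "i \<in> cells" "x \<in> L \<gamma>" "y \<in> L \<delta>"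
  moreover from this have "i(\<gamma> := x) \<in> cells" "i(\<delta> := y) \<in> cells" "i(\<gamma> := x, \<delta> := y) \<in> cells"
    using assms(2) by (auto intro!: update_cells)
  ultimately show "G i * G (i(\<gamma> := x, \<delta> := y)) = G (i(\<gamma> := x)) * G (i(\<delta> := y))"
    using assms(1,3) unfolding mixed_def by metis
qed

lemma mixedD:
  assumes "mixed E U F" "\<gamma> \<in> U" "\<delta> \<in> U" "\<gamma> \<noteq> \<delta> \<and> (\<gamma>, \<delta>) \<notin> E" "i \<in> cells" "x \<in> L \<gamma>" "y \<in> L \<delta>"
  shows "F i * F (i(\<gamma> := x, \<delta> := y)) = F (i(\<gamma> := x)) * F (i(\<delta> := y))"
  using assms unfolding mixed_def by blast

lemma mixed_mult:
  assumes "mixed E U F" "mixed E U G"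
  shows "mixed E U (\<lambda>i. F i * G i)"
  unfolding mixed_def
proof (intro ballI impI)
  fix \<gamma> \<delta> i x y
  assume a: "\<gamma> \<in> U" "\<delta> \<in> U" "\<gamma> \<noteq> \<delta> \<and> (\<gamma>, \<delta>) \<notin> E" "i \<in> cells" "x \<in> L \<gamma>" "y \<in> L \<delta>"
  show "F i * G i * (F (i(\<gamma> := x, \<delta> := y)) * G (i(\<gamma> := x, \<delta> := y))) =
      F (i(\<gamma> := x)) * G (i(\<gamma> := x)) * (F (i(\<delta> := y)) * G (i(\<delta> := y)))"
    using arg_cong2[OF mixedD[OF assms(1) a] mixedD[OF assms(2) a], of "(*)"] by (simp only: mult_ac)
qed

lemma mixed_divide:
  assumes "mixed E U F" "mixed E U G"
  shows "mixed E U (\<lambda>i. F i / G i)"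
proof -
  have "mixed E U (\<lambda>i. inverse (G i))"
    unfolding mixed_def
  proof (intro ballI impI)
    fix \<gamma> \<delta> i x y
    assume a: "\<gamma> \<in> U" "\<delta> \<in> U" "\<gamma> \<noteq> \<delta> \<and> (\<gamma>, \<delta>) \<notin> E" "i \<in> cells" "x \<in> L \<gamma>" "y \<in> L \<delta>"
    show "inverse (G i) * inverse (G (i(\<gamma> := x, \<delta> := y))) = inverse (G (i(\<gamma> := x))) * inverse (G (i(\<delta> := y)))"
      using arg_cong[OF mixedD[OF assms(2) a], of inverse] by (simp only: inverse_mult_distrib)
  qed
  then show ?thesis using mixed_mult[OF assms(1)] by (simp add: divide_inverse)
qed

lemma mixed_prod: "(\<And>l. l \<in> A \<Longrightarrow> mixed E U (F l)) \<Longrightarrow> mixed E U (\<lambda>i. \<Prod>l\<in>A. F l i)"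
proof (induction A rule: infinite_finite_induct)
  case (insert x A)
  then show ?case using mixed_mult[of E U "F x"] by simp
qed (auto simp: mixed_def)

text \<open>Of two non-adjacent vertices at least one lies outside the complete set
  \<open>D\<close>, and changing that coordinate does not change \<open>F\<close>.\<close>

lemma mixed_local:
  assumes "complete_set E D" "U \<subseteq> V"
    and loc: "\<And>i j. i \<in> cells \<Longrightarrow> j \<in> cells \<Longrightarrow> (\<And>a. a \<in> D \<Longrightarrow> i a = j a) \<Longrightarrow> F i = F j"
  shows "mixed E U F"
  unfolding mixed_def
proof (intro ballI impI)
  fix \<gamma> \<delta> i x y
  assume a: "\<gamma> \<in> U" "\<delta> \<in> U" "\<gamma> \<noteq> \<delta> \<and> (\<gamma>, \<delta>) \<notin> E" "i \<in> cells" "x \<in> L \<gamma>" "y \<in> L \<delta>"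
  then have c: "i(\<gamma> := x) \<in> cells" "i(\<delta> := y) \<in> cells" "i(\<gamma> := x, \<delta> := y) \<in> cells"
    using assms(2) by (auto intro!: update_cells)
  consider "\<gamma> \<notin> D" | "\<delta> \<notin> D" using a assms(1) by (auto simp: complete_set_def)
  then show "F i * F (i(\<gamma> := x, \<delta> := y)) = F (i(\<gamma> := x)) * F (i(\<delta> := y))"
  proof cases
    case 1
    then have "F (i(\<gamma> := x)) = F i" "F (i(\<gamma> := x, \<delta> := y)) = F (i(\<delta> := y))"
      using a c by (auto intro!: loc)
    then show ?thesis by simp
  next
    case 2
    then have "F (i(\<delta> := y)) = F i" "F (i(\<gamma> := x, \<delta> := y)) = F (i(\<gamma> := x))"
      using a c by (auto intro!: loc)
    then show ?thesis by simp
  qed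
qed

text \<open>After clearing the positive denominators, conditional independence reads
  \<open>p i * ?gd i = ?d i * ?g i\<close>. Forwards, it writes \<open>p\<close> as a quotient whose
  two numerators are each free of one coordinate and whose denominator is free of both, so the
  values at the four cells balance. Backwards, the mixed identity is summed over both
  coordinates.\<close>

lemma markov_iff_mixed:
  assumes pos: "\<And>i. i \<in> cells \<Longrightarrow> 0 < p i"
  shows "markov V E L p \<longleftrightarrow> mixed E V p"
proof -
  have pair: "(\<forall>i\<in>cells. let W = V - {\<gamma>, \<delta>} in
        conditional V L {\<gamma>, \<delta>} W p (restrict i {\<gamma>, \<delta>}) (restrict i W) =
        conditional V L {\<gamma>} W p (restrict i {\<gamma>}) (restrict i W) *
        conditional V L {\<delta>} W p (restrict i {\<delta>}) (restrict i W)) \<longleftrightarrow>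
      (\<forall>i\<in>cells. \<forall>x\<in>L \<gamma>. \<forall>y\<in>L \<delta>. p i * p (i(\<gamma> := x, \<delta> := y)) = p (i(\<gamma> := x)) * p (i(\<delta> := y)))"
    (is "?cond \<longleftrightarrow> ?mix")
    if gd: "\<gamma> \<in> V" "\<delta> \<in> V" "\<gamma> \<noteq> \<delta>" for \<gamma> \<delta>
  proof -
    let ?g = "sum_out L {\<gamma>} p" and ?d = "sum_out L {\<delta>} p" and ?gd = "sum_out L {\<gamma>, \<delta>} p"
    have sets: "V - ({\<gamma>, \<delta>} \<union> (V - {\<gamma>, \<delta>})) = {}" "V - ({\<gamma>} \<union> (V - {\<gamma>, \<delta>})) = {\<delta>}"
        "V - ({\<delta>} \<union> (V - {\<gamma>, \<delta>})) = {\<gamma>}" "V - (V - {\<gamma>, \<delta>}) = {\<gamma>, \<delta>}"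
      using gd by auto
    have gdpos: "0 < ?gd i" if "i \<in> cells" for i using that gd by (intro sum_out_pos pos) auto
    have "?cond \<longleftrightarrow> (\<forall>i\<in>cells. p i / ?gd i = ?d i / ?gd i * (?g i / ?gd i))"
      unfolding Let_def using gd
      by (intro ball_cong refl) (subst conditional_eq_sum_out, simp, blast, unfold sets, simp)+
    also have "\<dots> \<longleftrightarrow> (\<forall>i\<in>cells. p i * ?gd i = ?d i * ?g i)"
      using gdpos by (intro ball_cong refl) (simp add: field_simps less_imp_neq[symmetric])
    also have "\<dots> \<longleftrightarrow> ?mix"
    proof (intro iffI ballI)
      fix i x y assume F: "\<forall>i\<in>cells. p i * ?gd i = ?d i * ?g i" and i: "i \<in> cells" and x: "x \<in> L \<gamma>" and y: "y \<in> L \<delta>"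
      let ?i1 = "i(\<gamma> := x)" and ?i2 = "i(\<delta> := y)" and ?i3 = "i(\<gamma> := x, \<delta> := y)"
      have c: "?i1 \<in> cells" "?i2 \<in> cells" "?i3 \<in> cells" using i x y gd by (auto intro!: update_cells)
      have loc: "?g ?i1 = ?g i" "?g ?i3 = ?g ?i2" "?d ?i2 = ?d i" "?d ?i3 = ?d ?i1"
          "?gd ?i1 = ?gd i" "?gd ?i2 = ?gd i" "?gd ?i3 = ?gd i"
        using i c by (auto intro!: sum_out_local split: if_splits)
      have "p j = ?d j * ?g j / ?gd j" if "j \<in> cells" for j
        using F gdpos[OF that] that by (simp add: field_simps)
      from this[OF i] this[OF c(1)] this[OF c(2)] this[OF c(3)]
      show "p i * p ?i3 = p ?i1 * p ?i2" unfolding loc by (simp add: mult_ac)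
    next
      fix i assume F: ?mix and i: "i \<in> cells"
      have "?gd i = (\<Sum>x\<in>L \<gamma>. \<Sum>y\<in>L \<delta>. p (i(\<gamma> := x, \<delta> := y)))"
        using gd sum_out_Un[of "{\<gamma>}" "{\<delta>}" L p i] by (simp add: sum_out_singleton insert_commute)
      then have "p i * ?gd i = (\<Sum>x\<in>L \<gamma>. \<Sum>y\<in>L \<delta>. p (i(\<gamma> := x)) * p (i(\<delta> := y)))"
        using F i by (simp add: sum_distrib_left)
      also have "\<dots> = ?g i * ?d i" by (simp add: sum_out_singleton sum_product)
      finally show "p i * ?gd i = ?d i * ?g i" by simp
    qed
    finally show ?thesis .
  qed
  show ?thesis unfolding markov_def mixed_def
    by (rule ball_cong[OF refl], rule ball_cong[OF refl], rule imp_cong[OF refl], rule pair) auto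
qed

section \<open>From pairs of coordinates to blocks\<close>

definition swap_indep :: "(('v \<Rightarrow> 'l) \<Rightarrow> real) \<Rightarrow> 'v set \<Rightarrow> 'v set \<Rightarrow> bool" where
  "swap_indep F B T \<longleftrightarrow> (\<forall>i\<in>cells. \<forall>j\<in>cells.
    F i * F (override_on i j (B \<union> T)) = F (override_on i j B) * F (override_on i j T))"

lemma swap_indep_sym: "swap_indep F B T \<Longrightarrow> swap_indep F T B"
  by (simp add: swap_indep_def Un_commute mult.commute)

text \<open>For disjoint blocks \<open>swap_indep\<close> is conditional independence given the
  remaining coordinates, expressed without sums. The second relation is used at the cell where
  \<open>B\<close> has already been exchanged; the common factor at that cell is then cancelled,
  which is where positivity enters.\<close>

lemma swap_indep_Un:
  assumes pos: "\<And>i. i \<in> cells \<Longrightarrow> 0 < F i"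
    and 1: "swap_indep F B T" and 2: "swap_indep F B' T"
  shows "swap_indep F (B \<union> B') T"
  unfolding swap_indep_def
proof (intro ballI)
  fix i j assume ij: "i \<in> cells" "j \<in> cells"
  let ?o = "override_on i j"
  have c: "?o B \<in> cells" using override_cells'[OF ij] .
  have o: "override_on (?o B) j X = ?o (B \<union> X)" for X by (auto simp: override_on_def)
  have a: "F i * F (?o (B \<union> T)) = F (?o B) * F (?o T)" using 1 ij by (auto simp: swap_indep_def)
  have b: "F (?o B) * F (?o (B \<union> B' \<union> T)) = F (?o (B \<union> B')) * F (?o (B \<union> T))"
    using 2 c ij(2) unfolding swap_indep_def by (metis o Un_assoc)
  have "F (?o B) * (F i * F (?o (B \<union> B' \<union> T))) = F (?o (B \<union> B')) * (F i * F (?o (B \<union> T)))"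
    using b by (metis mult.left_commute)
  also have "\<dots> = F (?o B) * (F (?o (B \<union> B')) * F (?o T))" unfolding a by (simp add: mult_ac)
  finally show "F i * F (?o (B \<union> B' \<union> T)) = F (?o (B \<union> B')) * F (?o T)"
    using pos[OF c] by simp
qed

lemma swap_indep_empty: "swap_indep F {} T"
  by (simp add: swap_indep_def)

text \<open>The step from pairwise to global independence for positive functions: blocks grow one
  vertex at a time, first \<open>B\<close> against a single vertex of \<open>T\<close>, then, by
  symmetry, \<open>T\<close> against all of \<open>B\<close>.\<close>

lemma mixed_imp_swap_indep:
  assumes pos: "\<And>i. i \<in> cells \<Longrightarrow> 0 < F i" and mix: "mixed E U F" and U: "U \<subseteq> V"
    and B: "B \<subseteq> U" and T: "T \<subseteq> U" and "B \<inter> T = {}"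
    and no_edge: "\<And>b t. b \<in> B \<Longrightarrow> t \<in> T \<Longrightarrow> (b, t) \<notin> E"
  shows "swap_indep F B T"
proof -
  have fin: "finite B" "finite T" using B T U finV by (auto intro: finite_subset)
  have single: "swap_indep F {b} {t}" if "b \<in> B" "t \<in> T" for b t
    unfolding swap_indep_def
  proof (intro ballI)
    fix i j assume ij: "i \<in> cells" "j \<in> cells"
    have "b \<noteq> t" using that assms(6) by auto
    moreover have "j b \<in> L b" "j t \<in> L t" using that B T U ij(2) by (auto simp: PiE_iff)
    ultimately have "F i * F (i(b := j b, t := j t)) = F (i(b := j b)) * F (i(t := j t))"
      using mix that B T no_edge ij(1) unfolding mixed_def by blast
    moreover have "override_on i j ({b} \<union> {t}) = i(b := j b, t := j t)"
      "override_on i j {b} = i(b := j b)" "override_on i j {t} = i(t := j t)"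
      by (auto simp: override_on_def)
    ultimately show "F i * F (override_on i j ({b} \<union> {t})) = F (override_on i j {b}) * F (override_on i j {t})"
      by simp
  qed
  have row: "swap_indep F X {t}" if "finite X" "X \<subseteq> B" "t \<in> T" for X t
    using that
  proof (induction X rule: finite_induct)
    case (insert b X)
    have "swap_indep F ({b} \<union> X) {t}" using insert by (intro swap_indep_Un pos single) auto
    then show ?case by simp
  qed (simp add: swap_indep_empty)
  have "swap_indep F X B" if "finite X" "X \<subseteq> T" for X
    using that
  proof (induction X rule: finite_induct)
    case (insert t X)
    have "swap_indep F ({t} \<union> X) B" using insert row[OF fin(1) order_refl, of t]
      by (intro swap_indep_Un pos) (auto intro: swap_indep_sym)
    then show ?case by simp
  qed (simp add: swap_indep_empty)
  then show ?thesis using fin by (auto intro: swap_indep_sym)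
qed

lemma swap_indep_factorization:
  assumes "swap_indep F B T" "B \<inter> T = {}" "B \<subseteq> V" "T \<subseteq> V" and i: "i \<in> cells"
  shows "F i * sum_out L B (sum_out L T F) i = sum_out L T F i * sum_out L B F i"
proof -
  have "F i * F (override_on (override_on i b B) t T) = F (override_on i b B) * F (override_on i t T)"
    if b: "b \<in> Pi\<^sub>E B L" and t: "t \<in> Pi\<^sub>E T L" for b t
  proof -
    \<comment> \<open>One full cell carrying both replacements, so that \<open>swap_indep\<close>,
      which speaks of pairs of cells, yields the term for \<open>b\<close> and \<open>t\<close>;
      disjointness keeps the two replacements apart.\<close>
    let ?j = "override_on (override_on i b B) t T"
    have "?j \<in> cells" using assms b t by (intro override_cells) auto
    then have "F i * F (override_on i ?j (B \<union> T)) = F (override_on i ?j B) * F (override_on i ?j T)"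
      using assms(1) i unfolding swap_indep_def by blast
    moreover have "override_on i ?j (B \<union> T) = ?j" "override_on i ?j B = override_on i b B"
      "override_on i ?j T = override_on i t T"
      using assms(2) by (auto simp: override_on_def fun_eq_iff)
    ultimately show ?thesis by simp
  qed
  then have "F i * sum_out L B (sum_out L T F) i =
      (\<Sum>b\<in>Pi\<^sub>E B L. \<Sum>t\<in>Pi\<^sub>E T L. F (override_on i b B) * F (override_on i t T))"
    unfolding sum_out_def by (simp add: sum_distrib_left)
  also have "\<dots> = sum_out L B F i * sum_out L T F i" by (simp add: sum_out_def sum_product)
  finally show ?thesis by (simp add: mult.commute)
qed

end

section \<open>Factorization along a perfect order\<close>

lemma complete_set_subset_clique:
  assumes "finite V" "U \<subseteq> V" "complete_set E U"
  obtains C where "C \<in> cliques V E" "U \<subseteq> C"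
proof -
  let ?P = "{D. U \<subseteq> D \<and> D \<subseteq> V \<and> complete_set E D}"
  have "finite ?P" "?P \<noteq> {}" using assms by (auto intro: finite_subset[of _ "Pow V"])
  from finite_has_maximal[OF this] obtain C where C: "C \<in> ?P" "\<forall>D\<in>?P. C \<subseteq> D \<longrightarrow> C = D"
    by blast
  then have "C \<in> cliques V E" unfolding cliques_def by blast
  then show ?thesis using C that by blast
qed

locale clique_model = cell_space V L for V :: "'v set" and L :: "'v \<Rightarrow> 'l set" +
  fixes E :: "'v rel" and Cs :: "'v set list"
    and omit :: "nat \<times> ('v \<Rightarrow> 'l) \<Rightarrow> 'v \<Rightarrow> 'l"
  assumes E_sym: "sym E"
    and perfect: "perfect_clique_order V E Cs"
    and omit: "\<And>l s. (l, s) \<in> cond_groups L Cs \<Longrightarrow> omit (l, s) \<in> Pi\<^sub>E (residual Cs l) L"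
begin

abbreviation "S \<equiv> separator Cs"
abbreviation "R \<equiv> residual Cs"
abbreviation "k \<equiv> length Cs"

text \<open>The union of the first \<open>l\<close> cliques: positions start at 0, so
  \<open>H 0\<close> is empty and the clique at position \<open>l\<close> first appears in
  \<open>H (Suc l)\<close>.\<close>

definition H :: "nat \<Rightarrow> 'v set" where "H l = (\<Union>j<l. Cs ! j)"

lemma clique_nth:
  assumes "l < k"
  shows "Cs ! l \<subseteq> V" "complete_set E (Cs ! l)"
proof -
  have "Cs ! l \<in> cliques V E" using assms perfect by (auto simp: perfect_clique_order_def)
  then show "Cs ! l \<subseteq> V" "complete_set E (Cs ! l)" by (auto simp: cliques_def)
qed

lemma H_subset: "l \<le> k \<Longrightarrow> H l \<subseteq> V"
  unfolding H_def by (intro UN_least clique_nth(1)) auto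

lemma separator_residual:
  shows "S l \<subseteq> H l" "S l \<subseteq> Cs ! l" "R l \<subseteq> Cs ! l" "R l \<inter> H l = {}" "H (Suc l) = H l \<union> R l"
    "Cs ! l = S l \<union> R l" "S l \<inter> R l = {}" "S l \<subseteq> H (Suc l)" "Cs ! l \<subseteq> H (Suc l)"
  by (auto simp: separator_def residual_def H_def lessThan_Suc)

lemma H_mono: "j \<le> l \<Longrightarrow> H j \<subseteq> H l"
  by (force simp: H_def)

lemma clique_exists: "U \<subseteq> V \<Longrightarrow> complete_set E U \<Longrightarrow> \<exists>j<k. U \<subseteq> Cs ! j"
  using complete_set_subset_clique[OF finV] perfect
  by (metis in_set_conv_nth perfect_clique_order_def)

lemma H_k: "H k = V"
proof -
  have "\<exists>j<k. {\<gamma>} \<subseteq> Cs ! j" if "\<gamma> \<in> V" for \<gamma>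
    using that by (intro clique_exists) (auto simp: complete_set_def)
  then have "V \<subseteq> H k" by (auto simp: H_def)
  then show ?thesis using H_subset[of k] by auto
qed

text \<open>An edge lies in some clique; take the first one containing both ends. Before position
  \<open>l\<close> it cannot contain \<open>b\<close>, which is new at \<open>l\<close>; at
  \<open>l\<close> it would put \<open>a\<close> into the separator; after \<open>l\<close> both
  ends lie in its separator, hence in a still earlier clique by perfectness.\<close>

lemma no_edge:
  assumes "l < k" "a \<in> H l - S l" "b \<in> R l"
  shows "(a, b) \<notin> E"
proof
  assume "(a, b) \<in> E"
  have "a \<in> V" "b \<in> V"
    using assms H_subset[of l] clique_nth(1)[of l] separator_residual(3)[of l] by auto
  moreover have "complete_set E {a, b}"
    using \<open>(a, b) \<in> E\<close> E_sym by (auto simp: complete_set_def sym_def)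
  ultimately have "\<exists>j. j < k \<and> {a, b} \<subseteq> Cs ! j" using clique_exists[of "{a, b}"] by auto
  then obtain j where j: "j < k" "{a, b} \<subseteq> Cs ! j"
    and least: "\<And>i. i < j \<Longrightarrow> \<not> (i < k \<and> {a, b} \<subseteq> Cs ! i)"
    using exists_least_iff[of "\<lambda>j. j < k \<and> {a, b} \<subseteq> Cs ! j"] by blast
  consider "j < l" | "j = l" | "l < j" by linarith
  then show False
  proof cases
    case 1
    then have "b \<in> H l" using j by (auto simp: H_def)
    then show False using assms(3) separator_residual(4)[of l] by auto
  next
    case 2
    then show False using j assms by (auto simp: separator_def H_def)
  next
    case 3
    have "{a, b} \<subseteq> H (Suc l)" using assms separator_residual(5)[of l] by auto
    also have "\<dots> \<subseteq> H j" using 3 by (intro H_mono) auto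
    finally have "{a, b} \<subseteq> S j" using j by (auto simp: separator_def H_def)
    moreover obtain i where "i < j" "S j \<subseteq> Cs ! i"
      using perfect j(1) 3 unfolding perfect_clique_order_def by (metis not_less_zero neq0_conv)
    ultimately show False using least[of i] j(1) by auto
  qed
qed

lemma marginal_splits:
  assumes "l < k"
  shows "sum_out L (V - H l) p i = sum_out L (R l) (sum_out L (V - H (Suc l)) p) i"
    and "sum_out L (V - Cs ! l) p i = sum_out L (H l - S l) (sum_out L (V - H (Suc l)) p) i"
    and "sum_out L (V - S l) p i = sum_out L (H l - S l) (sum_out L (R l) (sum_out L (V - H (Suc l)) p)) i"
proof -
  have s: "H l \<subseteq> V" "H (Suc l) \<subseteq> V" using assms by (auto intro!: H_subset)
  have 1: "V - H l = R l \<union> (V - H (Suc l))" "R l \<inter> (V - H (Suc l)) = {}"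
    using separator_residual[of l] s by auto
  show "sum_out L (V - H l) p i = sum_out L (R l) (sum_out L (V - H (Suc l)) p) i"
    unfolding 1(1) using 1(2) by (rule sum_out_Un)
  have 2: "V - Cs ! l = (H l - S l) \<union> (V - H (Suc l))" "(H l - S l) \<inter> (V - H (Suc l)) = {}"
    using separator_residual[of l] s by auto
  show "sum_out L (V - Cs ! l) p i = sum_out L (H l - S l) (sum_out L (V - H (Suc l)) p) i"
    unfolding 2(1) using 2(2) by (rule sum_out_Un)
  have 3: "V - S l = ((H l - S l) \<union> R l) \<union> (V - H (Suc l))" "((H l - S l) \<union> R l) \<inter> (V - H (Suc l)) = {}"
    "(H l - S l) \<inter> R l = {}"
    using separator_residual[of l] s by auto
  show "sum_out L (V - S l) p i = sum_out L (H l - S l) (sum_out L (R l) (sum_out L (V - H (Suc l)) p)) i"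
    unfolding 3(1) sum_out_Un[OF 3(2)] sum_out_Un[OF 3(3)] ..
qed

lemma parts_subset:
  assumes "l < k"
  shows "R l \<subseteq> V" "H l - S l \<subseteq> V" "H l \<subseteq> V" "S l \<subseteq> V" "Cs ! l \<subseteq> V"
  using assms separator_residual[of l] H_subset[of l] clique_nth[of l] by auto

text \<open>No edge joins \<open>R l\<close> to \<open>H l - S l\<close>, so in the marginal on
  \<open>H (Suc l)\<close> these blocks are independent given \<open>S l\<close>. The identity is
  this independence without denominators.\<close>

lemma clique_factor_step:
  assumes l: "l < k" and pos: "\<And>i. i \<in> cells \<Longrightarrow> 0 < p i"
    and mix: "mixed E (H (Suc l)) (sum_out L (V - H (Suc l)) p)" and i: "i \<in> cells"
  shows "sum_out L (V - H (Suc l)) p i * sum_out L (V - S l) p i =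
    sum_out L (V - H l) p i * sum_out L (V - Cs ! l) p i"
proof -
  have "swap_indep (sum_out L (V - H (Suc l)) p) (H l - S l) (R l)"
    using l separator_residual[of l] no_edge[OF l]
    by (intro mixed_imp_swap_indep[OF _ mix] sum_out_pos pos H_subset) auto
  then show ?thesis
    unfolding marginal_splits[OF l] using separator_residual[of l] parts_subset[OF l] i
    by (intro swap_indep_factorization) auto
qed

text \<open>Marginals of Markov distributions generally acquire new dependencies. Here the vertices
  removed last sit in a single clique, so the smaller marginal is the larger one times a quotient of
  functions on complete sets, which cannot create mixed differences.\<close>

lemma marginal_mixed:
  assumes pos: "\<And>i. i \<in> cells \<Longrightarrow> 0 < p i" and "mixed E V p" "l \<le> k"
  shows "mixed E (H l) (sum_out L (V - H l) p)"
  using assms(3)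
proof (induction l rule: inc_induct)
  case base
  have "sum_out L {} p = p" by (rule ext) simp
  then show ?case using assms(2) by (simp add: H_k)
next
  case (step l)
  let ?m = "\<lambda>D. sum_out L (V - D) p"
  have l: "l < k" by fact
  have loc: "mixed E (H l) (?m D)" if "D \<subseteq> Cs ! l" for D
  proof (rule mixed_local[of E D])
    show "complete_set E D" using clique_nth(2)[OF l] that by (auto simp: complete_set_def)
    show "?m D i = ?m D j" if "i \<in> cells" "j \<in> cells" "\<And>a. a \<in> D \<Longrightarrow> i a = j a" for i j
      using that by (intro sum_out_local) auto
  qed (use parts_subset[OF l] in auto)
  have "mixed E (H l) (\<lambda>i. ?m (H (Suc l)) i * ?m (S l) i / ?m (Cs ! l) i)"
    using separator_residual(2,5)[of l]
    by (intro mixed_divide[OF mixed_mult[OF mixed_subset[OF step.IH] loc] loc]) auto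
  then show ?case
  proof (rule mixed_cong)
    fix i assume i: "i \<in> cells"
    have "0 < ?m (Cs ! l) i" using i by (intro sum_out_pos pos) auto
    then show "?m (H (Suc l)) i * ?m (S l) i / ?m (Cs ! l) i = ?m (H l) i"
      using clique_factor_step[OF l pos step.IH i] by simp
  qed (use parts_subset[OF l] in auto)
qed

text \<open>A telescoping product of the ratios between consecutive marginals, from total mass one
  at \<open>H 0 = {}\<close> up to \<open>p\<close> itself at \<open>H k = V\<close>.\<close>

lemma markov_factorization:
  assumes pos: "\<And>i. i \<in> cells \<Longrightarrow> 0 < p i" and "mixed E V p" and one: "(\<Sum>i\<in>cells. p i) = 1"
    and i: "i \<in> cells"
  shows "p i = (\<Prod>l<k. sum_out L (V - Cs ! l) p i / sum_out L (V - S l) p i)"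
proof -
  have "sum_out L (V - H l) p i = (\<Prod>l<l. sum_out L (V - Cs ! l) p i / sum_out L (V - S l) p i)"
    if "l \<le> k" for l
    using that
  proof (induction l)
    case 0
    then show ?case using one sum_cells[OF i, of p] by (simp add: H_def)
  next
    case (Suc l)
    then have l: "l < k" by simp
    have "0 < sum_out L (V - S l) p i" using i by (intro sum_out_pos pos) auto
    moreover note clique_factor_step[OF l pos marginal_mixed[OF pos assms(2)] i]
    ultimately show ?case using Suc l by (simp add: field_simps)
  qed
  from this[of k] show ?thesis by (simp add: H_k)
qed

section \<open>The conditional parametrization and its inverse\<close>

abbreviation "gc \<equiv> group_coords L Cs omit"

definition param_space :: "((nat \<times> ('v \<Rightarrow> 'l)) \<times> ('v \<Rightarrow> 'l) \<Rightarrow> real) set" where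
  "param_space = {x \<in> extensional (cond_coords L Cs omit). \<forall>g\<in>cond_groups L Cs. x \<in> open_simplex (gc g)}"

text \<open>Restores the full probability vector of a group, the omitted cell included, from its
  coordinates.\<close>

definition entry :: "((nat \<times> ('v \<Rightarrow> 'l)) \<times> ('v \<Rightarrow> 'l) \<Rightarrow> real) \<Rightarrow> nat \<times> ('v \<Rightarrow> 'l) \<Rightarrow> ('v \<Rightarrow> 'l) \<Rightarrow> real" where
  "entry x g r = (if r = omit g then 1 - sum x (gc g) else x (g, r))"

definition kernel :: "((nat \<times> ('v \<Rightarrow> 'l)) \<times> ('v \<Rightarrow> 'l) \<Rightarrow> real) \<Rightarrow> nat \<Rightarrow> ('v \<Rightarrow> 'l) \<Rightarrow> real" where
  "kernel x l i = entry x (l, restrict i (S l)) (restrict i (R l))"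

text \<open>The candidate for the inverse of \<open>p_cond\<close>; restricted to the cells because
  members of \<open>markov_model\<close> are extensional.\<close>

definition joint :: "((nat \<times> ('v \<Rightarrow> 'l)) \<times> ('v \<Rightarrow> 'l) \<Rightarrow> real) \<Rightarrow> ('v \<Rightarrow> 'l) \<Rightarrow> real" where
  "joint x = (\<lambda>i\<in>cells. \<Prod>l<k. kernel x l i)"

lemma cond_groups_iff: "(l, s) \<in> cond_groups L Cs \<longleftrightarrow> l < k \<and> s \<in> Pi\<^sub>E (S l) L"
  by (auto simp: cond_groups_def)

lemma finite_residual_cells: "l < k \<Longrightarrow> finite (Pi\<^sub>E (R l) L)"
  using parts_subset by (intro finite_cells)

lemma gc_eq: "gc (l, s) = Pair (l, s) ` (Pi\<^sub>E (R l) L - {omit (l, s)})"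
  by (auto simp: group_coords_def)

lemma finite_gc: "(l, s) \<in> cond_groups L Cs \<Longrightarrow> finite (gc (l, s))"
  using finite_residual_cells by (auto simp: gc_eq cond_groups_iff)

lemma sum_gc: "sum x (gc (l, s)) = (\<Sum>r\<in>Pi\<^sub>E (R l) L - {omit (l, s)}. x ((l, s), r))"
  unfolding gc_eq by (subst sum.reindex) (auto simp: inj_on_def)

lemma prod_gc: "prod x (gc (l, s)) = (\<Prod>r\<in>Pi\<^sub>E (R l) L - {omit (l, s)}. x ((l, s), r))"
  unfolding gc_eq by (subst prod.reindex) (auto simp: inj_on_def)

lemma sum_entry_mult:
  assumes "(l, s) \<in> cond_groups L Cs"
  shows "(\<Sum>r\<in>Pi\<^sub>E (R l) L. entry x (l, s) r * \<phi> r) =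
    (\<Sum>r\<in>Pi\<^sub>E (R l) L - {omit (l, s)}. x ((l, s), r) * \<phi> r) + (1 - sum x (gc (l, s))) * \<phi> (omit (l, s))"
  using assms finite_residual_cells omit[OF assms]
  by (subst sum.remove[of _ "omit (l, s)"]) (auto simp: cond_groups_iff entry_def intro!: sum.cong)

lemma sum_entry:
  assumes "(l, s) \<in> cond_groups L Cs"
  shows "(\<Sum>r\<in>Pi\<^sub>E (R l) L. entry x (l, s) r) = 1"
  using sum_entry_mult[OF assms, of x "\<lambda>_. 1"] by (simp add: sum_gc)

lemma prod_entry:
  assumes "(l, s) \<in> cond_groups L Cs"
  shows "(\<Prod>r\<in>Pi\<^sub>E (R l) L. entry x (l, s) r) = simplex_prod (gc (l, s)) x"
proof -
  have "(\<Prod>r\<in>Pi\<^sub>E (R l) L. entry x (l, s) r) =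
      (1 - sum x (gc (l, s))) * (\<Prod>r\<in>Pi\<^sub>E (R l) L - {omit (l, s)}. entry x (l, s) r)"
    using assms finite_residual_cells omit[OF assms]
    by (subst prod.remove[of _ "omit (l, s)"]) (auto simp: cond_groups_iff entry_def)
  also have "(\<Prod>r\<in>Pi\<^sub>E (R l) L - {omit (l, s)}. entry x (l, s) r) = prod x (gc (l, s))"
    unfolding prod_gc by (intro prod.cong) (auto simp: entry_def)
  finally show ?thesis by (simp add: simplex_prod_def)
qed

lemma entry_pos:
  assumes "x \<in> open_simplex (gc (l, s))" "r \<in> Pi\<^sub>E (R l) L"
  shows "0 < entry x (l, s) r"
  using assms by (auto simp: open_simplex_def entry_def gc_eq)

lemma entry_ge_simplex_prod:
  assumes "(l, s) \<in> cond_groups L Cs" "x \<in> open_simplex (gc (l, s))" "r \<in> Pi\<^sub>E (R l) L"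
  shows "simplex_prod (gc (l, s)) x \<le> entry x (l, s) r"
  using simplex_prod_le_coord[OF finite_gc[OF assms(1)] assms(2), of "((l, s), r)"]
    simplex_prod_le_rest[OF finite_gc[OF assms(1)] assms(2)] assms(3)
  by (auto simp: entry_def gc_eq)

lemma group_of_cell: "i \<in> cells \<Longrightarrow> l < k \<Longrightarrow> (l, restrict i (S l)) \<in> cond_groups L Cs"
  using restrict_cells parts_subset by (auto simp: cond_groups_iff)

lemma param_space_simplex: "x \<in> param_space \<Longrightarrow> g \<in> cond_groups L Cs \<Longrightarrow> x \<in> open_simplex (gc g)"
  by (auto simp: param_space_def)

lemma kernel_pos: "x \<in> param_space \<Longrightarrow> i \<in> cells \<Longrightarrow> l < k \<Longrightarrow> 0 < kernel x l i"
  unfolding kernel_def using restrict_cells parts_subset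
  by (intro entry_pos param_space_simplex group_of_cell) auto

lemma joint_pos: "x \<in> param_space \<Longrightarrow> i \<in> cells \<Longrightarrow> 0 < joint x i"
  using kernel_pos by (auto simp: joint_def intro!: prod_pos)

lemma kernel_local:
  assumes "\<And>a. a \<in> Cs ! l \<Longrightarrow> i a = j a"
  shows "kernel x l i = kernel x l j"
proof -
  have "restrict i (S l) = restrict j (S l)" "restrict i (R l) = restrict j (R l)"
    using assms separator_residual(2,3)[of l] by (auto simp: restrict_def fun_eq_iff)
  then show ?thesis by (simp add: kernel_def)
qed

definition head :: "((nat \<times> ('v \<Rightarrow> 'l)) \<times> ('v \<Rightarrow> 'l) \<Rightarrow> real) \<Rightarrow> nat \<Rightarrow> ('v \<Rightarrow> 'l) \<Rightarrow> real" where
  "head x l i = (\<Prod>j<l. kernel x j i)"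

lemma head_local:
  assumes "\<And>a. a \<in> H l \<Longrightarrow> i a = j a"
  shows "head x l i = head x l j"
  unfolding head_def using assms by (intro prod.cong refl kernel_local) (auto simp: H_def)

lemma head_override: "head x l (override_on i r (R l)) = head x l i"
  using separator_residual(4)[of l] by (intro head_local) (auto simp: override_on_def)

lemma sum_out_kernel_mult:
  assumes "i \<in> cells" "l < k"
  shows "sum_out L (R l) (\<lambda>i. kernel x l i * \<phi> (restrict i (R l))) i =
    (\<Sum>r\<in>Pi\<^sub>E (R l) L. entry x (l, restrict i (S l)) r * \<phi> r)"
  unfolding sum_out_def
proof (intro sum.cong refl)
  fix r assume r: "r \<in> Pi\<^sub>E (R l) L"
  have "restrict (override_on i r (R l)) (R l) = r" "restrict (override_on i r (R l)) (S l) = restrict i (S l)"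
    using r separator_residual(7)[of l] by (auto simp: override_on_def fun_eq_iff PiE_iff extensional_def)
  then show "kernel x l (override_on i r (R l)) * \<phi> (restrict (override_on i r (R l)) (R l)) =
      entry x (l, restrict i (S l)) r * \<phi> r" by (simp add: kernel_def)
qed

lemma sum_out_kernel: "i \<in> cells \<Longrightarrow> l < k \<Longrightarrow> sum_out L (R l) (kernel x l) i = 1"
  using sum_out_kernel_mult[of i l x "\<lambda>_. 1"] sum_entry[OF group_of_cell] by simp

lemma sum_out_head_Suc: "i \<in> cells \<Longrightarrow> l < k \<Longrightarrow> sum_out L (R l) (head x (Suc l)) i = head x l i"
  using sum_out_mult_left[of "R l" L "head x l" i "kernel x l"] head_override[of x l] sum_out_kernel[of i l x]
  by (simp add: head_def[abs_def])

text \<open>Kernels can be summed away from the last clique backwards: the kernel at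
  \<open>l\<close> sums to one over \<open>R l\<close>, and the preceding product does not see
  \<open>R l\<close>. This holds for every \<open>x\<close>, since the omitted entry is defined so
  as to make the sums equal to one.\<close>

lemma sum_out_joint:
  assumes "l \<le> k" "i \<in> cells"
  shows "sum_out L (V - H l) (joint x) i = head x l i"
  using assms
proof (induction l arbitrary: i rule: inc_induct)
  case base
  then show ?case by (simp add: H_k joint_def head_def)
next
  case (step l)
  then have l: "l < k" by simp
  have "sum_out L (V - H l) (joint x) i = sum_out L (R l) (head x (Suc l)) i"
    unfolding marginal_splits(1)[OF l]
    using step.IH step.prems parts_subset[OF l] by (intro sum_out_cong) auto
  then show ?case using sum_out_head_Suc[OF step.prems l] by simp
qed

lemma sum_joint: "(\<Sum>i\<in>cells. joint x i) = 1"
proof -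
  obtain i where i: "i \<in> cells" using cells_nonempty[of V] by auto
  show ?thesis using sum_cells[OF i, of "joint x"] sum_out_joint[of 0 i x] i by (simp add: H_def head_def)
qed

text \<open>The marginal probability of \<open>s\<close> on the separator at position \<open>l\<close>; unlike the marginal of
  the joint distribution it visibly involves earlier groups only.\<close>

definition separator_prob :: "((nat \<times> ('v \<Rightarrow> 'l)) \<times> ('v \<Rightarrow> 'l) \<Rightarrow> real) \<Rightarrow> nat \<Rightarrow> ('v \<Rightarrow> 'l) \<Rightarrow> real" where
  "separator_prob x l s = sum_out L (H l - S l) (head x l) s"

text \<open>Evaluating at a partial cell on the separator is harmless: \<open>head x l\<close> reads
  only coordinates in \<open>H l\<close>, and those outside \<open>S l\<close> are overwritten by
  the summation.\<close>

lemma separator_prob_restrict: "separator_prob x l (restrict i (S l)) = separator_prob x l i"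
  unfolding separator_prob_def sum_out_def
  by (intro sum.cong refl head_local) (auto simp: override_on_def)

lemma sum_out_separator:
  assumes "i \<in> cells" "l < k"
  shows "sum_out L (V - S l) (joint x) i = separator_prob x l (restrict i (S l))"
proof -
  have "sum_out L (V - S l) (joint x) i = sum_out L (H l - S l) (sum_out L (V - H l) (joint x)) i"
    unfolding marginal_splits[OF assms(2)] marginal_splits(1)[OF assms(2), abs_def] ..
  also have "\<dots> = sum_out L (H l - S l) (head x l) i"
    using assms parts_subset sum_out_joint by (intro sum_out_cong) auto
  finally show ?thesis unfolding separator_prob_restrict by (simp add: separator_prob_def)
qed

lemma sum_out_clique:
  assumes "i \<in> cells" "l < k"
  shows "sum_out L (V - Cs ! l) (joint x) i = separator_prob x l (restrict i (S l)) * kernel x l i"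
proof -
  have "sum_out L (V - Cs ! l) (joint x) i = sum_out L (H l - S l) (head x (Suc l)) i"
    unfolding marginal_splits[OF assms(2)]
    using assms parts_subset sum_out_joint by (intro sum_out_cong) auto
  also have "\<dots> = sum_out L (H l - S l) (\<lambda>i. kernel x l i * head x l i) i"
    by (simp add: head_def[abs_def] mult.commute)
  also have "\<dots> = kernel x l i * sum_out L (H l - S l) (head x l) i"
  proof (rule sum_out_mult_left)
    fix r
    show "kernel x l (override_on i r (H l - S l)) = kernel x l i"
      using separator_residual[of l] by (intro kernel_local) (auto simp: override_on_def)
  qed
  finally show ?thesis unfolding separator_prob_restrict by (simp add: separator_prob_def mult.commute)
qed

lemma separator_prob_pos:
  assumes "x \<in> param_space" "i \<in> cells" "l < k"
  shows "0 < separator_prob x l (restrict i (S l))"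
  unfolding sum_out_separator[OF assms(2,3), symmetric]
  using assms joint_pos by (intro sum_out_pos) auto

lemma joint_conditional:
  assumes "x \<in> param_space" "i \<in> cells" "l < k"
  shows "conditional V L (R l) (S l) (joint x) (restrict i (R l)) (restrict i (S l)) = kernel x l i"
proof -
  have "R l \<union> S l = Cs ! l" using separator_residual(6)[of l] by auto
  then show ?thesis
    using assms clique_nth(1)[OF assms(3)] separator_prob_pos[OF assms]
    by (simp add: conditional_eq_sum_out sum_out_clique sum_out_separator)
qed

text \<open>Each kernel depends on the coordinates of one clique, a complete set, so the product has
  no mixed differences for non-adjacent pairs.\<close>

lemma joint_mem: "x \<in> param_space \<Longrightarrow> joint x \<in> markov_model V E L"
proof -
  assume x: "x \<in> param_space"
  have "mixed E V (kernel x l)" if "l < k" for l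
    by (rule mixed_local[OF clique_nth(2)[OF that] order_refl]) (rule kernel_local)
  then have "mixed E V (\<lambda>i. \<Prod>l<k. kernel x l i)" by (intro mixed_prod) auto
  then have "mixed E V (joint x)" by (rule mixed_cong) (auto simp: joint_def)
  then have "markov V E L (joint x)" using joint_pos[OF x] by (simp add: markov_iff_mixed)
  then show ?thesis
    using joint_pos[OF x] sum_joint by (auto simp: markov_model_def joint_def)
qed

lemma group_cell:
  assumes "(l, s) \<in> cond_groups L Cs" "r \<in> Pi\<^sub>E (R l) L"
  obtains i where "i \<in> cells" "restrict i (S l) = s" "restrict i (R l) = r"
proof -
  have l: "l < k" and s: "s \<in> Pi\<^sub>E (S l) L" using assms by (auto simp: cond_groups_iff)
  obtain j where j: "j \<in> cells" "restrict j (S l) = s"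
    using extend_cell[OF _ s] parts_subset[OF l] by auto
  have "override_on j r (R l) \<in> cells" using override_cells j assms(2) parts_subset[OF l] by blast
  moreover have "restrict (override_on j r (R l)) (S l) = s"
    unfolding j(2)[symmetric] using separator_residual(7)[of l] by (auto simp: override_on_def fun_eq_iff)
  moreover have "restrict (override_on j r (R l)) (R l) = r"
    using assms(2) by (auto simp: override_on_def fun_eq_iff PiE_iff extensional_def)
  ultimately show ?thesis using that by blast
qed

lemma p_cond_joint:
  assumes "x \<in> param_space"
  shows "p_cond V L Cs omit (joint x) = x"
proof
  fix a :: "(nat \<times> ('v \<Rightarrow> 'l)) \<times> ('v \<Rightarrow> 'l)"
  obtain l s r where a: "a = ((l, s), r)" by (metis prod.exhaust)
  show "p_cond V L Cs omit (joint x) a = x a"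
  proof (cases "a \<in> cond_coords L Cs omit")
    case True
    then have g: "(l, s) \<in> cond_groups L Cs" and r: "r \<in> Pi\<^sub>E (R l) L" "r \<noteq> omit (l, s)"
      unfolding a by (auto simp: cond_coords_def group_coords_def)
    obtain i where i: "i \<in> cells" "restrict i (S l) = s" "restrict i (R l) = r"
      using group_cell[OF g r(1)] .
    have "l < k" using g by (simp add: cond_groups_iff)
    from joint_conditional[OF assms i(1) this] have "conditional V L (R l) (S l) (joint x) r s = x a"
      using r i by (simp add: kernel_def entry_def a)
    then show ?thesis using True by (simp add: p_cond_def a)
  next
    case False
    have "x \<in> extensional (cond_coords L Cs omit)" using assms by (simp add: param_space_def)
    from extensional_arb[OF this False] show ?thesis using False by (simp add: p_cond_def)
  qed
qed

text \<open>The coordinates agree by definition of \<open>p_cond\<close>; the omitted entry agrees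
  because conditional probabilities given \<open>s\<close> sum to one over the residual.\<close>

lemma p_cond_entry:
  assumes p: "p \<in> markov_model V E L" and g: "(l, s) \<in> cond_groups L Cs"
  shows "r \<in> Pi\<^sub>E (R l) L \<Longrightarrow> 0 < conditional V L (R l) (S l) p r s"
    and "r \<in> Pi\<^sub>E (R l) L \<Longrightarrow> entry (p_cond V L Cs omit p) (l, s) r = conditional V L (R l) (S l) p r s"
proof -
  let ?c = "\<lambda>r. conditional V L (R l) (S l) p r s" and ?x = "p_cond V L Cs omit p"
  have pos: "0 < p i" if "i \<in> cells" for i using p that by (auto simp: markov_model_def)
  have l: "l < k" using g by (simp add: cond_groups_iff)
  have RS: "R l \<union> S l = Cs ! l" using separator_residual(6)[of l] by auto
  have eq: "?c (restrict i (R l)) = sum_out L (V - Cs ! l) p i / sum_out L (V - S l) p i"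
    if "i \<in> cells" "restrict i (S l) = s" for i
    using conditional_eq_sum_out[OF that(1), of "R l" "S l" p] that(2) parts_subset(5)[OF l] by (simp add: RS)
  have cpos: "0 < ?c r" if r: "r \<in> Pi\<^sub>E (R l) L" for r
  proof -
    obtain i where i: "i \<in> cells" "restrict i (S l) = s" "restrict i (R l) = r" using group_cell[OF g r] .
    have "0 < sum_out L (V - Cs ! l) p i / sum_out L (V - S l) p i"
      using i by (intro divide_pos_pos sum_out_pos pos) auto
    then show ?thesis using eq[OF i(1,2)] i(3) by simp
  qed
  then show "r \<in> Pi\<^sub>E (R l) L \<Longrightarrow> 0 < ?c r" .
  have one: "(\<Sum>r\<in>Pi\<^sub>E (R l) L. ?c r) = 1"
  proof -
    obtain i where i: "i \<in> cells" "restrict i (S l) = s" using group_cell[OF g omit[OF g]] .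
    have "?c r = sum_out L (V - Cs ! l) p (override_on i r (R l)) / sum_out L (V - S l) p i"
      if r: "r \<in> Pi\<^sub>E (R l) L" for r
    proof -
      let ?i = "override_on i r (R l)"
      have c: "?i \<in> cells" using override_cells i(1) r parts_subset[OF l] by blast
      have "restrict ?i (S l) = s"
        unfolding i(2)[symmetric] using separator_residual(7)[of l] by (auto simp: override_on_def fun_eq_iff)
      moreover have "restrict ?i (R l) = r"
        using r by (auto simp: override_on_def fun_eq_iff PiE_iff extensional_def)
      moreover have "sum_out L (V - S l) p ?i = sum_out L (V - S l) p i"
        using separator_residual(7)[of l] c i(1) by (intro sum_out_local) (auto simp: override_on_def)
      ultimately show ?thesis using eq[OF c] by simp
    qed
    then have "(\<Sum>r\<in>Pi\<^sub>E (R l) L. ?c r) = sum_out L (R l) (sum_out L (V - Cs ! l) p) i / sum_out L (V - S l) p i"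
      by (simp add: sum_out_def[of L "R l"] sum_divide_distrib)
    also have "sum_out L (R l) (sum_out L (V - Cs ! l) p) i = sum_out L (R l \<union> (V - Cs ! l)) p i"
      using separator_residual(3)[of l] by (intro sum_out_Un[symmetric]) auto
    also have "R l \<union> (V - Cs ! l) = V - S l" using separator_residual[of l] parts_subset[OF l] by auto
    moreover have "0 < sum_out L (V - S l) p i" by (intro sum_out_pos pos i(1)) auto
    ultimately show ?thesis by simp
  qed
  have x: "?x ((l, s), r) = ?c r" if "r \<in> Pi\<^sub>E (R l) L" "r \<noteq> omit (l, s)" for r
    using that g by (force simp: p_cond_def cond_coords_def group_coords_def)
  have "sum ?x (gc (l, s)) = (\<Sum>r\<in>Pi\<^sub>E (R l) L - {omit (l, s)}. ?c r)"
    unfolding sum_gc using x by (intro sum.cong) auto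
  also have "\<dots> = 1 - ?c (omit (l, s))"
    using one omit[OF g] finite_residual_cells[OF l] by (simp add: sum_diff1)
  finally show "r \<in> Pi\<^sub>E (R l) L \<Longrightarrow> entry ?x (l, s) r = ?c r"
    using x by (auto simp: entry_def)
qed

lemma p_cond_mem:
  assumes p: "p \<in> markov_model V E L"
  shows "p_cond V L Cs omit p \<in> param_space"
proof -
  let ?x = "p_cond V L Cs omit p"
  have "?x \<in> open_simplex (gc (l, s))" if g: "(l, s) \<in> cond_groups L Cs" for l s
  proof -
    have pos: "0 < entry ?x (l, s) r" if "r \<in> Pi\<^sub>E (R l) L" for r
      using p_cond_entry[OF p g that] by simp
    have "0 < ?x a" if a: "a \<in> gc (l, s)" for a
    proof -
      obtain r where "a = ((l, s), r)" "r \<in> Pi\<^sub>E (R l) L" "r \<noteq> omit (l, s)"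
        using a by (auto simp: gc_eq)
      then show ?thesis using pos[of r] by (simp add: entry_def)
    qed
    moreover have "sum ?x (gc (l, s)) < 1" using pos[OF omit[OF g]] by (simp add: entry_def)
    ultimately show ?thesis by (simp add: open_simplex_def)
  qed
  moreover have "?x \<in> extensional (cond_coords L Cs omit)" by (simp add: p_cond_def)
  ultimately show ?thesis by (auto simp: param_space_def)
qed

lemma joint_p_cond:
  assumes p: "p \<in> markov_model V E L"
  shows "joint (p_cond V L Cs omit p) = p"
proof
  fix i
  have pos: "0 < p i" if "i \<in> cells" for i using p that by (auto simp: markov_model_def)
  show "joint (p_cond V L Cs omit p) i = p i"
  proof (cases "i \<in> cells")
    case True
    have "mixed E V p" and one: "(\<Sum>i\<in>cells. p i) = 1"
      using p pos by (auto simp: markov_model_def markov_iff_mixed)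
    then have "p i = (\<Prod>l<k. sum_out L (V - Cs ! l) p i / sum_out L (V - S l) p i)"
      using markov_factorization[OF pos _ one True] by simp
    also have "\<dots> = (\<Prod>l<k. kernel (p_cond V L Cs omit p) l i)"
    proof (intro prod.cong refl)
      fix l assume "l \<in> {..<k}"
      then have l: "l < k" by simp
      have "R l \<union> S l = Cs ! l" using separator_residual(6)[of l] by auto
      then have "sum_out L (V - Cs ! l) p i / sum_out L (V - S l) p i =
          conditional V L (R l) (S l) p (restrict i (R l)) (restrict i (S l))"
        using conditional_eq_sum_out[OF True, of "R l" "S l" p] parts_subset(5)[OF l] by simp
      then show "sum_out L (V - Cs ! l) p i / sum_out L (V - S l) p i = kernel (p_cond V L Cs omit p) l i"
        using p_cond_entry(2)[OF p group_of_cell[OF True l]] restrict_cells[OF True] parts_subset[OF l]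
        by (simp add: kernel_def)
    qed
    finally show ?thesis using True by (simp add: joint_def)
  next
    case False
    then show ?thesis using p by (auto simp: joint_def markov_model_def PiE_iff extensional_def)
  qed
qed

text \<open>Variation independence of the groups. One inclusion says that conditional probabilities
  lie in the open simplices, the other that each choice of points in them is realized by its
  \<open>joint\<close>.\<close>

lemma cond_space_eq: "cond_space V E L Cs omit = param_space"
proof
  show "cond_space V E L Cs omit \<subseteq> param_space" using p_cond_mem by (auto simp: cond_space_def)
  show "param_space \<subseteq> cond_space V E L Cs omit"
  proof
    fix x assume "x \<in> param_space"
    from p_cond_joint[OF this] joint_mem[OF this] show "x \<in> cond_space V E L Cs omit"
      unfolding cond_space_def by (metis imageI)
  qed
qed

lemma cell_prob_eq:
  assumes "x \<in> param_space"
  shows "cell_prob V E L Cs omit x = joint x"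
  unfolding cell_prob_def
proof (rule the_inv_into_f_eq)
  show "inj_on (p_cond V L Cs omit) (markov_model V E L)"
    by (rule inj_on_inverseI[of _ joint]) (rule joint_p_cond)
  show "p_cond V L Cs omit (joint x) = x" by (rule p_cond_joint[OF assms])
  show "joint x \<in> markov_model V E L" by (rule joint_mem[OF assms])
qed

end

section \<open>Scores of the conditional parametrization\<close>

context clique_model
begin

lemma group_coords_disjoint: "g \<noteq> h \<Longrightarrow> gc g \<inter> gc h = {}"
  by (auto simp: group_coords_def)

lemma gc_subset: "g \<in> cond_groups L Cs \<Longrightarrow> gc g \<subseteq> cond_coords L Cs omit"
  by (auto simp: cond_coords_def)

lemma entry_cong:
  assumes "\<And>a. a \<in> gc (l, s) \<Longrightarrow> x a = y a" "r \<in> Pi\<^sub>E (R l) L"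
  shows "entry x (l, s) r = entry y (l, s) r"
proof (cases "r = omit (l, s)")
  case True
  have "sum x (gc (l, s)) = sum y (gc (l, s))" using assms(1) by (rule sum.cong[OF refl])
  then show ?thesis using True by (simp add: entry_def)
next
  case False
  then have "((l, s), r) \<in> gc (l, s)" using assms(2) by (auto simp: gc_eq)
  then show ?thesis using assms(1) False by (simp add: entry_def)
qed

text \<open>Off the parameter space the values of \<open>cell_prob\<close> are unspecified, so a
  partial derivative can be computed only if a whole interval around \<open>x a\<close> stays
  inside. A coordinate may vary up to the mass left over by the others of its group.\<close>

lemma eventually_update_param_space:
  assumes x: "x \<in> param_space" and g: "g \<in> cond_groups L Cs" and a: "a \<in> gc g"
  shows "\<forall>\<^sub>F t in nhds (x a). x(a := t) \<in> param_space"
proof -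
  obtain l s where ls: "g = (l, s)" by (cases g)
  have fin: "finite (gc g)" using finite_gc g ls by blast
  have xs: "x \<in> open_simplex (gc g)" by (rule param_space_simplex[OF x g])
  then have "x a \<in> {0<..<1 - sum x (gc g - {a})}"
    using fin a by (auto simp: open_simplex_def sum.remove[of "gc g" a])
  then have "\<forall>\<^sub>F t in nhds (x a). t \<in> {0<..<1 - sum x (gc g - {a})}"
    by (intro eventually_nhds_in_open) auto
  then show ?thesis
  proof eventually_elim
    case (elim t)
    have "x(a := t) \<in> open_simplex (gc h)" if h: "h \<in> cond_groups L Cs" for h
    proof (cases "h = g")
      case True
      have "sum (x(a := t)) (gc g) = t + sum x (gc g - {a})"
        using fin a by (subst sum.remove[of _ a]) (auto intro!: sum.cong)
      then show ?thesis using True elim xs by (auto simp: open_simplex_def)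
    next
      case False
      then have "b \<noteq> a" if "b \<in> gc h" for b using group_coords_disjoint[of h g] a that by auto
      then have "x(a := t) \<in> open_simplex (gc h) \<longleftrightarrow> x \<in> open_simplex (gc h)"
        by (intro open_simplex_cong) auto
      then show ?thesis using param_space_simplex[OF x h] by simp
    qed
    moreover have "a \<in> cond_coords L Cs omit" using gc_subset g a by blast
    then have "x(a := t) \<in> extensional (cond_coords L Cs omit)"
      using x by (auto simp: param_space_def extensional_def)
    ultimately show ?case by (simp add: param_space_def)
  qed
qed

text \<open>The derivative of the entry at \<open>r\<close> in the coordinate \<open>a\<close>; the
  value -1 arises because the omitted entry is one minus the sum of the others.\<close>

definition entry_slope :: "(nat \<times> ('v \<Rightarrow> 'l)) \<times> ('v \<Rightarrow> 'l) \<Rightarrow> ('v \<Rightarrow> 'l) \<Rightarrow> real" where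
  "entry_slope a r = (if r = snd a then 1 else if r = omit (fst a) then -1 else 0)"

text \<open>The derivative of the log cell probability in the coordinate \<open>a\<close>: only the
  kernel at the position of the group depends on \<open>a\<close>, and only at cells whose separator
  value is that of the group.\<close>

definition score :: "((nat \<times> ('v \<Rightarrow> 'l)) \<times> ('v \<Rightarrow> 'l) \<Rightarrow> real) \<Rightarrow> (nat \<times> ('v \<Rightarrow> 'l)) \<times> ('v \<Rightarrow> 'l) \<Rightarrow>
    ('v \<Rightarrow> 'l) \<Rightarrow> real" where
  "score x a i = (if restrict i (S (fst (fst a))) = snd (fst a)
     then entry_slope a (restrict i (R (fst (fst a)))) / kernel x (fst (fst a)) i else 0)"

lemma entry_derivative:
  assumes g: "(l, s) \<in> cond_groups L Cs" and a: "a \<in> gc (l, s)"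
  shows "((\<lambda>t. entry (x(a := t)) (l', s') r) has_real_derivative
    (if (l', s') = (l, s) then entry_slope a r else 0)) (at (x a))"
proof -
  obtain r0 where r0: "a = ((l, s), r0)" "r0 \<in> Pi\<^sub>E (R l) L" "r0 \<noteq> omit (l, s)"
    using a by (auto simp: gc_eq)
  show ?thesis
  proof (cases "(l', s') = (l, s)")
    case False
    have "a \<notin> gc (l', s')" using r0 False by (auto simp: gc_eq)
    then have "sum (x(a := t)) (gc (l', s')) = sum x (gc (l', s'))" for t
      by (intro sum.cong) auto
    moreover have "((l', s'), r) \<noteq> a" using False r0 by auto
    ultimately have "(\<lambda>t. entry (x(a := t)) (l', s') r) = (\<lambda>t. entry x (l', s') r)"
      by (auto simp: entry_def fun_eq_iff)
    then show ?thesis using False by auto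
  next
    case True
    have "sum (x(a := t)) (gc (l, s)) = t + sum x (gc (l, s) - {a})" for t
      using finite_gc[OF g] a by (subst sum.remove[of _ a]) (auto intro!: sum.cong)
    then have "(\<lambda>t. entry (x(a := t)) (l, s) r) =
        (\<lambda>t. if r = omit (l, s) then 1 - (t + sum x (gc (l, s) - {a})) else if r = r0 then t else x ((l, s), r))"
      using r0 by (auto simp: entry_def fun_eq_iff)
    moreover have "((\<lambda>t. if r = omit (l, s) then 1 - (t + sum x (gc (l, s) - {a})) else if r = r0 then t else x ((l, s), r))
        has_real_derivative entry_slope a r) (at (x a))"
      using r0 by (auto simp: entry_slope_def intro!: derivative_eq_intros)
    ultimately show ?thesis using True by simp
  qed
qed

lemma ln_joint_derivative:
  assumes x: "x \<in> param_space" and g: "(l, s) \<in> cond_groups L Cs" and a: "a \<in> gc (l, s)" and i: "i \<in> cells"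
  shows "((\<lambda>t. ln (joint (x(a := t)) i)) has_real_derivative score x a i) (at (x a))"
proof -
  have fa: "fst a = (l, s)" using a by (auto simp: gc_eq)
  have l: "l < k" using g by (simp add: cond_groups_iff)
  have d: "((\<lambda>t. ln (kernel (x(a := t)) l' i)) has_real_derivative
      (if l' = l then score x a i else 0)) (at (x a))" if l': "l' < k" for l'
  proof -
    have pos: "0 < kernel (x(a := x a)) l' i" using kernel_pos[OF x i l'] by simp
    have "((\<lambda>t. kernel (x(a := t)) l' i) has_real_derivative
        (if (l', restrict i (S l')) = (l, s) then entry_slope a (restrict i (R l')) else 0)) (at (x a))"
      unfolding kernel_def by (rule entry_derivative[OF g a])
    from DERIV_chain2[OF DERIV_ln_divide[OF pos] this] show ?thesis
      by (rule DERIV_cong) (auto simp: score_def fa)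
  qed
  have "((\<lambda>t. \<Sum>l'<k. ln (kernel (x(a := t)) l' i)) has_real_derivative
      (\<Sum>l'<k. if l' = l then score x a i else 0)) (at (x a))"
    using d by (intro DERIV_sum) auto
  then have "((\<lambda>t. \<Sum>l'<k. ln (kernel (x(a := t)) l' i)) has_real_derivative score x a i) (at (x a))"
    using l by simp
  moreover have "\<forall>\<^sub>F t in nhds (x a). ln (joint (x(a := t)) i) = (\<Sum>l'<k. ln (kernel (x(a := t)) l' i))"
    using eventually_update_param_space[OF x g a]
  proof eventually_elim
    case (elim t)
    have "ln (\<Prod>l'<k. kernel (x(a := t)) l' i) = (\<Sum>l'<k. ln (kernel (x(a := t)) l' i))"
      using kernel_pos[OF elim i] by (intro ln_prod) (auto simp: less_imp_neq[symmetric])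
    then show ?case using i by (simp add: joint_def)
  qed
  ultimately show ?thesis by (rule DERIV_cong_ev[THEN iffD2, OF refl _ refl, rotated])
qed

section \<open>Covariances of the scores\<close>

lemma expectation_local:
  assumes l: "l < k" and i: "i \<in> cells"
    and loc: "\<And>i j. (\<And>a. a \<in> H (Suc l) \<Longrightarrow> i a = j a) \<Longrightarrow> G i = G j"
  shows "(\<Sum>i\<in>cells. joint x i * G i) =
    sum_out L (H l) (sum_out L (R l) (\<lambda>i. head x (Suc l) i * G i)) i"
proof -
  let ?W = "V - H (Suc l)"
  have HV: "H (Suc l) \<subseteq> V" using l by (intro H_subset) simp
  have "(\<Sum>i\<in>cells. joint x i * G i) = sum_out L (H (Suc l) \<union> ?W) (\<lambda>i. joint x i * G i) i"
    using HV sum_cells[OF i] by (simp add: Un_absorb1)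
  also have "\<dots> = sum_out L (H (Suc l)) (sum_out L ?W (\<lambda>i. joint x i * G i)) i"
    by (rule sum_out_Un) auto
  also have "\<dots> = sum_out L (H (Suc l)) (\<lambda>i. head x (Suc l) i * G i) i"
  proof (rule sum_out_cong[OF _ i HV])
    fix j assume j: "j \<in> cells"
    have "sum_out L ?W (\<lambda>i. G i * joint x i) j = G j * sum_out L ?W (joint x) j"
      by (rule sum_out_mult_left, rule loc) (auto simp: override_on_def)
    then show "sum_out L ?W (\<lambda>i. joint x i * G i) j = head x (Suc l) j * G j"
      using sum_out_joint[OF _ j, of "Suc l"] l by (simp add: mult.commute)
  qed
  also have "\<dots> = sum_out L (H l) (sum_out L (R l) (\<lambda>i. head x (Suc l) i * G i)) i"
    unfolding separator_residual(5) using separator_residual(4)[of l] by (intro sum_out_Un) auto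
  finally show ?thesis .
qed

lemma score_local:
  assumes "fst (fst a) = l" "\<And>v. v \<in> Cs ! l \<Longrightarrow> i v = j v"
  shows "score x a i = score x a j"
proof -
  have "restrict i (S l) = restrict j (S l)" "restrict i (R l) = restrict j (R l)"
    using assms(2) separator_residual(2,3)[of l] by (auto simp: restrict_def fun_eq_iff)
  moreover have "kernel x l i = kernel x l j" by (rule kernel_local) (rule assms(2))
  ultimately show ?thesis using assms(1) by (simp add: score_def)
qed

lemma sum_entry_slope:
  assumes g: "(l, s) \<in> cond_groups L Cs" and a: "a \<in> gc (l, s)"
  shows "(\<Sum>r\<in>Pi\<^sub>E (R l) L. entry_slope a r) = 0"
proof -
  obtain r0 where r0: "a = ((l, s), r0)" "r0 \<in> Pi\<^sub>E (R l) L" "r0 \<noteq> omit (l, s)"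
    using a by (auto simp: gc_eq)
  have "entry_slope a r = (if r = r0 then 1 else 0) - (if r = omit (l, s) then 1 else 0)" for r
    using r0 by (auto simp: entry_slope_def)
  then show ?thesis
    using r0 omit[OF g] g finite_residual_cells by (simp add: sum_subtractf cond_groups_iff)
qed

lemma sum_entry_slope_product:
  assumes g: "(l, s) \<in> cond_groups L Cs" and a: "a \<in> gc (l, s)" and b: "b \<in> gc (l, s)"
  shows "(\<Sum>r\<in>Pi\<^sub>E (R l) L. entry_slope a r * entry_slope b r / entry x (l, s) r) =
    (if a = b then 1 / x a else 0) + 1 / (1 - sum x (gc (l, s)))"
proof -
  obtain r0 where r0: "a = ((l, s), r0)" "r0 \<in> Pi\<^sub>E (R l) L" "r0 \<noteq> omit (l, s)"
    using a by (auto simp: gc_eq)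
  obtain r1 where r1: "b = ((l, s), r1)" "r1 \<in> Pi\<^sub>E (R l) L" "r1 \<noteq> omit (l, s)"
    using b by (auto simp: gc_eq)
  have "entry_slope a r * entry_slope b r / entry x (l, s) r =
      (if r = r0 then (if a = b then 1 / x a else 0) else 0) +
      (if r = omit (l, s) then 1 / (1 - sum x (gc (l, s))) else 0)" for r
    using r0 r1 by (auto simp: entry_slope_def entry_def)
  then show ?thesis
    using r0 omit[OF g] g finite_residual_cells by (simp add: sum.distrib cond_groups_iff)
qed

lemma restrict_override_R:
  assumes "r \<in> Pi\<^sub>E (R l) L"
  shows "restrict (override_on i r (R l)) (R l) = r"
    and "restrict (override_on i r (R l)) (S l) = restrict i (S l)"
  using assms separator_residual(7)[of l] by (auto simp: override_on_def fun_eq_iff PiE_iff extensional_def)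

text \<open>The kernel in the density cancels the denominator of the score, and the slopes sum to
  zero over \<open>R l\<close>. So a score has conditional mean zero given the coordinates in
  \<open>H l\<close>, and multiplying by a function of these keeps the mean zero.\<close>

lemma expectation_mult_score:
  assumes x: "x \<in> param_space" and g: "(l, s) \<in> cond_groups L Cs" and a: "a \<in> gc (l, s)"
    and loc: "\<And>i j. (\<And>v. v \<in> H l \<Longrightarrow> i v = j v) \<Longrightarrow> F i = F j"
  shows "(\<Sum>i\<in>cells. joint x i * (F i * score x a i)) = 0"
proof -
  have l: "l < k" using g by (simp add: cond_groups_iff)
  have fa: "fst a = (l, s)" using a by (auto simp: gc_eq)
  obtain i where i: "i \<in> cells" using cells_nonempty[of V] by auto
  have locG: "F i * score x a i = F j * score x a j" if "\<And>v. v \<in> H (Suc l) \<Longrightarrow> i v = j v" for i j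
  proof -
    have "F i = F j" using that H_mono[of l "Suc l"] by (intro loc) auto
    moreover have "score x a i = score x a j"
      using that separator_residual(9)[of l] by (intro score_local[of a l]) (auto simp: fa)
    ultimately show ?thesis by simp
  qed
  have "(\<Sum>i\<in>cells. joint x i * (F i * score x a i)) =
      sum_out L (H l) (sum_out L (R l) (\<lambda>i. head x (Suc l) i * (F i * score x a i))) i"
    by (rule expectation_local[OF l i locG])
  also have "\<dots> = sum_out L (H l) (\<lambda>_. 0) i"
  proof (rule sum_out_cong[OF _ i])
    fix j assume j: "j \<in> cells"
    have "head x (Suc l) (override_on j r (R l)) * (F (override_on j r (R l)) * score x a (override_on j r (R l))) =
        head x l j * F j * (if restrict j (S l) = s then 1 else 0) * entry_slope a r"
      if r: "r \<in> Pi\<^sub>E (R l) L" for r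
    proof -
      let ?j = "override_on j r (R l)"
      have c: "?j \<in> cells" using override_cells j r parts_subset[OF l] by blast
      have "F ?j = F j" using separator_residual(4)[of l] by (intro loc) (auto simp: override_on_def)
      then show ?thesis
        using kernel_pos[OF x c l] head_override[of x l j r] restrict_override_R[OF r, of j]
        by (simp add: head_def score_def fa)
    qed
    then have "sum_out L (R l) (\<lambda>i. head x (Suc l) i * (F i * score x a i)) j =
        head x l j * F j * (if restrict j (S l) = s then 1 else 0) * (\<Sum>r\<in>Pi\<^sub>E (R l) L. entry_slope a r)"
      unfolding sum_out_def sum_distrib_left by (rule sum.cong[OF refl])
    then show "sum_out L (R l) (\<lambda>i. head x (Suc l) i * (F i * score x a i)) j = 0"
      using sum_entry_slope[OF g a] by simp
  qed (use parts_subset[OF l] in auto)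
  finally show ?thesis by (simp add: sum_out_def)
qed

lemma expectation_score:
  "x \<in> param_space \<Longrightarrow> (l, s) \<in> cond_groups L Cs \<Longrightarrow> a \<in> gc (l, s) \<Longrightarrow> (\<Sum>i\<in>cells. joint x i * score x a i) = 0"
  using expectation_mult_score[of x l s a "\<lambda>_. 1"] by simp

lemma expectation_score_same_group:
  assumes x: "x \<in> param_space" and g: "(l, s) \<in> cond_groups L Cs" and a: "a \<in> gc (l, s)" and b: "b \<in> gc (l, s)"
  shows "(\<Sum>i\<in>cells. joint x i * (score x a i * score x b i)) =
    separator_prob x l s * ((if a = b then 1 / x a else 0) + 1 / (1 - sum x (gc (l, s))))"
proof -
  let ?c = "(if a = b then 1 / x a else 0) + 1 / (1 - sum x (gc (l, s)))"
  have l: "l < k" and s: "s \<in> Pi\<^sub>E (S l) L" using g by (auto simp: cond_groups_iff)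
  have fa: "fst a = (l, s)" "fst b = (l, s)" using a b by (auto simp: gc_eq)
  obtain i where i: "i \<in> cells" using cells_nonempty[of V] by auto
  have locG: "score x a i * score x b i = score x a j * score x b j"
    if "\<And>v. v \<in> H (Suc l) \<Longrightarrow> i v = j v" for i j
    using that separator_residual(9)[of l] by (intro arg_cong2[where f = "(*)"] score_local[of _ l]) (auto simp: fa)
  have "(\<Sum>i\<in>cells. joint x i * (score x a i * score x b i)) =
      sum_out L (H l) (sum_out L (R l) (\<lambda>i. head x (Suc l) i * (score x a i * score x b i))) i"
    by (rule expectation_local[OF l i locG])
  also have "\<dots> = sum_out L (H l) (\<lambda>j. (if restrict j (S l) = s then ?c else 0) * head x l j) i"
  proof (rule sum_out_cong[OF _ i])
    fix j assume j: "j \<in> cells"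
    have "head x (Suc l) (override_on j r (R l)) * (score x a (override_on j r (R l)) * score x b (override_on j r (R l))) =
        head x l j * ((if restrict j (S l) = s then entry_slope a r * entry_slope b r / entry x (l, s) r else 0))"
      if r: "r \<in> Pi\<^sub>E (R l) L" for r
    proof -
      let ?j = "override_on j r (R l)"
      have c: "?j \<in> cells" using override_cells j r parts_subset[OF l] by blast
      have "kernel x l ?j = entry x (l, restrict j (S l)) r"
        using restrict_override_R[OF r, of j] by (simp add: kernel_def)
      then show ?thesis
        using kernel_pos[OF x c l] head_override[of x l j r] restrict_override_R[OF r, of j]
        by (simp add: head_def score_def fa)
    qed
    then have "sum_out L (R l) (\<lambda>i. head x (Suc l) i * (score x a i * score x b i)) j =
        head x l j * (\<Sum>r\<in>Pi\<^sub>E (R l) L. if restrict j (S l) = s then entry_slope a r * entry_slope b r / entry x (l, s) r else 0)"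
      unfolding sum_out_def sum_distrib_left by (rule sum.cong[OF refl])
    then show "sum_out L (R l) (\<lambda>i. head x (Suc l) i * (score x a i * score x b i)) j =
        (if restrict j (S l) = s then ?c else 0) * head x l j"
      using sum_entry_slope_product[OF g a b, of x] by simp
  qed (use parts_subset[OF l] in auto)
  \<comment> \<open>Splitting \<open>H l\<close> at the separator: the condition on \<open>s\<close>
    is constant in the inner sum, which becomes \<open>separator_prob\<close>, and the outer sum
    then retains the single value \<open>s\<close>.\<close>
  also have "\<dots> = sum_out L (S l \<union> (H l - S l)) (\<lambda>j. (if restrict j (S l) = s then ?c else 0) * head x l j) i"
    using separator_residual(1)[of l] by (simp add: Un_absorb1)
  also have "\<dots> = sum_out L (S l) (sum_out L (H l - S l) (\<lambda>j. (if restrict j (S l) = s then ?c else 0) * head x l j)) i"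
    by (rule sum_out_Un) auto
  also have "\<dots> = sum_out L (S l) (\<lambda>j. (if restrict j (S l) = s then ?c else 0) * separator_prob x l j) i"
  proof (rule sum_out_cong[OF _ i])
    fix j :: "'v \<Rightarrow> 'l"
    have "restrict (override_on j r (H l - S l)) (S l) = restrict j (S l)" for r :: "'v \<Rightarrow> 'l"
      by (auto simp: override_on_def fun_eq_iff)
    then show "sum_out L (H l - S l) (\<lambda>j. (if restrict j (S l) = s then ?c else 0) * head x l j) j =
        (if restrict j (S l) = s then ?c else 0) * separator_prob x l j"
      unfolding separator_prob_def by (intro sum_out_mult_left) simp
  qed (use parts_subset[OF l] in auto)
  also have "\<dots> = (\<Sum>r\<in>Pi\<^sub>E (S l) L. if r = s then ?c * separator_prob x l s else 0)"
    unfolding sum_out_def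
  proof (rule sum.cong[OF refl])
    fix r assume r: "r \<in> Pi\<^sub>E (S l) L"
    have e: "restrict (override_on i r (S l)) (S l) = r"
      using r by (auto simp: override_on_def fun_eq_iff PiE_iff extensional_def)
    have "separator_prob x l (override_on i r (S l)) = separator_prob x l r"
      using separator_prob_restrict[of x l "override_on i r (S l)"] by (simp only: e)
    then show "(if restrict (override_on i r (S l)) (S l) = s then ?c else 0) * separator_prob x l (override_on i r (S l)) =
        (if r = s then ?c * separator_prob x l s else 0)"
      unfolding e by simp
  qed
  also have "\<dots> = separator_prob x l s * ?c"
    using s finite_cells parts_subset[OF l] by simp
  finally show ?thesis .
qed

text \<open>For different clique positions the earlier score is a function of the coordinates
  preceding the later one, whose conditional mean is zero. At the same position the separator values
  differ, and the scores have disjoint supports.\<close>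

lemma expectation_score_distinct_groups:
  assumes x: "x \<in> param_space" and g: "g \<in> cond_groups L Cs" "a \<in> gc g" and h: "h \<in> cond_groups L Cs" "b \<in> gc h"
    and "g \<noteq> h"
  shows "(\<Sum>i\<in>cells. joint x i * (score x a i * score x b i)) = 0"
proof -
  obtain l s where ls: "g = (l, s)" by (cases g)
  obtain l' s' where ls': "h = (l', s')" by (cases h)
  have fa: "fst a = (l, s)" "fst b = (l', s')" using g h by (auto simp: ls ls' gc_eq)
  have loc: "score x a i = score x a j"
    if "fst (fst a) < m" "\<And>v. v \<in> H m \<Longrightarrow> i v = j v" for a m i j
    using that separator_residual(9)[of "fst (fst a)"] H_mono[of "Suc (fst (fst a))" m]
    by (intro score_local[OF refl]) auto
  consider "l < l'" | "l' < l" | "l = l'" by linarith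
  then show ?thesis
  proof cases
    case 1
    show ?thesis
      using h 1 unfolding ls' by (intro expectation_mult_score[OF x, of l' s']) (auto intro!: loc[of a l'] simp: fa)
  next
    case 2
    have "(\<Sum>i\<in>cells. joint x i * (score x b i * score x a i)) = 0"
      using g 2 unfolding ls by (intro expectation_mult_score[OF x, of l s]) (auto intro!: loc[of b l] simp: fa)
    then show ?thesis by (simp only: mult.commute[of "score x a _"])
  next
    case 3
    then have "s \<noteq> s'" using assms(6) by (simp add: ls ls')
    then have z: "score x a i * score x b i = 0" for i by (auto simp: score_def fa 3)
    show ?thesis unfolding z by simp
  qed
qed

section \<open>Bounds, locality and measurability of separator probabilities\<close>

lemma separator_prob_le_1:
  assumes x: "x \<in> param_space" and g: "(l, s) \<in> cond_groups L Cs"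
  shows "separator_prob x l s \<le> 1"
proof -
  have l: "l < k" using g by (simp add: cond_groups_iff)
  obtain i where i: "i \<in> cells" "restrict i (S l) = s" using group_cell[OF g omit[OF g]] .
  have "separator_prob x l s = marginal V L (S l) (joint x) s"
    using sum_out_separator[OF i(1) l] marginal_eq_sum_out[OF i(1) parts_subset(4)[OF l]] i(2) by simp
  also have "\<dots> \<le> (\<Sum>i\<in>cells. joint x i)"
    unfolding marginal_def using joint_pos[OF x] finite_cells[of V]
    by (intro sum_mono2) (auto intro: less_imp_le)
  finally show ?thesis by (simp add: sum_joint)
qed

text \<open>A single summand suffices: for one cell with separator value \<open>s\<close>, the
  product of its kernels before \<open>l\<close> has one entry per position, each at least the
  product of all entries of its group. The remaining groups contribute factors at most one.\<close>

lemma separator_prob_ge: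
  assumes x: "x \<in> param_space" and g: "(l, s) \<in> cond_groups L Cs"
  shows "(\<Prod>g\<in>cond_groups L Cs. simplex_prod (gc g) x) \<le> separator_prob x l s"
proof -
  have l: "l < k" using g by (simp add: cond_groups_iff)
  obtain i where i: "i \<in> cells" "restrict i (S l) = s" using group_cell[OF g omit[OF g]] .
  have fin: "finite (cond_groups L Cs)"
    unfolding cond_groups_def using finite_cells parts_subset(4) by (intro finite_SigmaI) auto
  have sp: "0 \<le> simplex_prod (gc h) x" "simplex_prod (gc h) x \<le> 1" if "h \<in> cond_groups L Cs" for h
    using param_space_simplex[OF x that] finite_gc[of "fst h" "snd h"] that
    by (auto intro: less_imp_le simplex_prod_pos simplex_prod_le_1)
  \<comment> \<open>The groups that the cell \<open>i\<close> selects at the earlier positions; they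
    are distinct because their positions are.\<close>
  let ?G = "(\<lambda>j. (j, restrict i (S j))) ` {..<l}"
  have sub: "?G \<subseteq> cond_groups L Cs" using group_of_cell[OF i(1)] l by auto
  have "(\<Prod>g\<in>cond_groups L Cs. simplex_prod (gc g) x) =
      (\<Prod>g\<in>cond_groups L Cs - ?G. simplex_prod (gc g) x) * (\<Prod>g\<in>?G. simplex_prod (gc g) x)"
    using fin sub by (rule prod.subset_diff[rotated])
  also have "\<dots> \<le> 1 * (\<Prod>g\<in>?G. simplex_prod (gc g) x)"
    using sp group_of_cell[OF i(1)] l by (intro mult_right_mono prod_le_1 prod_nonneg) auto
  also have "\<dots> = (\<Prod>j<l. simplex_prod (gc (j, restrict i (S j))) x)"
    by (subst prod.reindex) (auto simp: inj_on_def)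
  also have "\<dots> \<le> head x l i"
    unfolding head_def
  proof (intro prod_mono conjI)
    fix j assume "j \<in> {..<l}"
    then have j: "j < k" using l by simp
    note gj = group_of_cell[OF i(1) j]
    show "0 \<le> simplex_prod (gc (j, restrict i (S j))) x" by (rule sp(1)[OF gj])
    show "simplex_prod (gc (j, restrict i (S j))) x \<le> kernel x j i"
      unfolding kernel_def using restrict_cells[OF i(1) parts_subset(1)[OF j]]
      by (intro entry_ge_simplex_prod gj param_space_simplex[OF x gj])
  qed
  also have "\<dots> = head x l (override_on i (restrict i (H l - S l)) (H l - S l))"
    by (intro head_local) (auto simp: override_on_def)
  also have "\<dots> \<le> sum_out L (H l - S l) (head x l) i"
    unfolding sum_out_def
  proof (rule member_le_sum)
    show "restrict i (H l - S l) \<in> Pi\<^sub>E (H l - S l) L" using restrict_cells i parts_subset[OF l] by blast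
    show "finite (Pi\<^sub>E (H l - S l) L)" using finite_cells parts_subset[OF l] by blast
    fix r assume r: "r \<in> Pi\<^sub>E (H l - S l) L - {restrict i (H l - S l)}"
    have "override_on i r (H l - S l) \<in> cells" using override_cells[OF i(1) parts_subset(2)[OF l]] r by blast
    then show "0 \<le> head x l (override_on i r (H l - S l))"
      unfolding head_def using kernel_pos[OF x] l by (intro prod_nonneg) (auto intro: less_imp_le)
  qed
  also have "\<dots> = separator_prob x l s"
    using separator_prob_restrict[of x l i] i(2) by (simp add: separator_prob_def)
  finally show ?thesis .
qed

text \<open>A partial cell \<open>s\<close> becomes defined on all of \<open>H l\<close> once
  \<open>H l - S l\<close> is overwritten, and \<open>H l\<close> contains every earlier clique; so
  the entries occurring in \<open>separator_prob\<close> belong to genuine groups.\<close>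

lemma restrict_override_separator:
  assumes "(l, s) \<in> cond_groups L Cs" "r \<in> Pi\<^sub>E (H l - S l) L" "j < l" "D \<subseteq> Cs ! j"
  shows "restrict (override_on s r (H l - S l)) D \<in> Pi\<^sub>E D L"
proof -
  have "D \<subseteq> H l" using assms(3,4) by (auto simp: H_def)
  then show ?thesis
    using assms(1,2) by (auto simp: cond_groups_iff override_on_def PiE_iff)
qed

lemma separator_prob_cong:
  assumes g: "(l, s) \<in> cond_groups L Cs"
    and eq: "\<And>a. a \<in> cond_coords L Cs omit \<Longrightarrow> a \<notin> gc (l, s) \<Longrightarrow> x a = y a"
  shows "separator_prob x l s = separator_prob y l s"
  unfolding separator_prob_def sum_out_def head_def kernel_def
proof (intro sum.cong prod.cong refl entry_cong)
  fix r j assume r: "r \<in> Pi\<^sub>E (H l - S l) L" and j: "j \<in> {..<l}"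
  note res = restrict_override_separator[OF g r]
  show "restrict (override_on s r (H l - S l)) (R j) \<in> Pi\<^sub>E (R j) L"
    using res j separator_residual(3)[of j] by simp
  fix a assume a: "a \<in> gc (j, restrict (override_on s r (H l - S l)) (S j))"
  have "j < k" using g j by (auto simp: cond_groups_iff)
  then have "(j, restrict (override_on s r (H l - S l)) (S j)) \<in> cond_groups L Cs"
    using res[of j "S j"] j separator_residual(2)[of j] by (simp add: cond_groups_iff)
  then have "a \<in> cond_coords L Cs omit" using gc_subset a by blast
  then show "x a = y a" using a j by (intro eq) (auto simp: gc_eq)
qed

lemma entry_measurable:
  assumes g: "(l, s) \<in> cond_groups L Cs" and r: "r \<in> Pi\<^sub>E (R l) L"
  shows "(\<lambda>x. entry x (l, s) r) \<in> borel_measurable (coord_lebesgue (cond_coords L Cs omit))"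
proof (cases "r = omit (l, s)")
  case True
  then show ?thesis
    using gc_subset[OF g] unfolding entry_def coord_lebesgue_def
    by (auto intro!: borel_measurable_diff borel_measurable_sum coord_measurable)
next
  case False
  then have "((l, s), r) \<in> cond_coords L Cs omit" using r gc_subset[OF g] by (auto simp: gc_eq)
  then show ?thesis using False unfolding entry_def coord_lebesgue_def by (auto intro!: coord_measurable)
qed

lemma separator_prob_measurable:
  assumes g: "(l, s) \<in> cond_groups L Cs"
  shows "(\<lambda>x. separator_prob x l s) \<in> borel_measurable (coord_lebesgue (cond_coords L Cs omit))"
  unfolding separator_prob_def sum_out_def head_def kernel_def
proof (intro borel_measurable_sum borel_measurable_prod entry_measurable)
  fix r j assume r: "r \<in> Pi\<^sub>E (H l - S l) L" and j: "j \<in> {..<l}"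
  note res = restrict_override_separator[OF g r]
  show "restrict (override_on s r (H l - S l)) (R j) \<in> Pi\<^sub>E (R j) L"
    using res j separator_residual(3)[of j] by simp
  have "j < k" using g j by (auto simp: cond_groups_iff)
  then show "(j, restrict (override_on s r (H l - S l)) (S j)) \<in> cond_groups L Cs"
    using res[of j "S j"] j separator_residual(2)[of j] by (simp add: cond_groups_iff)
qed

section \<open>The reference prior of the conditional parametrization\<close>

abbreviation "model_prob N \<equiv> \<lambda>x. multinomial_prob cells N (cell_prob V E L Cs omit x)"

lemma fisher_info_scores:
  assumes x: "x \<in> param_space" and g: "g \<in> cond_groups L Cs" "a \<in> gc g" and h: "h \<in> cond_groups L Cs" "b \<in> gc h"
  shows "fisher_info (count_vectors cells N) (model_prob N) x a b =
    real N * (\<Sum>i\<in>cells. joint x i * (score x a i * score x b i))"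
proof -
  let ?P = "cell_prob V E L Cs omit"
  have P: "?P x = joint x" by (rule cell_prob_eq[OF x])
  have d: "((\<lambda>t. ln (?P (x(a := t)) i)) has_real_derivative score x a i) (at (x a))"
    and c: "(\<Sum>i\<in>cells. ?P x i * score x a i) = 0"
    and p: "\<forall>\<^sub>F t in nhds (x a). \<forall>i\<in>cells. 0 < ?P (x(a := t)) i"
    if g: "g \<in> cond_groups L Cs" "a \<in> gc g" and i: "i \<in> cells" for g a i
  proof -
    obtain l s where ls: "g = (l, s)" by (cases g)
    note ev = eventually_update_param_space[OF x g]
    have "\<forall>\<^sub>F t in nhds (x a). ln (?P (x(a := t)) i) = ln (joint (x(a := t)) i)"
      using ev by eventually_elim (simp add: cell_prob_eq)
    then show "((\<lambda>t. ln (?P (x(a := t)) i)) has_real_derivative score x a i) (at (x a))"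
      using ln_joint_derivative[OF x g[unfolded ls] i]
      by (rule DERIV_cong_ev[THEN iffD2, OF refl _ refl])
    show "(\<Sum>i\<in>cells. ?P x i * score x a i) = 0"
      unfolding P by (rule expectation_score[OF x g[unfolded ls]])
    show "\<forall>\<^sub>F t in nhds (x a). \<forall>i\<in>cells. 0 < ?P (x(a := t)) i"
      using ev by eventually_elim (simp add: cell_prob_eq joint_pos)
  qed
  obtain i where i: "i \<in> cells" using cells_nonempty[of V] by auto
  have "fisher_info (count_vectors cells N) (model_prob N) x a b =
      real N * (\<Sum>i\<in>cells. ?P x i * (score x a i * score x b i))"
  proof (rule fisher_info_multinomial)
    show "finite cells" by (rule finite_cells) simp
    show "(\<Sum>i\<in>cells. ?P x i) = 1" unfolding P by (rule sum_joint)
    show "0 < ?P x i" if "i \<in> cells" for i unfolding P using joint_pos[OF x that] .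
  qed (rule d[OF g] c[OF g i] p[OF g i] d[OF h] c[OF h i] p[OF h i]; assumption)+
  then show ?thesis unfolding P .
qed

lemma conditional_joint:
  assumes "x \<in> param_space" "(l, s) \<in> cond_groups L Cs" "r \<in> Pi\<^sub>E (R l) L"
  shows "conditional V L (R l) (S l) (joint x) r s = entry x (l, s) r"
  using p_cond_entry(2)[OF joint_mem[OF assms(1)] assms(2,3)] p_cond_joint[OF assms(1)] by simp

lemma k_pos: "0 < k"
  using clique_exists[of "{}"] by (auto simp: complete_set_def)

lemma prod_groups_eq:
  assumes x: "x \<in> param_space"
  shows "(\<Prod>i\<in>Pi\<^sub>E (Cs ! 0) L. marginal V L (Cs ! 0) (joint x) i) powr (- 1 / 2) *
      (\<Prod>l\<in>{1..<k}. \<Prod>s\<in>Pi\<^sub>E (S l) L. (\<Prod>r\<in>Pi\<^sub>E (R l) L. conditional V L (R l) (S l) (joint x) r s) powr (- 1 / 2)) =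
    (\<Prod>g\<in>cond_groups L Cs. simplex_prod (gc g) x powr (-1/2))"
proof -
  let ?F = "\<lambda>l s. (\<Prod>r\<in>Pi\<^sub>E (R l) L. conditional V L (R l) (S l) (joint x) r s) powr (- 1 / 2)"
  have F: "?F l s = simplex_prod (gc (l, s)) x powr (-1/2)" if "(l, s) \<in> cond_groups L Cs" for l s
    using conditional_joint[OF x that] prod_entry[OF that, of x] by simp
  have S0: "S 0 = {}" and R0: "R 0 = Cs ! 0" by (auto simp: separator_def residual_def)
  \<comment> \<open>The empty separator has one value, the everywhere undefined function, with
    marginal equal to the total mass one. Hence the conditional probabilities at position 0 are the
    marginal ones of the first clique.\<close>
  have "restrict i {} = (\<lambda>_. undefined)" for i :: "'v \<Rightarrow> 'l" by auto
  then have "marginal V L {} (joint x) (\<lambda>_. undefined) = 1"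
    using sum_joint[of x] by (simp add: marginal_def)
  moreover have "merge (Cs ! 0) {} (r, s) = r" if "r \<in> Pi\<^sub>E (Cs ! 0) L" for r s
    using that by (auto simp: merge_def fun_eq_iff PiE_iff extensional_def)
  ultimately have "(\<Prod>i\<in>Pi\<^sub>E (Cs ! 0) L. marginal V L (Cs ! 0) (joint x) i) powr (- 1 / 2) =
      (\<Prod>s\<in>Pi\<^sub>E (S 0) L. ?F 0 s)"
    by (simp add: S0 R0 conditional_def cong: prod.cong)
  then have "(\<Prod>i\<in>Pi\<^sub>E (Cs ! 0) L. marginal V L (Cs ! 0) (joint x) i) powr (- 1 / 2) *
      (\<Prod>l\<in>{1..<k}. \<Prod>s\<in>Pi\<^sub>E (S l) L. ?F l s) = (\<Prod>l\<in>insert 0 {1..<k}. \<Prod>s\<in>Pi\<^sub>E (S l) L. ?F l s)"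
    by simp
  also have "insert 0 {1..<k} = {..<k}" using k_pos by auto
  also have "(\<Prod>l<k. \<Prod>s\<in>Pi\<^sub>E (S l) L. ?F l s) = (\<Prod>(l, s)\<in>cond_groups L Cs. ?F l s)"
    unfolding cond_groups_def using finite_cells parts_subset(4) by (intro prod.Sigma) auto
  also have "\<dots> = (\<Prod>g\<in>cond_groups L Cs. simplex_prod (gc g) x powr (-1/2))"
    using F by (intro prod.cong) auto
  finally show ?thesis .
qed

lemma reference_prior:
  fixes gs :: "(nat \<times> ('v \<Rightarrow> 'l)) list"
    and coord_list :: "nat \<times> ('v \<Rightarrow> 'l) \<Rightarrow> ((nat \<times> ('v \<Rightarrow> 'l)) \<times> ('v \<Rightarrow> 'l)) list"
  assumes N: "N \<ge> 1" and gs: "distinct gs" "set gs = cond_groups L Cs"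
    and cl: "\<And>g. g \<in> cond_groups L Cs \<Longrightarrow> distinct (coord_list g) \<and> set (coord_list g) = gc g"
  shows "\<exists>c>0. \<forall>\<pi>. is_reference_prior (count_vectors cells N) (model_prob N) param_space (map coord_list gs) \<pi> \<longleftrightarrow>
    (\<forall>x\<in>param_space. \<pi> x = c * (\<Prod>g\<in>cond_groups L Cs. simplex_prod (gc g) x powr (-1/2)))"
proof -
  let ?Gs = "map coord_list gs"
  \<comment> \<open>Here \<open>j\<close> is a position in the list \<open>gs\<close>, while the
    first component of \<open>gs ! j\<close> is a clique position; the two orders are
    unrelated.\<close>
  let ?M = "\<lambda>j x. separator_prob x (fst (gs ! j)) (snd (gs ! j))"
  have gsj: "gs ! j \<in> cond_groups L Cs" if "j < length ?Gs" for j
    using that gs(2) nth_mem[of j gs] by auto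
  have nth: "set (?Gs ! j) = gc (gs ! j)" if "j < length ?Gs" for j
    using cl gsj[OF that] that by simp
  have coords: "set (concat ?Gs) = cond_coords L Cs omit"
    using cl gs(2) by (auto simp: cond_coords_def)
  have dist: "distinct (concat ?Gs)"
  proof -
    have "distinct (concat (map coord_list hs))" if "distinct hs" "set hs \<subseteq> cond_groups L Cs" for hs
      using that
    proof (induction hs)
      case (Cons h hs)
      have "set (coord_list h) \<inter> set (coord_list h') = {}" if "h' \<in> set hs" for h'
        using that Cons.prems cl[of h] cl[of h'] group_coords_disjoint[of h h'] by auto
      then show ?case using Cons cl[of h] by auto
    qed simp
    then show ?thesis using gs by simp
  qed
  interpret block_diagonal_model "count_vectors cells N" "model_prob N" ?Gs "real N" ?M param_space
  proof (unfold_locales, goal_cases)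
    case 1
    show ?case by (rule dist)
  next
    case 2
    have "(\<forall>g\<in>cond_groups L Cs. x \<in> open_simplex (gc g)) \<longleftrightarrow> (\<forall>j<length ?Gs. x \<in> open_simplex (set (?Gs ! j)))" for x
      unfolding gs(2)[symmetric] all_set_conv_all_nth using nth by simp
    then show ?case unfolding coords param_space_def by simp
  next
    case 3
    show ?case using N by simp
  next
    case (4 x a b)
    obtain i where i: "i < length ?Gs" "a \<in> set (?Gs ! i)"
      using 4(2) by (metis in_set_conv_nth set_concat UN_E)
    obtain j where j: "j < length ?Gs" "b \<in> set (?Gs ! j)"
      using 4(3) by (metis in_set_conv_nth set_concat UN_E)
    have ia: "block_index ?Gs a = i" "block_index ?Gs b = j"
      using block_index_eq[OF dist] i j by auto
    have ag: "a \<in> gc (gs ! i)" "b \<in> gc (gs ! j)" using i j nth by auto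
    note fi = fisher_info_scores[OF 4(1) gsj[OF i(1)] ag(1) gsj[OF j(1)] ag(2), of N]
    show ?case
    proof (cases "i = j")
      case True
      obtain l s where ls: "gs ! j = (l, s)" by (cases "gs ! j")
      show ?thesis
        using expectation_score_same_group[OF 4(1), of l s a b] gsj[OF j(1)] ag True nth[OF j(1)]
        unfolding fi block_info_def ia by (simp add: ls)
    next
      case False
      then have "gs ! i \<noteq> gs ! j" using gs(1) i j by (simp add: nth_eq_iff_index_eq)
      then show ?thesis
        using expectation_score_distinct_groups[OF 4(1) gsj[OF i(1)] ag(1) gsj[OF j(1)] ag(2)] False
        unfolding fi block_info_def ia by simp
    qed
  next
    case (5 j x)
    have "(\<Prod>r<length ?Gs. simplex_prod (set (?Gs ! r)) x) = (\<Prod>r<length gs. simplex_prod (gc (gs ! r)) x)"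
      using nth by (intro prod.cong) auto
    also have "\<dots> = (\<Prod>g\<in>cond_groups L Cs. simplex_prod (gc g) x)"
      unfolding gs(2)[symmetric] using gs(1) by (intro prod.reindex_bij_betw bij_betw_nth) auto
    also have "\<dots> \<le> ?M j x" using separator_prob_ge[OF 5(2)] gsj[OF 5(1)] by simp
    finally show ?case .
  next
    case (6 j x)
    show ?case using separator_prob_le_1[OF 6(2)] gsj[OF 6(1)] by simp
  next
    case (7 j)
    show ?case unfolding coords using separator_prob_measurable gsj[OF 7] by simp
  next
    case (8 j x y)
    have "(fst (gs ! j), snd (gs ! j)) \<in> cond_groups L Cs" using gsj[OF 8(1)] by simp
    then show ?case
    proof (rule separator_prob_cong)
      fix a assume "a \<in> cond_coords L Cs omit" "a \<notin> gc (fst (gs ! j), snd (gs ! j))"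
      then show "x a = y a" using 8(2)[of a] unfolding coords nth[OF 8(1)] by simp
    qed
  qed
  \<comment> \<open>The product of the Dirichlet normalizations of the groups, fixed independently
    of \<open>\<pi>\<close> and of the order of the groups.\<close>
  let ?c = "\<Prod>g\<in>cond_groups L Cs. 1 / simplex_const (gc g)"
  have "(\<Prod>j<length ?Gs. prior_factor j x) = ?c * (\<Prod>g\<in>cond_groups L Cs. simplex_prod (gc g) x powr (-1/2))" for x
  proof -
    have "(\<Prod>j<length ?Gs. prior_factor j x) =
        (\<Prod>j<length gs. 1 / simplex_const (gc (gs ! j)) * simplex_prod (gc (gs ! j)) x powr (-1/2))"
      using nth by (intro prod.cong) (auto simp: prior_factor_def)
    also have "\<dots> = (\<Prod>g\<in>cond_groups L Cs. 1 / simplex_const (gc g) * simplex_prod (gc g) x powr (-1/2))"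
      unfolding gs(2)[symmetric] using gs(1)
      by (intro prod.reindex_bij_betw[where g = "\<lambda>g. 1 / simplex_const (gc g) * simplex_prod (gc g) x powr (-1/2)"]
          bij_betw_nth) auto
    finally show ?thesis by (simp only: prod.distrib)
  qed
  moreover have "0 < ?c"
    using simplex_const(2) finite_gc by (intro prod_pos) auto
  ultimately show ?thesis using is_reference_prior_iff by auto
qed

end

theorem proposition3p1:
  fixes V :: "'v set" and E :: "'v rel" and L :: "'v \<Rightarrow> 'l set" and Cs :: "'v set list"
    and N :: nat
    and omit :: "nat \<times> ('v \<Rightarrow> 'l) \<Rightarrow> 'v \<Rightarrow> 'l"
    and gs :: "(nat \<times> ('v \<Rightarrow> 'l)) list"
    and coord_list :: "nat \<times> ('v \<Rightarrow> 'l) \<Rightarrow> ((nat \<times> ('v \<Rightarrow> 'l)) \<times> ('v \<Rightarrow> 'l)) list"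
  assumes "finite V" and "V \<noteq> {}"
    and "E \<subseteq> V \<times> V" and "sym E" and "irrefl E"
    and "\<And>\<gamma>. \<gamma> \<in> V \<Longrightarrow> finite (L \<gamma>)"
    and "decomposable E V"
    and "perfect_clique_order V E Cs"
    and "N \<ge> 1"
    and "\<And>l s. (l, s) \<in> cond_groups L Cs \<Longrightarrow> omit (l, s) \<in> Pi\<^sub>E (residual Cs l) L"
    and "distinct gs" and "set gs = cond_groups L Cs"
    and "\<And>g. g \<in> cond_groups L Cs \<Longrightarrow>
          distinct (coord_list g) \<and> set (coord_list g) = group_coords L Cs omit g"
  shows "\<exists>c>0. \<forall>\<pi>.
    is_reference_prior
      (count_vectors (Pi\<^sub>E V L) N)
      (\<lambda>x. multinomial_prob (Pi\<^sub>E V L) N (cell_prob V E L Cs omit x))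
      (cond_space V E L Cs omit) (map coord_list gs) \<pi> \<longleftrightarrow>
    (\<forall>x\<in>cond_space V E L Cs omit. let p = cell_prob V E L Cs omit x in
      \<pi> x = c *
        ((\<Prod>i\<in>Pi\<^sub>E (Cs ! 0) L. marginal V L (Cs ! 0) p i) powr (- 1 / 2) *
         (\<Prod>l\<in>{1..<length Cs}. \<Prod>s\<in>Pi\<^sub>E (separator Cs l) L.
            (\<Prod>r\<in>Pi\<^sub>E (residual Cs l) L.
               conditional V L (residual Cs l) (separator Cs l) p r s) powr (- 1 / 2))))"
proof (cases "\<forall>\<gamma>\<in>V. L \<gamma> \<noteq> {}")
  \<comment> \<open>A vertex without levels leaves no cells, so no vector sums to one and the
    parameter space is empty. Both sides hold vacuously for every positive constant.\<close>
  case False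
  then have "Pi\<^sub>E V L = {}" by (auto simp: PiE_eq_empty_iff)
  then have "cond_space V E L Cs omit = {}" by (auto simp: cond_space_def markov_model_def)
  then show ?thesis by (auto simp: is_reference_prior_def intro!: exI[of _ 1])
next
  case True
  interpret clique_model V L E Cs omit
    using assms True by unfold_locales auto
  obtain c where c: "c > 0" and iff: "\<And>\<pi>. is_reference_prior (count_vectors (Pi\<^sub>E V L) N)
      (\<lambda>x. multinomial_prob (Pi\<^sub>E V L) N (cell_prob V E L Cs omit x)) param_space (map coord_list gs) \<pi> \<longleftrightarrow>
      (\<forall>x\<in>param_space. \<pi> x = c * (\<Prod>g\<in>cond_groups L Cs. simplex_prod (group_coords L Cs omit g) x powr (-1/2)))"
    using reference_prior[OF assms(9,11,12,13)] by blast
  show ?thesis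
    unfolding cond_space_eq iff Let_def
    by (intro exI[of _ c] conjI c allI ball_cong refl) (simp only: cell_prob_eq prod_groups_eq)
qed

end
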